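(* Assume that the following conditions hold for the $M$ candidate models $\mathfrak{M}_1,\dots,\mathfrak{M}_M$. (A1) There are constants $C\ge 0$, $C'\ge 0$ and $K>0$ such that (i) $\max_{i\in\{1,2,3\}}|\partial^i b(x)|\le K(1+|x|^{C})$ for all $x\in\mathbb{R}$; (ii) $E\big[|Y_j|^3\,\big|\,\mathcal{F}_{j-1}\vee\sigma(X_j)\big]\le K(1+|X_j|^{C'})$ a.s. for every $j\in\mathbb{N}$; (iii) $\sup_{j\in\mathbb{N}}E\big[|X_j|^{3C+C'+3}\big]<\infty$. (A2) There is a measurable function $F:\mathbb{R}^p\to\mathbb{R}$ with $E[Y_j\mid\mathcal{F}_{j-1}\vee\sigma(X_j)]=F(X_j)$ for every $j\in\mathbb{N}$. (A3) With $\zeta_j=(X_j,Y_j)$ and $\alpha(k):=\sup_{j\in\mathbb{N}}\sup\{|P[A\cap B]-P[A]P[B]| : A\in\sigma(\zeta_i;i\le j),\ B\in\sigma(\zeta_i;i\ge j+k)\}$, there is $c>0$ such that $\alpha(k)\le c^{-1}e^{-ck}$ for all $k\in\mathbb{N}$. (A4) There is a non-degenerate probability measure $\nu$ on $\mathbb{R}^p$ such that, for every $m\in\{1,\dots,M\}$ and every $\theta\in\Theta_m$, as $n\to\infty$, (i) $\frac1n\sum_{j=1}^n\big(F(X_j)X_j^{(m)\prime}\theta-b(X_j^{(m)\prime}\theta)\big)-\int\big(F(x)x^{(m)\prime}\theta-b(x^{(m)\prime}\theta)\big)\nu(dx)\to0$ in probability; (ii) $\frac1n\sum_{j=1}^n\partial^2b(X_j^{(m)\prime}\theta)X_j^{(m)}X_j^{(m)\prime}-\int\partial^2b(x^{(m)\prime}\theta)x^{(m)}x^{(m)\prime}\,\nu(dx)\to0$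 in probability. (A5) For every $m$ there is a function $\underline{b}_m:\mathbb{R}^p\to(0,\infty)$ such that (i) $\inf_{\theta\in\Theta_m}\partial^2b(x^{(m)\prime}\theta)\ge\underline{b}_m(x)$ for every $x$; (ii) for some constant $\lambda_0>0$, $\limsup_{n\to\infty}P\big[\lambda_{\min}\big(\frac1n\sum_{j=1}^n\underline{b}_m(X_j)X_j^{(m)}X_j^{(m)\prime}\big)<\lambda_0\big]=0$. (A6) For every $m$, $\frac{1}{\sqrt n}\sum_{j=1}^n\big(F(X_j)-\partial b(X_j^{(m)\prime}\theta_{m,0})\big)X_j^{(m)}=O_p(1)$. Assume moreover that there is a unique $m_0\in\{1,\dots,M\}$ such that $\mathfrak{M}_{m_0}$ is the optimal model. Fix any $m\in\{1,\dots,M\}\setminus\{m_0\}$. If either $\Theta_{m_0}$ is nested in $\Theta_m$, or $\mathbb{H}_{m,0}(\theta)\ne\mathbb{H}_{m_0,0}(\theta_{m_0,0})$ for every $\theta\in\Theta_m$, then $$\lim_{n\to\infty}P\big[\mathrm{QBIC}^{(m_0)}-\mathrm{QBIC}^{(m)}<0\big]=1.$$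
   Context: On a probability space, $Y_1,Y_2,\dots$ are real random variables and $X_j=(X_{j,1},\dots,X_{j,p})'$, $j\ge1$, are $\mathbb{R}^p$-valued random vectors; $'$ (or $\prime$) denotes transpose and $|\cdot|$ the Euclidean norm. $\mathcal{F}_j=\sigma(Y_i,X_i;i\le j)$, with $\mathcal{F}_0$ trivial. $\lambda_{\min}(\cdot)$ is the smallest eigenvalue of a symmetric matrix. $b:\mathbb{R}\to\mathbb{R}$ is a sufficiently smooth (at least three times continuously differentiable) convex function, the same for all candidate models, and $\partial^ib$ is its $i$-th derivative. Candidate models: for $m=1,\dots,M$, the model $\mathfrak{M}_m$ uses a subset $\{d_1(m),\dots,d_{p_m}(m)\}\subset\{1,\dots,p\}$ of the covariates and has as parameter space a bounded convex domain (open set) $\Theta_m\subset\mathbb{R}^{p_m}$, $p_m\le p$. Write $x^{(m)}=(x_{d_1(m)},\dots,x_{d_{p_m}(m)})'$ for $x\in\mathbb{R}^p$, and $X_j^{(m)}$ likewise. The logarithmic quasi-likelihood is $\mathbb{H}_{m,n}(\theta)=\sum_{j=1}^n\big(Y_jX_j^{(m)\prime}\theta-b(X_j^{(m)\prime}\theta)\big)$, and the quasi-maximum likelihood estimator $\hat\theta_{m,n}$ is any ($\Theta_m$-valued, random) maximizer of $\mathbb{H}_{m,n}$ over $\Theta_m$. With $F,\nu$ as in the claim, $\mathbb{H}_{m,0}(\theta)=\int\big(F(x)x^{(m)\prime}\theta-b(x^{(m)\prime}\theta)\big)\nu(dx)$, and $\theta_{m,0}\in\Theta_m$ is the unique maximizer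 of $\mathbb{H}_{m,0}$ over $\Theta_m$. Quasi-Bayesian information criterion: $$\mathrm{QBIC}^{(m)}=-2\sum_{j=1}^n\big(Y_jX_j^{(m)\prime}\hat\theta_{m,n}-b(X_j^{(m)\prime}\hat\theta_{m,n})\big)+\log\det\Big(\sum_{j=1}^n\partial^2b(X_j^{(m)\prime}\hat\theta_{m,n})X_j^{(m)}X_j^{(m)\prime}\Big).$$ Nestedness: $\Theta_i$ is nested in $\Theta_j$ if $p_i<p_j$ and there exist a matrix $A\in\mathbb{R}^{p_j\times p_i}$ with $A'A=I_{p_i\times p_i}$ and a vector $c\in\mathbb{R}^{p_j}$ such that, for all $\theta\in\Theta_i$ (and all $n$), $A\theta+c\in\Theta_j$ and $\mathbb{H}_{i,n}(\theta)=\mathbb{H}_{j,n}(A\theta+c)$. Optimal model: let $\mathcal{M}=\mathrm{argmax}_{m\in\{1,\dots,M\}}\mathbb{H}_{m,0}(\theta_{m,0})$. $\mathfrak{M}_{m_0}$ is the optimal model if $\{m_0\}=\mathrm{argmin}_{m\in\mathcal{M}}\dim(\Theta_m)$, where $\dim(\Theta_m)=p_m$. *)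

theory Defs
  imports "HOL-Probability.Probability" "Jordan_Normal_Form.Spectral_Radius"
begin

unbundle no vec_syntax
unbundle no inner_syntax

text \<open>
  The covariates live in the fixed space \<open>real ^ 'p\<close>.  The dimension of the parameter space differs
  from model to model, so parameters, selected covariates and information matrices are vectors and
  matrices of Jordan_Normal_Form, with explicit carriers; \<open>$\<close> and \<open>\<bullet>\<close> below are its operations.
\<close>


subsection \<open>Euclidean notions on carriers\<close>

definition vec_enorm :: "real vec \<Rightarrow> real" where
  "vec_enorm v = sqrt (v \<bullet> v)"

definition mat_fnorm :: "real mat \<Rightarrow> real" where
  "mat_fnorm A = sqrt (\<Sum>i<dim_row A. \<Sum>j<dim_col A. (A $$ (i, j))\<^sup>2)"

definition lambda_min :: "real mat \<Rightarrow> real" where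
  "lambda_min A = Min (spectrum A)"

definition bounded_convex_domain :: "nat \<Rightarrow> real vec set \<Rightarrow> bool" where
  "bounded_convex_domain k S \<longleftrightarrow>
     S \<subseteq> carrier_vec k \<and> S \<noteq> {} \<and>
     (\<forall>u\<in>S. \<exists>e>0. \<forall>v\<in>carrier_vec k. vec_enorm (v - u) < e \<longrightarrow> v \<in> S) \<and>
     (\<exists>R. \<forall>u\<in>S. vec_enorm u \<le> R) \<and>
     (\<forall>u\<in>S. \<forall>v\<in>S. \<forall>t\<in>{0..1}. (1 - t) \<cdot>\<^sub>v u + t \<cdot>\<^sub>v v \<in> S)"


subsection \<open>Stochastic notions\<close>

definition conv_to_0_in_prob :: "'w measure \<Rightarrow> (nat \<Rightarrow> 'w \<Rightarrow> real) \<Rightarrow> bool" where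
  "conv_to_0_in_prob \<Omega> Z \<longleftrightarrow>
     (\<forall>\<epsilon>>0. (\<lambda>n. \<P>(\<omega> in \<Omega>. \<epsilon> < \<bar>Z n \<omega>\<bar>)) \<longlonglongrightarrow> 0)"

definition bounded_in_prob :: "'w measure \<Rightarrow> (nat \<Rightarrow> 'w \<Rightarrow> real) \<Rightarrow> bool" where
  "bounded_in_prob \<Omega> Z \<longleftrightarrow>
     (\<forall>\<epsilon>>0. \<exists>R. \<exists>N. \<forall>n\<ge>N. \<P>(\<omega> in \<Omega>. R < \<bar>Z n \<omega>\<bar>) < \<epsilon>)"

definition generated :: "'w measure \<Rightarrow> nat set \<Rightarrow> (nat \<Rightarrow> 'w \<Rightarrow> 'b::topological_space) \<Rightarrow> 'w measure" where
  "generated \<Omega> I Z = sigma (space \<Omega>) (\<Union>i\<in>I. {Z i -` B \<inter> space \<Omega> | B. B \<in> sets borel})"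

definition sigma_join :: "'w measure \<Rightarrow> 'w measure \<Rightarrow> 'w measure \<Rightarrow> 'w measure" where
  "sigma_join \<Omega> G H = sigma (space \<Omega>) (sets G \<union> sets H)"

definition observation :: "(nat \<Rightarrow> 'w \<Rightarrow> 'x) \<Rightarrow> (nat \<Rightarrow> 'w \<Rightarrow> real) \<Rightarrow> nat \<Rightarrow> 'w \<Rightarrow> 'x \<times> real" where
  "observation X Y j \<omega> = (X j \<omega>, Y j \<omega>)"

text \<open>\<open>past \<Omega> X Y j\<close> is \<open>\<F>\<^sub>j\<^sub>-\<^sub>1 \<or> \<sigma>(X\<^sub>j)\<close>.\<close>

definition past ::
  "'w measure \<Rightarrow> (nat \<Rightarrow> 'w \<Rightarrow> real ^ 'p) \<Rightarrow> (nat \<Rightarrow> 'w \<Rightarrow> real) \<Rightarrow> nat \<Rightarrow> 'w measure" where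
  "past \<Omega> X Y j = sigma_join \<Omega> (generated \<Omega> {1..<j} (observation X Y)) (generated \<Omega> {j} X)"

definition mixing_coeff :: "'w measure \<Rightarrow> (nat \<Rightarrow> 'w \<Rightarrow> 'b::topological_space) \<Rightarrow> nat \<Rightarrow> real" where
  "mixing_coeff \<Omega> Z k =
     (SUP j\<in>{1..}. SUP (A, B)\<in>sets (generated \<Omega> {1..j} Z) \<times> sets (generated \<Omega> {j + k..} Z).
        \<bar>measure \<Omega> (A \<inter> B) - measure \<Omega> A * measure \<Omega> B\<bar>)"


subsection \<open>Candidate models, quasi-likelihood and criterion\<close>

text \<open>A candidate model selects covariates by the list \<open>ds = [d\<^sub>1, \<dots>, d\<^sub>p\<^sub>m]\<close> of their indices.\<close>

definition select :: "'p::finite list \<Rightarrow> real ^ 'p \<Rightarrow> real vec" where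
  "select ds x = Matrix.vec (length ds) (\<lambda>i. vec_nth x (ds ! i))"

definition quasi_loglik ::
  "(real \<Rightarrow> real) \<Rightarrow> (nat \<Rightarrow> 'w \<Rightarrow> real ^ 'p) \<Rightarrow> (nat \<Rightarrow> 'w \<Rightarrow> real) \<Rightarrow> 'p::finite list \<Rightarrow>
    nat \<Rightarrow> real vec \<Rightarrow> 'w \<Rightarrow> real" where
  "quasi_loglik b X Y ds n \<theta> \<omega> =
     (\<Sum>j=1..n. Y j \<omega> * (select ds (X j \<omega>) \<bullet> \<theta>) - b (select ds (X j \<omega>) \<bullet> \<theta>))"

definition quasi_loglik0 ::
  "(real \<Rightarrow> real) \<Rightarrow> (real ^ 'p \<Rightarrow> real) \<Rightarrow> (real ^ 'p) measure \<Rightarrow> 'p::finite list \<Rightarrow>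
    real vec \<Rightarrow> real" where
  "quasi_loglik0 b F \<nu> ds \<theta> = (\<integral>x. F x * (select ds x \<bullet> \<theta>) - b (select ds x \<bullet> \<theta>) \<partial>\<nu>)"

text \<open>\<open>weighted_gram ds n w x\<close> is the matrix \<open>\<Sum>\<^sub>j\<^sub>\<le>\<^sub>n w\<^sub>j x\<^sub>j\<^sup>(\<^sup>m\<^sup>) x\<^sub>j\<^sup>(\<^sup>m\<^sup>)'\<close>.\<close>

definition weighted_gram ::
  "'p::finite list \<Rightarrow> nat \<Rightarrow> (nat \<Rightarrow> real) \<Rightarrow> (nat \<Rightarrow> real ^ 'p) \<Rightarrow> real mat" where
  "weighted_gram ds n w x =
     Matrix.mat (length ds) (length ds)
       (\<lambda>(r, s). \<Sum>j=1..n. w j * (select ds (x j) $ r * select ds (x j) $ s))"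

definition information0 ::
  "(real \<Rightarrow> real) \<Rightarrow> (real ^ 'p) measure \<Rightarrow> 'p::finite list \<Rightarrow> real vec \<Rightarrow> real mat" where
  "information0 b \<nu> ds \<theta> =
     Matrix.mat (length ds) (length ds)
       (\<lambda>(r, s). \<integral>x. (deriv ^^ 2) b (select ds x \<bullet> \<theta>) * (select ds x $ r * select ds x $ s) \<partial>\<nu>)"

definition QBIC ::
  "(real \<Rightarrow> real) \<Rightarrow> (nat \<Rightarrow> 'w \<Rightarrow> real ^ 'p) \<Rightarrow> (nat \<Rightarrow> 'w \<Rightarrow> real) \<Rightarrow> 'p::finite list \<Rightarrow>
    nat \<Rightarrow> ('w \<Rightarrow> real vec) \<Rightarrow> 'w \<Rightarrow> real" where
  "QBIC b X Y ds n \<theta>hat \<omega> =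
     - 2 * quasi_loglik b X Y ds n (\<theta>hat \<omega>) \<omega> +
     ln (Determinant.det (weighted_gram ds n
       (\<lambda>j. (deriv ^^ 2) b (select ds (X j \<omega>) \<bullet> \<theta>hat \<omega>)) (\<lambda>j. X j \<omega>)))"

text \<open>
  Since \<open>\<Theta>\<close> is open, a maximizer may fail to exist for some \<open>n\<close> and \<open>\<omega>\<close> (e.g. logistic regression with
  \<open>n = 1\<close>).  The estimator is therefore a \<open>\<Theta>\<close>-valued random vector that is a maximizer whenever there
  is one; an estimator that maximizes for all \<open>\<omega>\<close> is a special case.
\<close>

definition is_QMLE ::
  "'w measure \<Rightarrow> (real \<Rightarrow> real) \<Rightarrow> (nat \<Rightarrow> 'w \<Rightarrow> real ^ 'p) \<Rightarrow> (nat \<Rightarrow> 'w \<Rightarrow> real) \<Rightarrow> 'p::finite list \<Rightarrow>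
    real vec set \<Rightarrow> nat \<Rightarrow> ('w \<Rightarrow> real vec) \<Rightarrow> bool" where
  "is_QMLE \<Omega> b X Y ds \<Theta> n \<theta>hat \<longleftrightarrow>
     (\<forall>i<length ds. (\<lambda>\<omega>. \<theta>hat \<omega> $ i) \<in> borel_measurable \<Omega>) \<and>
     (\<forall>\<omega>\<in>space \<Omega>. \<theta>hat \<omega> \<in> \<Theta> \<and>
        ((\<exists>\<theta>. is_arg_max (\<lambda>\<theta>. quasi_loglik b X Y ds n \<theta> \<omega>) (\<lambda>\<theta>. \<theta> \<in> \<Theta>) \<theta>) \<longrightarrow>
         is_arg_max (\<lambda>\<theta>. quasi_loglik b X Y ds n \<theta> \<omega>) (\<lambda>\<theta>. \<theta> \<in> \<Theta>) (\<theta>hat \<omega>)))"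

definition unique_maximizer :: "('c \<Rightarrow> real) \<Rightarrow> 'c set \<Rightarrow> 'c \<Rightarrow> bool" where
  "unique_maximizer f S x \<longleftrightarrow> (\<forall>y. is_arg_max f (\<lambda>z. z \<in> S) y \<longleftrightarrow> y = x)"

text \<open>\<open>nested_in \<Omega> k\<^sub>1 \<Theta>\<^sub>1 H\<^sub>1 k\<^sub>2 \<Theta>\<^sub>2 H\<^sub>2\<close>: \<open>\<Theta>\<^sub>1 \<subseteq> \<real>\<^sup>k\<^sup>1\<close> is nested in \<open>\<Theta>\<^sub>2 \<subseteq> \<real>\<^sup>k\<^sup>2\<close>; the
  quasi-likelihoods are random, and their equality is understood almost surely.\<close>

definition nested_in ::
  "'w measure \<Rightarrow> nat \<Rightarrow> real vec set \<Rightarrow> (nat \<Rightarrow> real vec \<Rightarrow> 'w \<Rightarrow> real) \<Rightarrow>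
    nat \<Rightarrow> real vec set \<Rightarrow> (nat \<Rightarrow> real vec \<Rightarrow> 'w \<Rightarrow> real) \<Rightarrow> bool" where
  "nested_in \<Omega> k\<^sub>1 \<Theta>\<^sub>1 H\<^sub>1 k\<^sub>2 \<Theta>\<^sub>2 H\<^sub>2 \<longleftrightarrow>
     k\<^sub>1 < k\<^sub>2 \<and>
     (\<exists>A\<in>carrier_mat k\<^sub>2 k\<^sub>1. \<exists>c\<in>carrier_vec k\<^sub>2.
        transpose_mat A * A = 1\<^sub>m k\<^sub>1 \<and>
        (\<forall>\<theta>\<in>\<Theta>\<^sub>1. A *\<^sub>v \<theta> + c \<in> \<Theta>\<^sub>2 \<and>
           (\<forall>n. AE \<omega> in \<Omega>. H\<^sub>1 n \<theta> \<omega> = H\<^sub>2 n (A *\<^sub>v \<theta> + c) \<omega>)))"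

text \<open>In \<open>optimal_model\<close>, \<open>v m\<close> is the maximal value \<open>\<H>\<^sub>m\<^sub>,\<^sub>0(\<theta>\<^sub>m\<^sub>,\<^sub>0)\<close> and \<open>k m\<close> the dimension of model \<open>m\<close>.\<close>

definition optimal_model :: "nat \<Rightarrow> (nat \<Rightarrow> real) \<Rightarrow> (nat \<Rightarrow> nat) \<Rightarrow> nat \<Rightarrow> bool" where
  "optimal_model M v k m\<^sub>0 \<longleftrightarrow>
     {m\<^sub>0} = {m. is_arg_min k (is_arg_max v (\<lambda>m. m \<in> {1..M})) m}"


subsection \<open>Assumptions\<close>

definition C3_function :: "(real \<Rightarrow> real) \<Rightarrow> bool" where
  "C3_function b \<longleftrightarrow>
     (\<forall>i<3. \<forall>x. (deriv ^^ i) b field_differentiable (at x)) \<and>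
     continuous_on UNIV ((deriv ^^ 3) b)"

text \<open>
  For exponent \<open>0\<close>, \<open>0 powr 0 = 0\<close> differs from the convention \<open>0\<^sup>0 = 1\<close>; this is absorbed by replacing
  the existentially quantified constant \<open>K\<close> by \<open>2 * K\<close>.
  The conditional moment of the nonnegative variable \<open>\<bar>Y\<^sub>j\<bar>\<^sup>3\<close> is taken in \<open>[0, \<infinity>]\<close>, so no integrability
  is presupposed.
\<close>

definition condition_A1 ::
  "'w measure \<Rightarrow> (real \<Rightarrow> real) \<Rightarrow> (nat \<Rightarrow> 'w \<Rightarrow> real ^ 'p) \<Rightarrow> (nat \<Rightarrow> 'w \<Rightarrow> real) \<Rightarrow> bool" where
  "condition_A1 \<Omega> b X Y \<longleftrightarrow>
     (\<exists>C\<ge>0. \<exists>C'\<ge>0. \<exists>K>0.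
        (\<forall>x. \<forall>i\<in>{1, 2, 3}. \<bar>(deriv ^^ i) b x\<bar> \<le> K * (1 + \<bar>x\<bar> powr C)) \<and>
        (\<forall>j\<ge>1. AE \<omega> in \<Omega>. nn_cond_exp \<Omega> (past \<Omega> X Y j) (\<lambda>\<omega>. ennreal (\<bar>Y j \<omega>\<bar> ^ 3)) \<omega>
                    \<le> ennreal (K * (1 + norm (X j \<omega>) powr C'))) \<and>
        (SUP j\<in>{1..}. \<integral>\<^sup>+\<omega>. ennreal (norm (X j \<omega>) powr (3 * C + C' + 3)) \<partial>\<Omega>) < \<infinity>)"

definition condition_A2 ::
  "'w measure \<Rightarrow> (nat \<Rightarrow> 'w \<Rightarrow> real ^ 'p) \<Rightarrow> (nat \<Rightarrow> 'w \<Rightarrow> real) \<Rightarrow> (real ^ 'p \<Rightarrow> real) \<Rightarrow> bool" where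
  "condition_A2 \<Omega> X Y F \<longleftrightarrow>
     F \<in> borel_measurable borel \<and>
     (\<forall>j\<ge>1. AE \<omega> in \<Omega>. real_cond_exp \<Omega> (past \<Omega> X Y j) (Y j) \<omega> = F (X j \<omega>))"

definition condition_A3 ::
  "'w measure \<Rightarrow> (nat \<Rightarrow> 'w \<Rightarrow> real ^ 'p) \<Rightarrow> (nat \<Rightarrow> 'w \<Rightarrow> real) \<Rightarrow> bool" where
  "condition_A3 \<Omega> X Y \<longleftrightarrow>
     (\<exists>c>0. \<forall>k\<ge>1. mixing_coeff \<Omega> (observation X Y) k \<le> inverse c * exp (- c * real k))"

text \<open>Non-degenerate means: not a point mass.\<close>

definition nondegenerate_law :: "(real ^ 'p) measure \<Rightarrow> bool" where
  "nondegenerate_law \<nu> \<longleftrightarrow>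
     prob_space \<nu> \<and> sets \<nu> = sets borel \<and> \<not> (\<exists>a. AE x in \<nu>. x = a)"

text \<open>
  The integrability conditions express that the integrals in the two limits exist; a Bochner integral
  of a non-integrable function would be \<open>0\<close>.
\<close>

definition condition_A4 ::
  "'w measure \<Rightarrow> (real \<Rightarrow> real) \<Rightarrow> (nat \<Rightarrow> 'w \<Rightarrow> real ^ 'p) \<Rightarrow> (real ^ 'p \<Rightarrow> real) \<Rightarrow>
    (real ^ 'p) measure \<Rightarrow> nat \<Rightarrow> (nat \<Rightarrow> 'p::finite list) \<Rightarrow> (nat \<Rightarrow> real vec set) \<Rightarrow> bool" where
  "condition_A4 \<Omega> b X F \<nu> M d \<Theta> \<longleftrightarrow>
     nondegenerate_law \<nu> \<and>
     (\<forall>m\<in>{1..M}. \<forall>\<theta>\<in>\<Theta> m.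
        integrable \<nu> (\<lambda>x. F x * (select (d m) x \<bullet> \<theta>) - b (select (d m) x \<bullet> \<theta>)) \<and>
        conv_to_0_in_prob \<Omega> (\<lambda>n \<omega>.
          1 / real n * (\<Sum>j=1..n. F (X j \<omega>) * (select (d m) (X j \<omega>) \<bullet> \<theta>)
                                    - b (select (d m) (X j \<omega>) \<bullet> \<theta>))
          - quasi_loglik0 b F \<nu> (d m) \<theta>) \<and>
        (\<forall>r<length (d m). \<forall>s<length (d m).
           integrable \<nu> (\<lambda>x. (deriv ^^ 2) b (select (d m) x \<bullet> \<theta>) *
                              (select (d m) x $ r * select (d m) x $ s))) \<and>
        conv_to_0_in_prob \<Omega> (\<lambda>n \<omega>. mat_fnorm
          ((1 / real n) \<cdot>\<^sub>m weighted_gram (d m) n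
              (\<lambda>j. (deriv ^^ 2) b (select (d m) (X j \<omega>) \<bullet> \<theta>)) (\<lambda>j. X j \<omega>)
           - information0 b \<nu> (d m) \<theta>)))"

text \<open>
  The lower bound \<open>bl\<close> is an arbitrary positive function.  That the events below are measurable is
  what it takes for their probabilities to be defined (the measure of a non-measurable set would be \<open>0\<close>).
\<close>

definition condition_A5 ::
  "'w measure \<Rightarrow> (real \<Rightarrow> real) \<Rightarrow> (nat \<Rightarrow> 'w \<Rightarrow> real ^ 'p) \<Rightarrow>
    nat \<Rightarrow> (nat \<Rightarrow> 'p::finite list) \<Rightarrow> (nat \<Rightarrow> real vec set) \<Rightarrow> bool" where
  "condition_A5 \<Omega> b X M d \<Theta> \<longleftrightarrow>
     (\<forall>m\<in>{1..M}. \<exists>bl :: real ^ 'p \<Rightarrow> real.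
        (\<forall>x. 0 < bl x) \<and>
        (\<forall>x. \<forall>\<theta>\<in>\<Theta> m. bl x \<le> (deriv ^^ 2) b (select (d m) x \<bullet> \<theta>)) \<and>
        (\<exists>l>0.
           (\<forall>n\<ge>1. {\<omega>\<in>space \<Omega>. lambda_min ((1 / real n) \<cdot>\<^sub>m
                weighted_gram (d m) n (\<lambda>j. bl (X j \<omega>)) (\<lambda>j. X j \<omega>)) < l} \<in> sets \<Omega>) \<and>
           limsup (\<lambda>n. ereal (\<P>(\<omega> in \<Omega>. lambda_min ((1 / real n) \<cdot>\<^sub>m
                weighted_gram (d m) n (\<lambda>j. bl (X j \<omega>)) (\<lambda>j. X j \<omega>)) < l))) = 0))"

definition condition_A6 ::
  "'w measure \<Rightarrow> (real \<Rightarrow> real) \<Rightarrow> (nat \<Rightarrow> 'w \<Rightarrow> real ^ 'p) \<Rightarrow> (real ^ 'p \<Rightarrow> real) \<Rightarrow>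
    nat \<Rightarrow> (nat \<Rightarrow> 'p::finite list) \<Rightarrow> (nat \<Rightarrow> real vec) \<Rightarrow> bool" where
  "condition_A6 \<Omega> b X F M d \<theta>\<^sub>0 \<longleftrightarrow>
     (\<forall>m\<in>{1..M}. bounded_in_prob \<Omega> (\<lambda>n \<omega>. vec_enorm
        ((1 / sqrt (real n)) \<cdot>\<^sub>v Matrix.vec (length (d m)) (\<lambda>i. \<Sum>j=1..n.
           (F (X j \<omega>) - deriv b (select (d m) (X j \<omega>) \<bullet> \<theta>\<^sub>0 m)) * select (d m) (X j \<omega>) $ i))))"

end

theory Submission
  imports Defs
begin

text \<open>
  By (A5) the quasi-log-likelihood \<open>\<H>\<^sub>n\<close> of a model is, with probability tending to one, concave on \<open>\<Theta>\<close>
  with curvature at least \<open>n l\<close>. The score at \<open>\<theta>\<^sub>0\<close> is \<open>O\<^sub>p(\<surd>n)\<close>: by (A2) the part containing \<open>Y\<^sub>j - F(X\<^sub>j)\<close>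
  is a martingale, whose increments are orthogonal in \<open>L\<^sup>2\<close> and bounded there by (A1); the remaining part is
  (A6). Comparing with a parabola, the estimator is an interior maximizer and \<open>\<H>\<^sub>n(\<theta>hat)\<close> exceeds
  \<open>\<H>\<^sub>n(\<theta>\<^sub>0)\<close> by \<open>O\<^sub>p(1)\<close>. All eigenvalues of the information matrix are of exact order \<open>n\<close>, so its
  log-determinant is \<open>dim(\<Theta>) ln n + O\<^sub>p(1)\<close>.

  If \<open>\<Theta>\<close> of the optimal model is nested, the law of large numbers and the uniqueness of the maximizer
  identify the two values \<open>\<H>\<^sub>n(\<theta>\<^sub>0)\<close>, and the difference of the dimensions decides, with the rate \<open>ln n\<close>.
  Otherwise the limits of \<open>\<H>\<^sub>n(\<theta>\<^sub>0) / n\<close> differ and the likelihoods decide, with the rate \<open>n\<close>.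
\<close>

subsection \<open>Symmetric matrices and compactness on carriers\<close>

text \<open>The estimator is random, and since \<open>\<Theta>\<close> is open it is known to be a
  maximizer only where one exists. Every bound that is later evaluated at the estimator is therefore
  proved for all points of \<open>\<Theta>\<close> on one event: the curvature bound, because (A5)
  provides one weight for the whole of \<open>\<Theta>\<close>, and the bound on the second
  derivatives of \<open>b\<close>, because \<open>\<Theta>\<close> is bounded. The curvature bound
  does double duty: it forces an interior maximizer to exist, and it bounds the information matrix
  from below at whatever point the estimator takes. What happens at a fixed \<open>\<omega>\<close>
  is separated from the probabilistic part, which only has to show that a few events are likely.

  Parameters live on carriers whose dimension varies with the model, so compactness is pulled back
  to functions on the naturals with the product topology. Rayleigh's principle, which links
  \<open>lambda_min\<close> to quadratic forms, rests on this compactness.\<close>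

lemma vec_enorm_sq:
  "(vec_enorm v)\<^sup>2 = v \<bullet> v"
  by (simp add: vec_enorm_def scalar_prod_def sum_nonneg)

lemma vec_enorm_nonneg [simp]:
  "0 \<le> vec_enorm v"
  by (simp add: vec_enorm_def scalar_prod_def sum_nonneg)

lemma abs_index_le_vec_enorm:
  assumes "i < dim_vec v"
  shows "\<bar>v $ i\<bar> \<le> vec_enorm v"
proof -
  have "(v $ i)\<^sup>2 \<le> v \<bullet> v"
    unfolding scalar_prod_def power2_eq_square
    by (rule member_le_sum[of i "{0..<dim_vec v}" "\<lambda>i. v $ i * v $ i"]) (use assms in auto)
  then show ?thesis
    unfolding vec_enorm_def by (metis real_sqrt_abs real_sqrt_le_mono)
qed

lemma abs_scalar_prod_le:
  assumes "dim_vec u = dim_vec v"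
  shows "\<bar>u \<bullet> v\<bar> \<le> vec_enorm u * vec_enorm v"
proof -
  have "(u \<bullet> v)\<^sup>2 \<le> (u \<bullet> u) * (v \<bullet> v)"
    using Cauchy_Schwarz_ineq_sum[of "\<lambda>i. u $ i" "\<lambda>i. v $ i" "{0..<dim_vec v}"] assms
    by (simp add: scalar_prod_def power2_eq_square)
  then have "sqrt ((u \<bullet> v)\<^sup>2) \<le> sqrt ((u \<bullet> u) * (v \<bullet> v))"
    by (rule real_sqrt_le_mono)
  then show ?thesis
    by (simp add: vec_enorm_def real_sqrt_mult)
qed

lemma continuous_on_scalar_prod_vec [continuous_intros]:
  "continuous_on UNIV (\<lambda>g :: nat \<Rightarrow> real. a \<bullet> Matrix.vec k g)"
  by (simp add: scalar_prod_def) (intro continuous_intros continuous_on_product_coordinates)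

lemma continuous_on_vec_enorm_diff:
  assumes "c \<in> carrier_vec k"
  shows "continuous_on UNIV (\<lambda>g :: nat \<Rightarrow> real. vec_enorm (Matrix.vec k g - c))"
  using assms
  by (simp add: vec_enorm_def scalar_prod_def)
    (intro continuous_intros continuous_on_product_coordinates)

lemma vec_eq_vec_index:
  assumes "v \<in> carrier_vec k"
  shows "Matrix.vec k (\<lambda>i. if i < k then v $ i else 0) = v"
  using assms by (auto intro!: eq_vecI)

text \<open>Compactness is obtained after pulling \<open>f\<close> and \<open>S\<close> back along
  \<open>Matrix.vec k\<close> to functions on the naturals. \<open>Matrix.vec k g\<close> ignores
  \<open>g\<close> from index \<open>k\<close> on, so the pullback of \<open>S\<close> is unbounded
  in those coordinates; each vector is therefore represented by the function that vanishes
  there.\<close>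

lemma attains_max_carrier:
  fixes f :: "real vec \<Rightarrow> real"
  assumes f: "continuous_on UNIV (\<lambda>g. f (Matrix.vec k g))"
    and S: "closed {g. Matrix.vec k g \<in> S}" "S \<subseteq> carrier_vec k" "S \<noteq> {}"
    and R: "\<And>v. v \<in> S \<Longrightarrow> vec_enorm v \<le> R"
  shows "\<exists>v\<in>S. \<forall>u\<in>S. f u \<le> f v"
proof -
  \<comment> \<open>A box in the first \<open>k\<close> coordinates and a single point in all
    others; Tychonoff's theorem makes it compact.\<close>
  define K :: "(nat \<Rightarrow> real) set" where "K = PiE UNIV (\<lambda>i. if i < k then {-R..R} else {0})"
  have "compactin (product_topology (\<lambda>i. euclidean) UNIV) K"
    unfolding K_def compactin_PiE by auto
  then have "compact K"
    by (simp add: euclidean_product_topology)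
  then have comp: "compact ({g. Matrix.vec k g \<in> S} \<inter> K)"
    using S(1) by (rule closed_Int_compact[rotated])
  have mem: "(\<lambda>i. if i < k then v $ i else 0) \<in> {g. Matrix.vec k g \<in> S} \<inter> K" if "v \<in> S" for v
  proof -
    have v: "v \<in> carrier_vec k" using that S(2) by auto
    have "\<bar>v $ i\<bar> \<le> R" if "i < k" for i
      using abs_index_le_vec_enorm[of i v] R[OF \<open>v \<in> S\<close>] v that by auto
    then show ?thesis
      using v that by (fastforce simp: K_def vec_eq_vec_index[OF v] abs_le_iff)
  qed
  have "{g. Matrix.vec k g \<in> S} \<inter> K \<noteq> {}"
    using S(3) mem by blast
  from continuous_attains_sup[OF comp this continuous_on_subset[OF f subset_UNIV]]
  obtain g where g: "g \<in> {g. Matrix.vec k g \<in> S} \<inter> K"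
    "\<And>h. h \<in> {g. Matrix.vec k g \<in> S} \<inter> K \<Longrightarrow> f (Matrix.vec k h) \<le> f (Matrix.vec k g)"
    by blast
  show ?thesis
  proof (intro bexI[of _ "Matrix.vec k g"] ballI)
    fix u assume "u \<in> S"
    then have "u \<in> carrier_vec k" using S(2) by auto
    then show "f u \<le> f (Matrix.vec k g)"
      using g(2)[OF mem[OF \<open>u \<in> S\<close>]] vec_eq_vec_index[of u k] by metis
  qed (use g in auto)
qed

section \<open>Rayleigh's principle for the smallest eigenvalue\<close>

lemma zero_if_perturbation_nonneg:
  fixes a c :: real
  assumes "\<And>t. 0 \<le> 2 * t * a + t\<^sup>2 * c" and "0 \<le> a"
  shows "a = 0"
proof (rule ccontr)
  assume "a \<noteq> 0"
  then have a: "a > 0" using assms(2) by simp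
  \<comment> \<open>Small enough that \<open>s * c \<le> a\<close>. At \<open>t = - s\<close>, and
    after division by \<open>s\<close>, the assumption becomes
    \<open>0 \<le> - 2 * a + s * c\<close>, which is at most \<open>- a\<close>.\<close>
  define s where "s = a / (\<bar>c\<bar> + 1)"
  have s: "s > 0" using a by (simp add: s_def)
  have "s * c \<le> a"
  proof -
    have "s * c \<le> s * (\<bar>c\<bar> + 1)" using s by (intro mult_left_mono) auto
    then show ?thesis by (simp add: s_def)
  qed
  moreover have "0 \<le> 2 * (-s) * a + (-s)\<^sup>2 * c" by (rule assms(1))
  then have "0 \<le> s * (- 2 * a + s * c)" by (simp add: power2_eq_square algebra_simps)
  then have "0 \<le> - 2 * a + s * c" using s by (simp add: zero_le_mult_iff)
  ultimately show False using a by simp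
qed

text \<open>By symmetry the two cross terms agree. The lemma is applied to \<open>A\<close> and,
  with \<open>1\<^sub>m k\<close> in place of \<open>A\<close>, to the squared norm.\<close>

lemma quadratic_form_add_smult:
  fixes A :: "real mat"
  assumes A: "A \<in> carrier_mat k k" "transpose_mat A = A"
    and v: "v \<in> carrier_vec k" and w: "w \<in> carrier_vec k"
  shows "(v + t \<cdot>\<^sub>v w) \<bullet> (A *\<^sub>v (v + t \<cdot>\<^sub>v w)) =
    v \<bullet> (A *\<^sub>v v) + 2 * t * (w \<bullet> (A *\<^sub>v v)) + t\<^sup>2 * (w \<bullet> (A *\<^sub>v w))"
proof -
  have Av: "A *\<^sub>v v \<in> carrier_vec k" and Aw: "A *\<^sub>v w \<in> carrier_vec k"
    using A v w by auto
  have "v \<bullet> (A *\<^sub>v w) = w \<bullet> (A *\<^sub>v v)"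
    using transpose_vec_mult_scalar[OF A(1) w v] A(2) comm_scalar_prod[OF w Av] by simp
  moreover have "A *\<^sub>v (v + t \<cdot>\<^sub>v w) = A *\<^sub>v v + t \<cdot>\<^sub>v (A *\<^sub>v w)"
    using A v w by (simp add: mult_add_distrib_mat_vec mult_mat_vec)
  ultimately show ?thesis
    using v w Av Aw
    by (simp add: scalar_prod_add_distrib[of _ k] add_scalar_prod_distrib[of _ k]
        power2_eq_square algebra_simps)
qed

text \<open>Rayleigh's principle: the form attains its minimum \<open>e\<close> over the unit
  sphere, and a minimizer is an eigenvector for \<open>e\<close>. \<open>k > 0\<close> makes the
  sphere nonempty. The eigenvalue is delivered together with its bound so that
  \<open>Min (spectrum A)\<close> can be compared with it.\<close>

lemma minimal_eigenvalue_exists: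
  fixes A :: "real mat"
  assumes A: "A \<in> carrier_mat k k" "transpose_mat A = A" and k: "k > 0"
  shows "\<exists>e. eigenvalue A e \<and> (\<forall>u\<in>carrier_vec k. e * (u \<bullet> u) \<le> u \<bullet> (A *\<^sub>v u))"
proof -
  define S where "S = {v \<in> carrier_vec k. vec_enorm v = (1 :: real)}"
  have quad: "u \<bullet> (A *\<^sub>v u) = (\<Sum>i<k. u $ i * (\<Sum>j<k. A $$ (i, j) * u $ j))"
    if "u \<in> carrier_vec k" for u
    using A that by (simp add: scalar_prod_def row_def lessThan_atLeast0)
  have cont: "continuous_on UNIV (\<lambda>g. - (Matrix.vec k g \<bullet> (A *\<^sub>v Matrix.vec k g)))"
    by (simp add: quad) (intro continuous_intros continuous_on_product_coordinates)
  have "continuous_on UNIV (\<lambda>g. vec_enorm (Matrix.vec k g))"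
    by (simp add: vec_enorm_def scalar_prod_def)
      (intro continuous_intros continuous_on_product_coordinates)
  then have "closed {g. vec_enorm (Matrix.vec k g) = 1}"
    by (intro closed_Collect_eq) auto
  then have "closed {g. Matrix.vec k g \<in> S}" by (simp add: S_def)
  moreover have "unit_vec k 0 \<in> S"
    using k by (simp add: S_def vec_enorm_def)
  moreover have "S \<subseteq> carrier_vec k" and "\<And>v. v \<in> S \<Longrightarrow> vec_enorm v \<le> 1"
    by (auto simp: S_def)
  ultimately obtain v where v: "v \<in> S"
    and vmin: "\<And>u. u \<in> S \<Longrightarrow> - (u \<bullet> (A *\<^sub>v u)) \<le> - (v \<bullet> (A *\<^sub>v v))"
    using attains_max_carrier[OF cont, of S 1] by blast
  define e where "e = v \<bullet> (A *\<^sub>v v)"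
  have vc: "v \<in> carrier_vec k" and vv: "v \<bullet> v = 1"
    using v by (auto simp: S_def vec_enorm_def)
  have low: "e * (u \<bullet> u) \<le> u \<bullet> (A *\<^sub>v u)" if u: "u \<in> carrier_vec k" for u
  proof (cases "vec_enorm u = 0")
    case True
    then have "u \<bullet> u = 0" by (metis vec_enorm_sq zero_power2)
    then have "u = 0\<^sub>v k"
      using u abs_index_le_vec_enorm[of _ u] True by (intro eq_vecI) auto
    then show ?thesis using A by simp
  next
    case False
    define r where "r = 1 / vec_enorm u"
    have r: "r > 0" "r\<^sup>2 * (u \<bullet> u) = 1"
      using False vec_enorm_nonneg[of u] by (auto simp: r_def less_le power_divide vec_enorm_sq[symmetric])
    have "vec_enorm (r \<cdot>\<^sub>v u) = 1"
      using r(2) u by (simp add: vec_enorm_def power2_eq_square mult.assoc)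
    then have "r \<cdot>\<^sub>v u \<in> S" using u by (simp add: S_def)
    from vmin[OF this] have "e \<le> (r \<cdot>\<^sub>v u) \<bullet> (A *\<^sub>v (r \<cdot>\<^sub>v u))"
      by (simp add: e_def)
    also have "\<dots> = r\<^sup>2 * (u \<bullet> (A *\<^sub>v u))"
      using A u by (simp add: mult_mat_vec power2_eq_square)
    finally have "e * (r\<^sup>2 * (u \<bullet> u)) \<le> r\<^sup>2 * (u \<bullet> (A *\<^sub>v u))"
      using r(2) by simp
    then have "r\<^sup>2 * (e * (u \<bullet> u)) \<le> r\<^sup>2 * (u \<bullet> (A *\<^sub>v u))"
      by (simp add: mult.left_commute)
    then show ?thesis using r(1) by simp
  qed
  \<comment> \<open>The defect in the eigenvalue equation. It is also the direction of variation,
    because the derivative along it is \<open>2 * (w \<bullet> w)\<close>.\<close>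
  define w where "w = A *\<^sub>v v - e \<cdot>\<^sub>v v"
  have Av: "A *\<^sub>v v \<in> carrier_vec k" and w: "w \<in> carrier_vec k"
    using A vc by (auto simp: w_def)
  have wA: "w \<bullet> (A *\<^sub>v v) = w \<bullet> w + e * (w \<bullet> v)"
  proof -
    have "A *\<^sub>v v = w + e \<cdot>\<^sub>v v" using A Av vc by (intro eq_vecI) (auto simp: w_def)
    then show ?thesis using w vc by (simp add: scalar_prod_add_distrib[of _ k])
  qed
  \<comment> \<open>The form \<open>u \<mapsto> u \<bullet> A u - e (u \<bullet> u)\<close> is minimal at \<open>v\<close>, so its derivative in direction \<open>w\<close> vanishes.\<close>
  have "w \<bullet> w = 0"
  proof (rule zero_if_perturbation_nonneg)
    fix t :: real
    have "e * ((v + t \<cdot>\<^sub>v w) \<bullet> (v + t \<cdot>\<^sub>v w)) \<le> (v + t \<cdot>\<^sub>v w) \<bullet> (A *\<^sub>v (v + t \<cdot>\<^sub>v w))"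
      using vc w by (intro low) auto
    moreover have "(v + t \<cdot>\<^sub>v w) \<bullet> (v + t \<cdot>\<^sub>v w) = 1 + 2 * t * (w \<bullet> v) + t\<^sup>2 * (w \<bullet> w)"
      using quadratic_form_add_smult[of "1\<^sub>m k" k v w t] vc w vv by simp
    ultimately show "0 \<le> 2 * t * (w \<bullet> w) + t\<^sup>2 * (w \<bullet> (A *\<^sub>v w) - e * (w \<bullet> w))"
      using quadratic_form_add_smult[OF A vc w, of t] wA
      by (simp add: e_def[symmetric] algebra_simps)
  next
    show "0 \<le> w \<bullet> w" by (simp add: vec_enorm_sq[symmetric])
  qed
  then have "vec_enorm w = 0" by (simp add: vec_enorm_def)
  then have w0: "w $ i = 0" if "i < k" for i
    using abs_index_le_vec_enorm[of i w] w that by auto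
  have "A *\<^sub>v v = e \<cdot>\<^sub>v v"
  proof (rule eq_vecI)
    fix i assume "i < dim_vec (e \<cdot>\<^sub>v v)"
    then have i: "i < k" using vc by simp
    then show "(A *\<^sub>v v) $ i = (e \<cdot>\<^sub>v v) $ i"
      using w0[OF i] A Av vc by (simp add: w_def)
  qed (use A vc in auto)
  moreover have "v \<noteq> 0\<^sub>v k" using vv by auto
  ultimately have "eigenvalue A e"
    using A vc by (auto simp: eigenvalue_def eigenvector_def)
  then show ?thesis using low by blast
qed

text \<open>The eigenvalue \<open>e\<close> from Rayleigh's principle belongs to the finite
  spectrum, hence \<open>lambda_min A \<le> e\<close>.\<close>

lemma lambda_min_le_quadratic_form:
  assumes A: "A \<in> carrier_mat k k" "transpose_mat A = A" and k: "k > 0"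
    and u: "u \<in> carrier_vec k"
  shows "lambda_min A * (u \<bullet> u) \<le> u \<bullet> (A *\<^sub>v u)"
proof -
  obtain e where e: "eigenvalue A e" "e * (u \<bullet> u) \<le> u \<bullet> (A *\<^sub>v u)"
    using minimal_eigenvalue_exists[OF A k] u by blast
  have "lambda_min A \<le> e"
    unfolding lambda_min_def using e(1) card_finite_spectrum[OF A(1)]
    by (intro Min_le) (auto simp: spectrum_def)
  moreover have "0 \<le> u \<bullet> u" by (simp add: vec_enorm_sq[symmetric])
  ultimately show ?thesis
    using e(2) mult_right_mono[of "lambda_min A" e "u \<bullet> u"] by linarith
qed

section \<open>Upper and lower bounds for determinants\<close>

text \<open>Split an eigenvector into real and imaginary part \<open>x\<close> and \<open>y\<close>.
  Symmetry equates \<open>y \<bullet> (A *\<^sub>v x)\<close> with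
  \<open>x \<bullet> (A *\<^sub>v y)\<close>, which leaves
  \<open>Im z * (x \<bullet> x + y \<bullet> y) = 0\<close>. For the lower bound the estimates at
  \<open>x\<close> and at \<open>y\<close> are added, because one of the two vectors may be
  zero.\<close>

lemma complex_eigenvalue_symmetric_real:
  fixes A :: "real mat"
  assumes A: "A \<in> carrier_mat k k" "transpose_mat A = A"
    and low: "\<And>u. u \<in> carrier_vec k \<Longrightarrow> l * (u \<bullet> u) \<le> u \<bullet> (A *\<^sub>v u)"
    and ev: "eigenvalue (map_mat complex_of_real A) z"
  shows "Im z = 0 \<and> l \<le> Re z"
proof -
  let ?B = "map_mat complex_of_real A"
  obtain v where v: "v \<in> carrier_vec k" "v \<noteq> 0\<^sub>v k" "?B *\<^sub>v v = z \<cdot>\<^sub>v v"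
    using ev A by (auto simp: eigenvalue_def eigenvector_def)
  define x where "x = Matrix.vec k (\<lambda>i. Re (v $ i))"
  define y where "y = Matrix.vec k (\<lambda>i. Im (v $ i))"
  have xy: "x \<in> carrier_vec k" "y \<in> carrier_vec k" by (auto simp: x_def y_def)
  have Bv: "(\<Sum>j<k. complex_of_real (A $$ (i, j)) * v $ j) = z * v $ i" if "i < k" for i
  proof -
    have "(?B *\<^sub>v v) $ i = (\<Sum>j<k. complex_of_real (A $$ (i, j)) * v $ j)"
      using that A v(1) by (simp add: scalar_prod_def row_def lessThan_atLeast0)
    then show ?thesis using v(1,3) that by simp
  qed
  have Ax: "A *\<^sub>v x = Re z \<cdot>\<^sub>v x - Im z \<cdot>\<^sub>v y"
  proof (rule eq_vecI)
    fix i assume "i < dim_vec (Re z \<cdot>\<^sub>v x - Im z \<cdot>\<^sub>v y)"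
    then have i: "i < k" using xy by simp
    have "(A *\<^sub>v x) $ i = (\<Sum>j<k. A $$ (i, j) * Re (v $ j))"
      using i A by (simp add: scalar_prod_def row_def lessThan_atLeast0 x_def)
    also have "\<dots> = Re (z * v $ i)"
      unfolding Bv[OF i, symmetric] by simp
    finally show "(A *\<^sub>v x) $ i = (Re z \<cdot>\<^sub>v x - Im z \<cdot>\<^sub>v y) $ i"
      using i by (simp add: x_def y_def)
  qed (use A xy in auto)
  have Ay: "A *\<^sub>v y = Re z \<cdot>\<^sub>v y + Im z \<cdot>\<^sub>v x"
  proof (rule eq_vecI)
    fix i assume "i < dim_vec (Re z \<cdot>\<^sub>v y + Im z \<cdot>\<^sub>v x)"
    then have i: "i < k" using xy by simp
    have "(A *\<^sub>v y) $ i = (\<Sum>j<k. A $$ (i, j) * Im (v $ j))"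
      using i A by (simp add: scalar_prod_def row_def lessThan_atLeast0 y_def)
    also have "\<dots> = Im (z * v $ i)"
      unfolding Bv[OF i, symmetric] by simp
    finally show "(A *\<^sub>v y) $ i = (Re z \<cdot>\<^sub>v y + Im z \<cdot>\<^sub>v x) $ i"
      using i by (simp add: x_def y_def)
  qed (use A xy in auto)
  have "y \<bullet> (A *\<^sub>v x) = x \<bullet> (A *\<^sub>v y)"
    using transpose_vec_mult_scalar[OF A(1) xy] A xy comm_scalar_prod[of "A *\<^sub>v y" k x] by simp
  moreover have "y \<bullet> (A *\<^sub>v x) = Re z * (x \<bullet> y) - Im z * (y \<bullet> y)"
    unfolding Ax using xy by (simp add: scalar_prod_minus_distrib[of _ k] comm_scalar_prod[of y k x])
  moreover have "x \<bullet> (A *\<^sub>v y) = Re z * (x \<bullet> y) + Im z * (x \<bullet> x)"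
    unfolding Ay using xy by (simp add: scalar_prod_add_distrib[of _ k])
  ultimately have "Im z * (x \<bullet> x + y \<bullet> y) = 0" by (simp add: algebra_simps)
  moreover have pos: "x \<bullet> x + y \<bullet> y > 0"
  proof -
    have "\<exists>i<k. v $ i \<noteq> 0"
    proof (rule ccontr)
      assume "\<not> ?thesis"
      then have "v = 0\<^sub>v k" using v(1) by (intro eq_vecI) auto
      then show False using v(2) by simp
    qed
    then obtain i where i: "i < k" "v $ i \<noteq> 0" by blast
    then have "0 < (Re (v $ i))\<^sup>2 + (Im (v $ i))\<^sup>2"
      by (simp add: complex_neq_0)
    also have "\<dots> \<le> (\<Sum>i\<in>{0..<k}. (Re (v $ i))\<^sup>2 + (Im (v $ i))\<^sup>2)"
      using i(1) by (intro member_le_sum[of i]) auto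
    finally show ?thesis
      by (simp add: scalar_prod_def x_def y_def power2_eq_square sum.distrib)
  qed
  ultimately have im: "Im z = 0" by simp
  have "l * (x \<bullet> x + y \<bullet> y) \<le> Re z * (x \<bullet> x + y \<bullet> y)"
    using low[OF xy(1)] low[OF xy(2)] xy im
    by (simp add: Ax Ay scalar_prod_minus_distrib[of _ k] scalar_prod_add_distrib[of _ k]
        algebra_simps)
  then show ?thesis using pos im by simp
qed

text \<open>The characteristic polynomial splits over the complex numbers, and its value at 0 is the
  determinant up to the sign \<open>(-1) ^ k\<close>; so the determinant is the product of the
  roots. These are real and at least \<open>l\<close>, and \<open>0 \<le> l\<close> allows the
  inequalities to be multiplied.\<close>

lemma det_ge_power:
  fixes A :: "real mat"
  assumes A: "A \<in> carrier_mat k k" "transpose_mat A = A"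
    and low: "\<And>u. u \<in> carrier_vec k \<Longrightarrow> l * (u \<bullet> u) \<le> u \<bullet> (A *\<^sub>v u)"
    and l: "0 \<le> l"
  shows "l ^ k \<le> Determinant.det A"
proof -
  let ?B = "map_mat complex_of_real A"
  have B: "?B \<in> carrier_mat k k" using A by simp
  from char_poly_factorized[OF B] obtain as
    where as: "char_poly ?B = (\<Prod>a\<leftarrow>as. [:- a, 1:])" and len: "length as = k" by blast
  have re: "a = complex_of_real (Re a) \<and> l \<le> Re a" if "a \<in> set as" for a
  proof -
    have "poly (char_poly ?B) a = 0" unfolding as using that by (rule linear_poly_root)
    then have "eigenvalue ?B a" using eigenvalue_root_char_poly[OF B] by simp
    from complex_eigenvalue_symmetric_real[OF A low this] show ?thesis
      by (simp add: complex_eq_iff)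
  qed
  have "poly (char_poly ?B) 0 = Determinant.det (- (char_matrix ?B 0))"
    by (rule char_poly_matrix[OF B])
  also have "- (char_matrix ?B 0) = (-1) \<cdot>\<^sub>m ?B"
    using B by (intro eq_matI) (auto simp: char_matrix_def)
  also have "Determinant.det \<dots> = (-1) ^ k * complex_of_real (Determinant.det A)"
    using A by simp
  finally have "(-1) ^ k * complex_of_real (Determinant.det A) = (\<Prod>a\<leftarrow>as. - a)"
    by (simp add: as poly_prod_list comp_def)
  also have "(\<Prod>a\<leftarrow>as. - a) = (-1) ^ k * complex_of_real (\<Prod>a\<leftarrow>as. Re a)"
    unfolding len[symmetric] using re by (induction as) auto
  finally have det: "Determinant.det A = (\<Prod>a\<leftarrow>as. Re a)"
    by (metis minus_one_power_iff mult_cancel_left of_real_eq_iff power_eq_0_iff zero_neq_neg_one)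
  have "l ^ length as \<le> (\<Prod>a\<leftarrow>as. Re a)" using re
  proof (induction as)
    case (Cons a as)
    then have "l * l ^ length as \<le> Re a * (\<Prod>a\<leftarrow>as. Re a)"
      using l by (intro mult_mono) (auto intro: order_trans)
    then show ?case by simp
  qed simp
  then show ?thesis by (simp add: det len)
qed

text \<open>Leibniz formula, term by term. The crude factor \<open>fact k\<close> only adds a
  constant to the log-determinant.\<close>

lemma det_le_fact_power:
  fixes A :: "real mat"
  assumes A: "A \<in> carrier_mat k k"
    and R: "\<And>i j. i < k \<Longrightarrow> j < k \<Longrightarrow> \<bar>A $$ (i, j)\<bar> \<le> R"
  shows "Determinant.det A \<le> fact k * R ^ k"
proof -
  have "Determinant.det A \<le> (\<Sum>p\<in>{p. p permutes {0..<k}}. R ^ k)"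
    unfolding det_def'[OF A]
  proof (rule sum_mono)
    fix p assume p: "p \<in> {p. p permutes {0..<k}}"
    have "signof p * (\<Prod>i = 0..<k. A $$ (i, p i)) \<le> \<bar>\<Prod>i = 0..<k. A $$ (i, p i)\<bar>"
      by (cases p rule: sign_cases) auto
    also have "\<dots> \<le> (\<Prod>i = 0..<k. R)"
      unfolding abs_prod using p by (intro prod_mono) (auto intro!: R)
    finally show "signof p * (\<Prod>i = 0..<k. A $$ (i, p i)) \<le> R ^ k" by simp
  qed
  also have "\<dots> = fact k * R ^ k"
    by (simp add: card_permutations[of _ k])
  finally show ?thesis .
qed

subsection \<open>Concavity of the quasi-likelihood\<close>

text \<open>The gradient of \<open>quasi_loglik\<close> in \<open>\<theta>\<close>.\<close>

definition score ::
  "(real \<Rightarrow> real) \<Rightarrow> (nat \<Rightarrow> 'w \<Rightarrow> real ^ 'p) \<Rightarrow> (nat \<Rightarrow> 'w \<Rightarrow> real) \<Rightarrow> 'p::finite list \<Rightarrow>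
    nat \<Rightarrow> real vec \<Rightarrow> 'w \<Rightarrow> real vec" where
  "score b X Y ds n \<theta> \<omega> = Matrix.vec (length ds) (\<lambda>i. \<Sum>j=1..n.
     (Y j \<omega> - deriv b (select ds (X j \<omega>) \<bullet> \<theta>)) * select ds (X j \<omega>) $ i)"

lemma dim_select [simp]: "dim_vec (select ds x) = length ds"
  by (simp add: select_def)

lemma select_carrier [simp]: "select ds x \<in> carrier_vec (length ds)"
  by (simp add: select_def)

lemma abs_select_le_norm:
  assumes "i < length ds"
  shows "\<bar>select ds x $ i\<bar> \<le> norm x"
  using assms component_le_norm_cart[of x "ds ! i"] by (simp add: select_def)

lemma domain_carrier:
  assumes "bounded_convex_domain k \<Theta>" "\<theta> \<in> \<Theta>"
  shows "\<theta> \<in> carrier_vec k"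
  using assms by (auto simp: bounded_convex_domain_def)

lemma C3_function_DERIV:
  assumes "C3_function b"
  shows "DERIV b x :> deriv b x" "DERIV (deriv b) x :> (deriv ^^ 2) b x"
    "DERIV ((deriv ^^ 2) b) x :> (deriv ^^ 3) b x"
proof -
  have D: "\<And>i. i < 3 \<Longrightarrow> DERIV ((deriv ^^ i) b) x :> deriv ((deriv ^^ i) b) x"
    using assms by (simp add: C3_function_def DERIV_deriv_iff_field_differentiable)
  show "DERIV b x :> deriv b x" using D[of 0] by simp
  show "DERIV (deriv b) x :> (deriv ^^ 2) b x" using D[of 1] by (simp add: numeral_2_eq_2)
  show "DERIV ((deriv ^^ 2) b) x :> (deriv ^^ 3) b x" using D[of 2] by (simp add: numeral_3_eq_3 numeral_2_eq_2)
qed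

lemma C3_function_continuous:
  assumes "C3_function b"
  shows "continuous_on UNIV b" "continuous_on UNIV (deriv b)" "continuous_on UNIV ((deriv ^^ 2) b)"
  using C3_function_DERIV[OF assms]
  by (auto intro!: continuous_at_imp_continuous_on DERIV_isCont)

text \<open>Taylor expansion with Lagrange remainder. The second derivative is bounded on the
  segment from \<open>a\<close> to \<open>c\<close>, which is what convexity of
  \<open>\<Theta>\<close> yields for the linear predictors of two parameters.\<close>

lemma second_order_lower_bound:
  fixes b :: "real \<Rightarrow> real"
  assumes b: "C3_function b"
    and w: "\<And>t. t \<in> {0..1} \<Longrightarrow> w \<le> (deriv ^^ 2) b ((1 - t) * a + t * c)"
  shows "b a + deriv b a * (c - a) + w / 2 * (c - a)\<^sup>2 \<le> b c"
proof (cases "a = c")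
  case False
  have "\<exists>s. (if c < a then c < s \<and> s < a else a < s \<and> s < c) \<and>
    b c = (\<Sum>m<2. ((deriv ^^ m) b a / fact m) * (c - a) ^ m) + ((deriv ^^ 2) b s / fact 2) * (c - a)\<^sup>2"
  proof (rule Taylor[where a = "min a c" and b = "max a c"])
    show "\<forall>m t. m < 2 \<and> min a c \<le> t \<and> t \<le> max a c \<longrightarrow>
      DERIV ((deriv ^^ m) b) t :> (deriv ^^ Suc m) b t"
      using b by (auto simp: C3_function_def DERIV_deriv_iff_field_differentiable)
  qed (use False in auto)
  then obtain s where s: "if c < a then c < s \<and> s < a else a < s \<and> s < c"
    and eq: "b c = (\<Sum>m<2. ((deriv ^^ m) b a / fact m) * (c - a) ^ m) + ((deriv ^^ 2) b s / fact 2) * (c - a)\<^sup>2"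
    by blast
  define t where "t = (s - a) / (c - a)"
  have "t \<in> {0..1}" using s False by (auto simp: t_def divide_simps split: if_splits)
  moreover have "(1 - t) * a + t * c = a + t * (c - a)" by (simp add: algebra_simps)
  then have "(1 - t) * a + t * c = s" using False by (simp add: t_def)
  ultimately have "w \<le> (deriv ^^ 2) b s" using w[of t] by simp
  then have "w * (c - a)\<^sup>2 \<le> (deriv ^^ 2) b s * (c - a)\<^sup>2" by (intro mult_right_mono) auto
  then show ?thesis using eq by (simp add: numeral_2_eq_2)
qed simp

text \<open>The content of (A5) at a single \<open>\<omega>\<close>, written as a bound on a
  quadratic form. Since \<open>bl\<close> is uniform over \<open>\<Theta>\<close>, the same property
  controls the likelihood along segments and the information matrix at the estimator.\<close>

definition curvature_ge ::
  "(real \<Rightarrow> real) \<Rightarrow> 'p::finite list \<Rightarrow> real vec set \<Rightarrow> nat \<Rightarrow>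
    (nat \<Rightarrow> 'w \<Rightarrow> real ^ 'p) \<Rightarrow> 'w \<Rightarrow> real \<Rightarrow> bool" where
  "curvature_ge b ds \<Theta> n X \<omega> \<kappa> \<longleftrightarrow>
     (\<exists>bl. (\<forall>x. \<forall>\<theta>\<in>\<Theta>. bl x \<le> (deriv ^^ 2) b (select ds x \<bullet> \<theta>)) \<and>
       (\<forall>u\<in>carrier_vec (length ds).
          \<kappa> * (u \<bullet> u) \<le> (\<Sum>j=1..n. bl (X j \<omega>) * (select ds (X j \<omega>) \<bullet> u)\<^sup>2)))"

text \<open>Taylor's bound is applied to each summand. Convexity of \<open>\<Theta>\<close> keeps
  the intermediate parameters where \<open>bl\<close> bounds the second derivative; the linear terms
  add up to the score, the quadratic ones to the form that \<open>\<kappa>\<close> bounds from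
  below.\<close>

lemma quasi_loglik_le_quadratic:
  assumes b: "C3_function b" and dom: "bounded_convex_domain (length ds) \<Theta>"
    and \<theta>: "\<theta>\<^sub>0 \<in> \<Theta>" "\<theta> \<in> \<Theta>"
    and curv: "curvature_ge b ds \<Theta> n X \<omega> \<kappa>"
  shows "quasi_loglik b X Y ds n \<theta> \<omega> \<le> quasi_loglik b X Y ds n \<theta>\<^sub>0 \<omega>
    + score b X Y ds n \<theta>\<^sub>0 \<omega> \<bullet> (\<theta> - \<theta>\<^sub>0) - \<kappa> / 2 * ((\<theta> - \<theta>\<^sub>0) \<bullet> (\<theta> - \<theta>\<^sub>0))"
proof -
  obtain bl where bl: "\<And>x \<theta>. \<theta> \<in> \<Theta> \<Longrightarrow> bl x \<le> (deriv ^^ 2) b (select ds x \<bullet> \<theta>)"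
    and gram: "\<And>u. u \<in> carrier_vec (length ds) \<Longrightarrow>
      \<kappa> * (u \<bullet> u) \<le> (\<Sum>j=1..n. bl (X j \<omega>) * (select ds (X j \<omega>) \<bullet> u)\<^sup>2)"
    using curv unfolding curvature_ge_def by blast
  let ?z = "\<lambda>j. select ds (X j \<omega>)"
  have c: "\<theta>\<^sub>0 \<in> carrier_vec (length ds)" "\<theta> \<in> carrier_vec (length ds)"
    using \<theta> domain_carrier[OF dom] by auto
  have diff: "?z j \<bullet> (\<theta> - \<theta>\<^sub>0) = ?z j \<bullet> \<theta> - ?z j \<bullet> \<theta>\<^sub>0" for j
    using c by (simp add: scalar_prod_minus_distrib[of _ "length ds"])
  have "b (?z j \<bullet> \<theta>\<^sub>0) + deriv b (?z j \<bullet> \<theta>\<^sub>0) * (?z j \<bullet> \<theta> - ?z j \<bullet> \<theta>\<^sub>0)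
      + bl (X j \<omega>) / 2 * (?z j \<bullet> \<theta> - ?z j \<bullet> \<theta>\<^sub>0)\<^sup>2 \<le> b (?z j \<bullet> \<theta>)" for j
  proof (rule second_order_lower_bound[OF b])
    fix t :: real assume t: "t \<in> {0..1}"
    have "(1 - t) \<cdot>\<^sub>v \<theta>\<^sub>0 + t \<cdot>\<^sub>v \<theta> \<in> \<Theta>"
      using dom \<theta> t by (auto simp: bounded_convex_domain_def)
    from bl[OF this, of "X j \<omega>"]
    show "bl (X j \<omega>) \<le> (deriv ^^ 2) b ((1 - t) * (?z j \<bullet> \<theta>\<^sub>0) + t * (?z j \<bullet> \<theta>))"
      using c by (simp add: scalar_prod_add_distrib[of _ "length ds"])
  qed
  then have "quasi_loglik b X Y ds n \<theta> \<omega> \<le> (\<Sum>j=1..n. Y j \<omega> * (?z j \<bullet> \<theta>\<^sub>0) - b (?z j \<bullet> \<theta>\<^sub>0)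
      + (Y j \<omega> - deriv b (?z j \<bullet> \<theta>\<^sub>0)) * (?z j \<bullet> (\<theta> - \<theta>\<^sub>0))
      - 1 / 2 * (bl (X j \<omega>) * (?z j \<bullet> (\<theta> - \<theta>\<^sub>0))\<^sup>2))"
    unfolding quasi_loglik_def diff by (intro sum_mono) (simp add: algebra_simps)
  also have "\<dots> = quasi_loglik b X Y ds n \<theta>\<^sub>0 \<omega>
      + (\<Sum>j=1..n. (Y j \<omega> - deriv b (?z j \<bullet> \<theta>\<^sub>0)) * (?z j \<bullet> (\<theta> - \<theta>\<^sub>0)))
      - 1 / 2 * (\<Sum>j=1..n. bl (X j \<omega>) * (?z j \<bullet> (\<theta> - \<theta>\<^sub>0))\<^sup>2)"
    by (simp add: quasi_loglik_def sum.distrib sum_subtractf sum_distrib_left)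
  also have "(\<Sum>j=1..n. (Y j \<omega> - deriv b (?z j \<bullet> \<theta>\<^sub>0)) * (?z j \<bullet> (\<theta> - \<theta>\<^sub>0)))
      = score b X Y ds n \<theta>\<^sub>0 \<omega> \<bullet> (\<theta> - \<theta>\<^sub>0)"
    using c unfolding score_def scalar_prod_def
    by (simp add: sum_distrib_left sum_distrib_right mult.assoc) (rule sum.swap)
  finally show ?thesis
    using gram[of "\<theta> - \<theta>\<^sub>0"] c by simp
qed

text \<open>Completing the square: the right side is the maximum of the parabola, attained at
  \<open>r = s / \<kappa>\<close>.\<close>

lemma linear_minus_quadratic_le:
  fixes s r \<kappa> :: real
  assumes "\<kappa> > 0"
  shows "s * r - \<kappa> / 2 * r\<^sup>2 \<le> s\<^sup>2 / (2 * \<kappa>)"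
proof -
  have "0 \<le> (s - \<kappa> * r)\<^sup>2 / (2 * \<kappa>)" using assms by simp
  also have "\<dots> = s\<^sup>2 / (2 * \<kappa>) - (s * r - \<kappa> / 2 * r\<^sup>2)"
    using assms by (simp add: field_simps power2_eq_square)
  finally show ?thesis by simp
qed

text \<open>Cauchy-Schwarz leaves a parabola in the distance from \<open>\<theta>\<^sub>0\<close>
  alone.\<close>

lemma quasi_loglik_le_score:
  assumes b: "C3_function b" and dom: "bounded_convex_domain (length ds) \<Theta>"
    and \<theta>: "\<theta>\<^sub>0 \<in> \<Theta>" "\<theta> \<in> \<Theta>"
    and curv: "curvature_ge b ds \<Theta> n X \<omega> \<kappa>"
  shows "quasi_loglik b X Y ds n \<theta> \<omega> \<le> quasi_loglik b X Y ds n \<theta>\<^sub>0 \<omega>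
    + vec_enorm (score b X Y ds n \<theta>\<^sub>0 \<omega>) * vec_enorm (\<theta> - \<theta>\<^sub>0) - \<kappa> / 2 * (vec_enorm (\<theta> - \<theta>\<^sub>0))\<^sup>2"
proof -
  have "score b X Y ds n \<theta>\<^sub>0 \<omega> \<bullet> (\<theta> - \<theta>\<^sub>0)
      \<le> vec_enorm (score b X Y ds n \<theta>\<^sub>0 \<omega>) * vec_enorm (\<theta> - \<theta>\<^sub>0)"
    using abs_scalar_prod_le[of "score b X Y ds n \<theta>\<^sub>0 \<omega>" "\<theta> - \<theta>\<^sub>0"]
      domain_carrier[OF dom \<theta>(1)] domain_carrier[OF dom \<theta>(2)] by (simp add: score_def)
  then show ?thesis
    using quasi_loglik_le_quadratic[OF b dom \<theta> curv, where Y = Y]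
    by (simp add: vec_enorm_sq)
qed

text \<open>Beyond distance \<open>\<rho>\<close> from \<open>\<theta>\<^sub>0\<close> the
  likelihood is at most its value at \<open>\<theta>\<^sub>0\<close>. Within that distance lies a
  closed ball, which is compact and, by \<open>small\<close>, contained in the open set
  \<open>\<Theta>\<close>; the maximum over the ball is thus a maximum over
  \<open>\<Theta>\<close>.\<close>

lemma quasi_loglik_argmax_exists:
  assumes b: "C3_function b" and dom: "bounded_convex_domain (length ds) \<Theta>"
    and \<theta>\<^sub>0: "\<theta>\<^sub>0 \<in> \<Theta>"
    and curv: "curvature_ge b ds \<Theta> n X \<omega> \<kappa>"
    and \<kappa>: "\<kappa> > 0"
    and ball: "\<And>v. v \<in> carrier_vec (length ds) \<Longrightarrow> vec_enorm (v - \<theta>\<^sub>0) < \<delta> \<Longrightarrow> v \<in> \<Theta>"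
    and small: "2 * vec_enorm (score b X Y ds n \<theta>\<^sub>0 \<omega>) < \<kappa> * \<delta>"
  shows "\<exists>\<theta>. is_arg_max (\<lambda>\<theta>. quasi_loglik b X Y ds n \<theta> \<omega>) (\<lambda>\<theta>. \<theta> \<in> \<Theta>) \<theta>"
proof -
  let ?H = "\<lambda>\<theta>. quasi_loglik b X Y ds n \<theta> \<omega>"
  let ?k = "length ds"
  \<comment> \<open>The zero, other than 0, of the parabola in \<open>quasi_loglik_le_score\<close>
    when the score does not vanish.\<close>
  define \<rho> where "\<rho> = 2 * vec_enorm (score b X Y ds n \<theta>\<^sub>0 \<omega>) / \<kappa>"
  have \<rho>: "0 \<le> \<rho>" "\<rho> < \<delta>" using \<kappa> small by (auto simp: \<rho>_def field_simps)
  define S where "S = {v \<in> carrier_vec ?k. vec_enorm (v - \<theta>\<^sub>0) \<le> \<rho>}"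
  have c: "\<theta>\<^sub>0 \<in> carrier_vec ?k" by (rule domain_carrier[OF dom \<theta>\<^sub>0])
  have S\<Theta>: "S \<subseteq> \<Theta>" using ball \<rho> by (auto simp: S_def)
  have \<theta>S: "\<theta>\<^sub>0 \<in> S" using c \<rho> by (simp add: S_def vec_enorm_def)
  have b_cont: "continuous_on UNIV b" by (rule C3_function_continuous[OF b])
  have cont: "continuous_on UNIV (\<lambda>g. ?H (Matrix.vec ?k g))"
    unfolding quasi_loglik_def
    by (intro continuous_intros continuous_on_compose2[OF b_cont]) auto
  have "closed {g. vec_enorm (Matrix.vec ?k g - \<theta>\<^sub>0) \<le> \<rho>}"
    by (intro closed_Collect_le continuous_on_vec_enorm_diff[OF c]) auto
  then have closed: "closed {g. Matrix.vec ?k g \<in> S}" by (simp add: S_def)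
  obtain R where R: "\<And>u. u \<in> \<Theta> \<Longrightarrow> vec_enorm u \<le> R"
    using dom unfolding bounded_convex_domain_def by blast
  have "\<exists>v\<in>S. \<forall>u\<in>S. ?H u \<le> ?H v"
  proof (rule attains_max_carrier[OF cont closed])
    show "vec_enorm v \<le> R" if "v \<in> S" for v using R S\<Theta> that by auto
  qed (use \<theta>S in \<open>auto simp: S_def\<close>)
  then obtain v where v: "v \<in> S" "\<And>u. u \<in> S \<Longrightarrow> ?H u \<le> ?H v" by blast
  have "?H u \<le> ?H v" if u: "u \<in> \<Theta>" for u
  proof (cases "u \<in> S")
    case False
    then have far: "\<rho> < vec_enorm (u - \<theta>\<^sub>0)"
      using domain_carrier[OF dom u] by (auto simp: S_def)
    have "?H u \<le> ?H \<theta>\<^sub>0 + vec_enorm (score b X Y ds n \<theta>\<^sub>0 \<omega>) * vec_enorm (u - \<theta>\<^sub>0)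
        - \<kappa> / 2 * (vec_enorm (u - \<theta>\<^sub>0))\<^sup>2"
      by (rule quasi_loglik_le_score[OF b dom \<theta>\<^sub>0 u curv])
    also have "\<dots> = ?H \<theta>\<^sub>0 + \<kappa> / 2 * vec_enorm (u - \<theta>\<^sub>0) * (\<rho> - vec_enorm (u - \<theta>\<^sub>0))"
      using \<kappa> by (simp add: \<rho>_def field_simps power2_eq_square)
    also have "\<dots> \<le> ?H \<theta>\<^sub>0"
      using far \<kappa> by (simp add: mult_nonneg_nonpos)
    finally show ?thesis using v(2)[OF \<theta>S] by simp
  qed (use v in auto)
  then have "is_arg_max ?H (\<lambda>\<theta>. \<theta> \<in> \<Theta>) v"
    using v S\<Theta> by (auto simp: is_arg_max_def not_less)
  then show ?thesis by blast
qed

text \<open>\<open>is_QMLE\<close> grants maximality only once a maximizer is known to exist; this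
  gives the lower bound. The upper bound is the maximum of the parabola and rests on
  \<open>\<theta>hat \<omega> \<in> \<Theta>\<close>.\<close>

lemma QMLE_loglik_bounds:
  assumes b: "C3_function b" and dom: "bounded_convex_domain (length ds) \<Theta>"
    and \<theta>\<^sub>0: "\<theta>\<^sub>0 \<in> \<Theta>"
    and curv: "curvature_ge b ds \<Theta> n X \<omega> \<kappa>"
    and \<kappa>: "\<kappa> > 0"
    and ball: "\<And>v. v \<in> carrier_vec (length ds) \<Longrightarrow> vec_enorm (v - \<theta>\<^sub>0) < \<delta> \<Longrightarrow> v \<in> \<Theta>"
    and small: "2 * vec_enorm (score b X Y ds n \<theta>\<^sub>0 \<omega>) < \<kappa> * \<delta>"
    and qmle: "is_QMLE \<Omega> b X Y ds \<Theta> n \<theta>hat" and \<omega>: "\<omega> \<in> space \<Omega>"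
  shows "quasi_loglik b X Y ds n \<theta>\<^sub>0 \<omega> \<le> quasi_loglik b X Y ds n (\<theta>hat \<omega>) \<omega>"
    and "quasi_loglik b X Y ds n (\<theta>hat \<omega>) \<omega> \<le> quasi_loglik b X Y ds n \<theta>\<^sub>0 \<omega>
      + (vec_enorm (score b X Y ds n \<theta>\<^sub>0 \<omega>))\<^sup>2 / (2 * \<kappa>)"
proof -
  have "is_arg_max (\<lambda>\<theta>. quasi_loglik b X Y ds n \<theta> \<omega>) (\<lambda>\<theta>. \<theta> \<in> \<Theta>) (\<theta>hat \<omega>)"
    using qmle \<omega> quasi_loglik_argmax_exists[OF b dom \<theta>\<^sub>0 curv \<kappa> ball small]
    by (auto simp: is_QMLE_def)
  then show "quasi_loglik b X Y ds n \<theta>\<^sub>0 \<omega> \<le> quasi_loglik b X Y ds n (\<theta>hat \<omega>) \<omega>"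
    using \<theta>\<^sub>0 by (auto simp: is_arg_max_def not_less)
  have "\<theta>hat \<omega> \<in> \<Theta>" using qmle \<omega> by (auto simp: is_QMLE_def)
  then show "quasi_loglik b X Y ds n (\<theta>hat \<omega>) \<omega> \<le> quasi_loglik b X Y ds n \<theta>\<^sub>0 \<omega>
      + (vec_enorm (score b X Y ds n \<theta>\<^sub>0 \<omega>))\<^sup>2 / (2 * \<kappa>)"
    using quasi_loglik_le_score[OF b dom \<theta>\<^sub>0 _ curv, of "\<theta>hat \<omega>" Y]
      linear_minus_quadratic_le[OF \<kappa>, of "vec_enorm (score b X Y ds n \<theta>\<^sub>0 \<omega>)" "vec_enorm (\<theta>hat \<omega> - \<theta>\<^sub>0)"]
    by linarith
qed

section \<open>Gram matrices and the log-determinant of the information matrix\<close>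

lemma weighted_gram_carrier [simp]:
  "weighted_gram ds n w x \<in> carrier_mat (length ds) (length ds)"
  by (simp add: weighted_gram_def)

lemma transpose_weighted_gram:
  "transpose_mat (weighted_gram ds n w x) = weighted_gram ds n w x"
proof (rule eq_matI)
  fix r s assume "r < dim_row (weighted_gram ds n w x)" "s < dim_col (weighted_gram ds n w x)"
  then show "transpose_mat (weighted_gram ds n w x) $$ (r, s) = weighted_gram ds n w x $$ (r, s)"
    unfolding weighted_gram_def by (auto intro!: sum.cong)
qed (simp_all add: weighted_gram_def)

lemma weighted_gram_quadratic_form:
  assumes u: "u \<in> carrier_vec (length ds)"
  shows "u \<bullet> (weighted_gram ds n w x *\<^sub>v u) = (\<Sum>j=1..n. w j * (select ds (x j) \<bullet> u)\<^sup>2)"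
proof -
  let ?k = "length ds"
  let ?z = "\<lambda>j. select ds (x j)"
  have "u \<bullet> (weighted_gram ds n w x *\<^sub>v u)
      = (\<Sum>r<?k. u $ r * (\<Sum>s<?k. (\<Sum>j=1..n. w j * (?z j $ r * ?z j $ s)) * u $ s))"
    using u by (simp add: weighted_gram_def scalar_prod_def row_def lessThan_atLeast0)
  also have "\<dots> = (\<Sum>r<?k. \<Sum>s<?k. \<Sum>j=1..n. w j * ((?z j $ r * u $ r) * (?z j $ s * u $ s)))"
    by (simp add: sum_distrib_left sum_distrib_right mult.assoc mult.left_commute)
  also have "\<dots> = (\<Sum>r<?k. \<Sum>j=1..n. \<Sum>s<?k. w j * ((?z j $ r * u $ r) * (?z j $ s * u $ s)))"
    by (rule sum.cong[OF refl], rule sum.swap)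
  also have "\<dots> = (\<Sum>j=1..n. \<Sum>r<?k. \<Sum>s<?k. w j * ((?z j $ r * u $ r) * (?z j $ s * u $ s)))"
    by (rule sum.swap)
  also have "\<dots> = (\<Sum>j=1..n. w j * ((\<Sum>r<?k. ?z j $ r * u $ r) * (\<Sum>s<?k. ?z j $ s * u $ s)))"
    unfolding sum_product unfolding sum_distrib_left ..
  also have "\<dots> = (\<Sum>j=1..n. w j * (?z j \<bullet> u)\<^sup>2)"
    using u by (simp add: scalar_prod_def lessThan_atLeast0 power2_eq_square)
  finally show ?thesis .
qed

text \<open>Translates the eigenvalue event of (A5) into the form asked for by
  \<open>curvature_ge\<close>, with \<open>\<kappa> = real n * l\<close>.
  \<open>ds \<noteq> []\<close> keeps the spectrum nonempty, so that its \<open>Min\<close> is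
  meaningful.\<close>

lemma lambda_min_gram_le:
  assumes n: "n \<ge> 1" and ds: "ds \<noteq> []" and u: "u \<in> carrier_vec (length ds)"
    and l: "l \<le> lambda_min ((1 / real n) \<cdot>\<^sub>m weighted_gram ds n w x)"
  shows "real n * l * (u \<bullet> u) \<le> (\<Sum>j=1..n. w j * (select ds (x j) \<bullet> u)\<^sup>2)"
proof -
  let ?G = "weighted_gram ds n w x"
  have "l * (u \<bullet> u) \<le> lambda_min ((1 / real n) \<cdot>\<^sub>m ?G) * (u \<bullet> u)"
    using l by (intro mult_right_mono) (auto simp: vec_enorm_sq[symmetric])
  also have "\<dots> \<le> u \<bullet> (((1 / real n) \<cdot>\<^sub>m ?G) *\<^sub>v u)"
  proof (rule lambda_min_le_quadratic_form)
    have "transpose_mat ((1 / real n) \<cdot>\<^sub>m ?G) = (1 / real n) \<cdot>\<^sub>m transpose_mat ?G"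
      by (intro eq_matI) auto
    then show "transpose_mat ((1 / real n) \<cdot>\<^sub>m ?G) = (1 / real n) \<cdot>\<^sub>m ?G"
      by (simp add: transpose_weighted_gram)
  qed (use ds u in auto)
  also have "\<dots> = 1 / real n * (u \<bullet> (?G *\<^sub>v u))"
  proof -
    have "((1 / real n) \<cdot>\<^sub>m ?G) *\<^sub>v u = (1 / real n) \<cdot>\<^sub>v (?G *\<^sub>v u)"
      using u by (intro eq_vecI) (auto simp: weighted_gram_def)
    then show ?thesis using u by (simp add: weighted_gram_def)
  qed
  finally show ?thesis
    using n by (simp add: weighted_gram_quadratic_form[OF u] field_simps)
qed

text \<open>From below, the weights \<open>w j\<close> dominate \<open>bl (X j \<omega>)\<close>, so
  the form is at least \<open>\<kappa>\<close> times the squared norm. From above, coordinates are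
  at most the norm, so every entry is at most \<open>W\<close>. With \<open>\<kappa>\<close> and
  \<open>W\<close> both proportional to \<open>n\<close>, the two bounds differ by a
  constant.\<close>

lemma ln_det_gram_bounds:
  assumes ds: "ds \<noteq> []" and \<kappa>: "\<kappa> > 0"
    and curv: "curvature_ge b ds \<Theta> n X \<omega> \<kappa>" and \<theta>: "\<theta> \<in> \<Theta>"
    and w: "w = (\<lambda>j. (deriv ^^ 2) b (select ds (X j \<omega>) \<bullet> \<theta>))"
    and W: "(\<Sum>j=1..n. \<bar>w j\<bar> * (norm (X j \<omega>))\<^sup>2) \<le> W" "0 < W"
  shows "real (length ds) * ln \<kappa> \<le> ln (Determinant.det (weighted_gram ds n w (\<lambda>j. X j \<omega>)))"
    and "ln (Determinant.det (weighted_gram ds n w (\<lambda>j. X j \<omega>))) \<le> ln (fact (length ds)) + real (length ds) * ln W"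
proof -
  let ?x = "\<lambda>j. X j \<omega>"
  let ?G = "weighted_gram ds n w ?x" and ?k = "length ds"
  obtain bl where bl: "\<And>x \<theta>. \<theta> \<in> \<Theta> \<Longrightarrow> bl x \<le> (deriv ^^ 2) b (select ds x \<bullet> \<theta>)"
    and gram: "\<And>u. u \<in> carrier_vec (length ds) \<Longrightarrow>
      \<kappa> * (u \<bullet> u) \<le> (\<Sum>j=1..n. bl (X j \<omega>) * (select ds (X j \<omega>) \<bullet> u)\<^sup>2)"
    using curv unfolding curvature_ge_def by blast
  have "\<kappa> ^ ?k \<le> Determinant.det ?G"
  proof (rule det_ge_power[OF _ transpose_weighted_gram])
    fix u :: "real vec" assume u: "u \<in> carrier_vec ?k"
    have "(\<Sum>j=1..n. bl (X j \<omega>) * (select ds (X j \<omega>) \<bullet> u)\<^sup>2) \<le> (\<Sum>j=1..n. w j * (select ds (X j \<omega>) \<bullet> u)\<^sup>2)"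
      using bl[OF \<theta>] by (intro sum_mono mult_right_mono) (auto simp: w)
    then show "\<kappa> * (u \<bullet> u) \<le> u \<bullet> (?G *\<^sub>v u)"
      using gram[OF u] by (simp add: weighted_gram_quadratic_form[OF u])
  qed (use \<kappa> in auto)
  moreover have "0 < \<kappa> ^ ?k" using \<kappa> by simp
  ultimately have pos: "0 < Determinant.det ?G" and "ln (\<kappa> ^ ?k) \<le> ln (Determinant.det ?G)"
    by auto
  then show "real ?k * ln \<kappa> \<le> ln (Determinant.det ?G)"
    using \<kappa> by (simp add: ln_realpow)
  have "Determinant.det ?G \<le> fact ?k * W ^ ?k"
  proof (rule det_le_fact_power)
    fix r s assume rs: "r < ?k" "s < ?k"
    have "\<bar>?G $$ (r, s)\<bar> \<le> (\<Sum>j=1..n. \<bar>w j * (select ds (X j \<omega>) $ r * select ds (X j \<omega>) $ s)\<bar>)"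
      using rs by (simp add: weighted_gram_def sum_abs)
    also have "\<dots> \<le> (\<Sum>j=1..n. \<bar>w j\<bar> * (norm (X j \<omega>))\<^sup>2)"
      unfolding abs_mult power2_eq_square using rs
      by (intro sum_mono mult_left_mono mult_mono abs_select_le_norm) auto
    finally show "\<bar>?G $$ (r, s)\<bar> \<le> W" using W by simp
  qed simp
  then have "ln (Determinant.det ?G) \<le> ln (fact ?k * W ^ ?k)"
    using pos W by simp
  also have "\<dots> = ln (fact ?k) + real ?k * ln W"
    using W by (simp add: ln_mult ln_realpow)
  finally show "ln (Determinant.det ?G) \<le> ln (fact ?k) + real ?k * ln W" .
qed

subsection \<open>Events of asymptotically large probability\<close>

text \<open>The events \<open>P n\<close> need not be measurable, hence the measurable inner approximation.\<close>

definition likely :: "'w measure \<Rightarrow> real \<Rightarrow> (nat \<Rightarrow> 'w \<Rightarrow> bool) \<Rightarrow> bool" where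
  "likely \<Omega> \<epsilon> P \<longleftrightarrow> (\<exists>N. \<forall>n\<ge>N. \<exists>S\<in>sets \<Omega>. 1 - \<epsilon> \<le> measure \<Omega> S \<and> (\<forall>\<omega>\<in>S. P n \<omega>))"

context prob_space
begin

lemma likelyI:
  assumes "\<And>n. n \<ge> N \<Longrightarrow> {\<omega>\<in>space M. P n \<omega>} \<in> sets M"
    and "\<And>n. n \<ge> N \<Longrightarrow> prob {\<omega>\<in>space M. \<not> P n \<omega>} \<le> \<epsilon>"
  shows "likely M \<epsilon> P"
  unfolding likely_def
proof (intro exI[of _ N] allI impI bexI conjI)
  fix n assume n: "N \<le> n"
  show "1 - \<epsilon> \<le> prob {\<omega>\<in>space M. P n \<omega>}"
    using prob_neg[OF assms(1)[OF n]] assms(2)[OF n] by simp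
qed (use assms(1) in auto)

text \<open>The probabilities of failure add up; this is why \<open>\<epsilon>\<close> is split into
  halves and thirds below.\<close>

lemma likely_conj:
  assumes "likely M \<epsilon>\<^sub>1 P" "likely M \<epsilon>\<^sub>2 Q"
  shows "likely M (\<epsilon>\<^sub>1 + \<epsilon>\<^sub>2) (\<lambda>n \<omega>. P n \<omega> \<and> Q n \<omega>)"
proof -
  obtain N\<^sub>1 N\<^sub>2 where N: "\<And>n. n \<ge> N\<^sub>1 \<Longrightarrow> \<exists>S\<in>sets M. 1 - \<epsilon>\<^sub>1 \<le> prob S \<and> (\<forall>\<omega>\<in>S. P n \<omega>)"
    "\<And>n. n \<ge> N\<^sub>2 \<Longrightarrow> \<exists>S\<in>sets M. 1 - \<epsilon>\<^sub>2 \<le> prob S \<and> (\<forall>\<omega>\<in>S. Q n \<omega>)"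
    using assms unfolding likely_def by blast
  show ?thesis
    unfolding likely_def
  proof (intro exI[of _ "max N\<^sub>1 N\<^sub>2"] allI impI)
    fix n assume "max N\<^sub>1 N\<^sub>2 \<le> n"
    then obtain S T where S: "S \<in> sets M" "1 - \<epsilon>\<^sub>1 \<le> prob S" "\<And>\<omega>. \<omega> \<in> S \<Longrightarrow> P n \<omega>"
      and T: "T \<in> sets M" "1 - \<epsilon>\<^sub>2 \<le> prob T" "\<And>\<omega>. \<omega> \<in> T \<Longrightarrow> Q n \<omega>"
      using N(1)[of n] N(2)[of n] by (metis max.bounded_iff)
    have "prob (S \<union> T) = prob S + prob (T - S)"
      using S(1) T(1) by (rule finite_measure_Union')
    moreover have "prob (T - S) = prob T - prob (S \<inter> T)"
      using S(1) T(1) by (simp add: finite_measure_Diff' Int_commute)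
    moreover have "prob (S \<union> T) \<le> 1" by simp
    ultimately have "1 - (\<epsilon>\<^sub>1 + \<epsilon>\<^sub>2) \<le> prob (S \<inter> T)"
      using S(2) T(2) by linarith
    then show "\<exists>S\<in>sets M. 1 - (\<epsilon>\<^sub>1 + \<epsilon>\<^sub>2) \<le> prob S \<and> (\<forall>\<omega>\<in>S. P n \<omega> \<and> Q n \<omega>)"
      using S T by (intro bexI[of _ "S \<inter> T"]) auto
  qed
qed

lemma likely_mono:
  assumes "likely M \<epsilon> P" and "\<And>n \<omega>. n \<ge> N \<Longrightarrow> \<omega> \<in> space M \<Longrightarrow> P n \<omega> \<Longrightarrow> Q n \<omega>"
  shows "likely M \<epsilon> Q"
proof -
  obtain N\<^sub>1 where N\<^sub>1: "\<And>n. n \<ge> N\<^sub>1 \<Longrightarrow> \<exists>S\<in>sets M. 1 - \<epsilon> \<le> prob S \<and> (\<forall>\<omega>\<in>S. P n \<omega>)"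
    using assms(1) unfolding likely_def by blast
  show ?thesis
    unfolding likely_def
  proof (intro exI[of _ "max N N\<^sub>1"] allI impI)
    fix n assume n: "max N N\<^sub>1 \<le> n"
    then obtain S where "S \<in> sets M" "1 - \<epsilon> \<le> prob S" "\<forall>\<omega>\<in>S. P n \<omega>"
      using N\<^sub>1[of n] by auto
    then show "\<exists>S\<in>sets M. 1 - \<epsilon> \<le> prob S \<and> (\<forall>\<omega>\<in>S. Q n \<omega>)"
      using assms(2)[of n] n sets.sets_into_space by (metis max.bounded_iff subsetD)
  qed
qed

lemma likely_AE:
  assumes "\<And>n. AE \<omega> in M. P n \<omega>" "0 \<le> \<epsilon>"
  shows "likely M \<epsilon> P"
  unfolding likely_def
proof (intro exI[of _ 0] allI impI)
  fix n
  obtain T where T: "{\<omega>\<in>space M. \<not> P n \<omega>} \<subseteq> T" "emeasure M T = 0" "T \<in> sets M"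
    using assms(1)[of n] by (rule AE_E)
  then have "prob (space M - T) = 1"
    by (metis prob_compl measure_eq_emeasure_eq_ennreal ennreal_0 order_refl diff_zero)
  then show "\<exists>S\<in>sets M. 1 - \<epsilon> \<le> prob S \<and> (\<forall>\<omega>\<in>S. P n \<omega>)"
    using T assms(2) by (intro bexI[of _ "space M - T"]) auto
qed

text \<open>Serves to compare deterministic limits: a relation between numbers follows once the
  random estimates hold at a single \<open>\<omega>\<close>.\<close>

lemma likely_not_False:
  assumes "likely M \<epsilon> P" "\<epsilon> < 1"
  shows "\<exists>N. \<forall>n\<ge>N. \<exists>\<omega>\<in>space M. P n \<omega>"
proof -
  obtain N where N: "\<And>n. n \<ge> N \<Longrightarrow> \<exists>S\<in>sets M. 1 - \<epsilon> \<le> prob S \<and> (\<forall>\<omega>\<in>S. P n \<omega>)"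
    using assms(1) unfolding likely_def by blast
  have "\<exists>\<omega>\<in>space M. P n \<omega>" if n: "n \<ge> N" for n
  proof -
    obtain S where S: "S \<in> sets M" "1 - \<epsilon> \<le> prob S" "\<forall>\<omega>\<in>S. P n \<omega>" using N[OF n] by blast
    then have "S \<noteq> {}" using assms(2) by auto
    then show ?thesis using S sets.sets_into_space[OF S(1)] by blast
  qed
  then show ?thesis by blast
qed

text \<open>Measurability of the event itself is what turns the inner approximation into a lower
  bound for its probability.\<close>

lemma tendsto_one_if_likely:
  assumes P: "\<And>\<epsilon>. \<epsilon> > 0 \<Longrightarrow> likely M \<epsilon> P"
    and meas: "\<And>n. n \<ge> N\<^sub>0 \<Longrightarrow> {\<omega>\<in>space M. P n \<omega>} \<in> sets M"
  shows "(\<lambda>n. prob {\<omega>\<in>space M. P n \<omega>}) \<longlonglongrightarrow> 1"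
proof (rule LIMSEQ_I)
  fix r :: real assume r: "r > 0"
  obtain N where N: "\<And>n. n \<ge> N \<Longrightarrow> \<exists>S\<in>sets M. 1 - r / 2 \<le> prob S \<and> (\<forall>\<omega>\<in>S. P n \<omega>)"
    using P[of "r / 2"] r unfolding likely_def by auto
  show "\<exists>N. \<forall>n\<ge>N. norm (prob {\<omega>\<in>space M. P n \<omega>} - 1) < r"
  proof (intro exI[of _ "max N N\<^sub>0"] allI impI)
    fix n assume n: "max N N\<^sub>0 \<le> n"
    then obtain S where S: "S \<in> sets M" "1 - r / 2 \<le> prob S" "\<forall>\<omega>\<in>S. P n \<omega>"
      using N[of n] by auto
    then have "prob S \<le> prob {\<omega>\<in>space M. P n \<omega>}"
      using n meas[of n] sets.sets_into_space[OF S(1)] by (intro finite_measure_mono) auto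
    moreover have "prob {\<omega>\<in>space M. P n \<omega>} \<le> 1" by simp
    ultimately show "norm (prob {\<omega>\<in>space M. P n \<omega>} - 1) < r"
      using S(2) r by auto
  qed
qed

lemma likely_if_prob_tendsto_0:
  assumes "(\<lambda>n. prob {\<omega>\<in>space M. \<not> P n \<omega>}) \<longlonglongrightarrow> 0"
    and "\<And>n. n \<ge> N \<Longrightarrow> {\<omega>\<in>space M. P n \<omega>} \<in> sets M" and "\<epsilon> > 0"
  shows "likely M \<epsilon> P"
proof -
  have "\<forall>\<^sub>F n in sequentially. prob {\<omega>\<in>space M. \<not> P n \<omega>} < \<epsilon>"
    using assms(1,3) by (rule order_tendstoD)
  then obtain N' where "\<And>n. n \<ge> N' \<Longrightarrow> prob {\<omega>\<in>space M. \<not> P n \<omega>} < \<epsilon>"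
    unfolding eventually_sequentially by blast
  then show ?thesis
    using assms(2) by (intro likelyI[of "max N N'"]) (auto intro: less_imp_le)
qed

lemma likely_if_conv_to_0_in_prob:
  assumes "conv_to_0_in_prob M Z" "\<And>n. n \<ge> N \<Longrightarrow> Z n \<in> borel_measurable M" "\<epsilon> > 0" "\<delta> > 0"
  shows "likely M \<epsilon> (\<lambda>n \<omega>. \<bar>Z n \<omega>\<bar> \<le> \<delta>)"
  by (rule likely_if_prob_tendsto_0[where N = N])
    (use assms in \<open>auto simp: conv_to_0_in_prob_def not_le\<close>)

lemma likely_if_bounded_in_prob:
  assumes "bounded_in_prob M Z" "\<And>n. n \<ge> N \<Longrightarrow> Z n \<in> borel_measurable M" "\<epsilon> > 0"
  shows "\<exists>R. likely M \<epsilon> (\<lambda>n \<omega>. \<bar>Z n \<omega>\<bar> \<le> R)"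
proof -
  obtain R N' where "\<And>n. n \<ge> N' \<Longrightarrow> prob {\<omega>\<in>space M. R < \<bar>Z n \<omega>\<bar>} < \<epsilon>"
    using assms(1,3) unfolding bounded_in_prob_def by blast
  then show ?thesis
    using assms(2)
    by (intro exI[of _ R] likelyI[of "max N N'"]) (auto simp: not_le intro: less_imp_le)
qed

lemma likely_Markov:
  assumes Z: "\<And>n. n \<ge> 1 \<Longrightarrow> integrable M (Z n)" "\<And>n \<omega>. 0 \<le> Z n \<omega>"
    and V: "\<And>n. n \<ge> 1 \<Longrightarrow> expectation (Z n) \<le> real n * V" and \<epsilon>: "\<epsilon> > 0"
  shows "\<exists>R>0. likely M \<epsilon> (\<lambda>n \<omega>. Z n \<omega> \<le> R * real n)"
proof -
  \<comment> \<open>Chosen so that Markov's bound \<open>\<bar>V\<bar> / R\<close> is at most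
    \<open>\<epsilon>\<close>; the summand 1 keeps \<open>R\<close> positive when
    \<open>V = 0\<close>.\<close>
  define R where "R = (\<bar>V\<bar> + 1) / \<epsilon>"
  have R: "R > 0" using \<epsilon> by (simp add: R_def add_nonneg_pos)
  have "likely M \<epsilon> (\<lambda>n \<omega>. Z n \<omega> \<le> R * real n)"
  proof (rule likelyI[of 1])
    fix n :: nat assume n: "1 \<le> n"
    have [measurable]: "Z n \<in> borel_measurable M" using Z(1)[OF n] by auto
    show "{\<omega>\<in>space M. Z n \<omega> \<le> R * real n} \<in> sets M" by measurable
    have pos: "0 < R * real n" using R n by simp
    have "prob {\<omega>\<in>space M. \<not> Z n \<omega> \<le> R * real n} \<le> prob {\<omega>\<in>space M. R * real n \<le> Z n \<omega>}"
      by (intro finite_measure_mono) auto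
    also have "\<dots> \<le> expectation (Z n) / (R * real n)"
      using Z(1)[OF n] Z(2) pos by (intro integral_Markov_inequality_measure[where A = "{}"]) auto
    also have "\<dots> \<le> real n * \<bar>V\<bar> / (R * real n)"
    proof (rule divide_right_mono)
      have "real n * V \<le> real n * \<bar>V\<bar>" by (intro mult_left_mono) auto
      then show "expectation (Z n) \<le> real n * \<bar>V\<bar>" using V[OF n] by linarith
    qed (use pos in auto)
    also have "\<dots> = \<bar>V\<bar> / R" using n by simp
    also have "\<dots> \<le> \<epsilon>" using \<epsilon> by (simp add: R_def field_simps)
    finally show "prob {\<omega>\<in>space M. \<not> Z n \<omega> \<le> R * real n} \<le> \<epsilon>" .
  qed
  then show ?thesis using R by blast
qed

end

subsection \<open>The score as a martingale\<close>

lemma space_generated [simp]: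
  "space (generated \<Omega> I Z) = space \<Omega>"
  by (simp add: generated_def space_measure_of_conv)

lemma generated_measurable:
  assumes "i \<in> I"
  shows "Z i \<in> borel_measurable (generated \<Omega> I Z)"
proof (rule measurableI)
  fix B :: "'b set" assume "B \<in> sets borel"
  then have "Z i -` B \<inter> space \<Omega> \<in> (\<Union>i\<in>I. {Z i -` B \<inter> space \<Omega> | B. B \<in> sets borel})"
    using assms by blast
  moreover have "(\<Union>i\<in>I. {Z i -` B \<inter> space \<Omega> | B. B \<in> sets borel}) \<subseteq> Pow (space \<Omega>)"
    by blast
  ultimately show "Z i -` B \<inter> space (generated \<Omega> I Z) \<in> sets (generated \<Omega> I Z)"
    unfolding space_generated by (simp add: generated_def)
qed simp

lemma sets_generated_subset:
  assumes "\<And>i. i \<in> I \<Longrightarrow> Z i \<in> borel_measurable \<Omega>"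
  shows "sets (generated \<Omega> I Z) \<subseteq> sets \<Omega>"
proof -
  have "(\<Union>i\<in>I. {Z i -` B \<inter> space \<Omega> | B. B \<in> sets borel}) \<subseteq> sets \<Omega>"
    using assms by (auto intro: measurable_sets)
  moreover from this have "(\<Union>i\<in>I. {Z i -` B \<inter> space \<Omega> | B. B \<in> sets borel}) \<subseteq> Pow (space \<Omega>)"
    using sets.space_closed by blast
  ultimately show ?thesis
    unfolding generated_def by (simp add: sets.sigma_sets_subset)
qed

lemma space_sigma_join [simp]:
  "space (sigma_join \<Omega> G H) = space \<Omega>"
  by (simp add: sigma_join_def space_measure_of_conv)

lemma sets_sigma_join:
  assumes "space G = space \<Omega>" "space H = space \<Omega>"
  shows "sets (sigma_join \<Omega> G H) = sigma_sets (space \<Omega>) (sets G \<union> sets H)"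
  unfolding sigma_join_def using sets.space_closed[of G] sets.space_closed[of H] assms by simp

lemma space_past [simp]:
  "space (past \<Omega> X Y j) = space \<Omega>"
  by (simp add: past_def)

lemma sets_past:
  "sets (past \<Omega> X Y j) = sigma_sets (space \<Omega>)
     (sets (generated \<Omega> {1..<j} (observation X Y)) \<union> sets (generated \<Omega> {j} X))"
  unfolding past_def by (rule sets_sigma_join) simp_all

lemma measurable_past_X:
  "X j \<in> borel_measurable (past \<Omega> X Y j)"
proof -
  have "subalgebra (past \<Omega> X Y j) (generated \<Omega> {j} X)"
    by (auto simp: subalgebra_def sets_past)
  then show ?thesis
    using generated_measurable[of j "{j}" X \<Omega>] by (blast intro: measurable_from_subalg)
qed

lemma measurable_past_observation:
  fixes X :: "nat \<Rightarrow> 'w \<Rightarrow> real ^ 'p::finite"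
  assumes "1 \<le> i" "i < j"
  shows "X i \<in> borel_measurable (past \<Omega> X Y j)" "Y i \<in> borel_measurable (past \<Omega> X Y j)"
proof -
  have "subalgebra (past \<Omega> X Y j) (generated \<Omega> {1..<j} (observation X Y))"
    by (auto simp: subalgebra_def sets_past)
  then have obs: "observation X Y i \<in> borel_measurable (past \<Omega> X Y j)"
    using generated_measurable[of i "{1..<j}" "observation X Y" \<Omega>] assms
    by (auto intro: measurable_from_subalg)
  have "(\<lambda>\<omega>. fst (observation X Y i \<omega>)) \<in> borel_measurable (past \<Omega> X Y j)"
    by (rule measurable_compose[OF obs]) (intro borel_measurable_continuous_onI continuous_intros)
  then show "X i \<in> borel_measurable (past \<Omega> X Y j)" by (simp add: observation_def)
  have "(\<lambda>\<omega>. snd (observation X Y i \<omega>)) \<in> borel_measurable (past \<Omega> X Y j)"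
    by (rule measurable_compose[OF obs]) (intro borel_measurable_continuous_onI continuous_intros)
  then show "Y i \<in> borel_measurable (past \<Omega> X Y j)" by (simp add: observation_def)
qed

lemma subalgebra_past:
  fixes X :: "nat \<Rightarrow> 'w \<Rightarrow> real ^ 'p::finite"
  assumes X: "\<And>i. i \<ge> 1 \<Longrightarrow> X i \<in> borel_measurable \<Omega>"
    and Y: "\<And>i. i \<ge> 1 \<Longrightarrow> Y i \<in> borel_measurable \<Omega>" and j: "j \<ge> 1"
  shows "subalgebra \<Omega> (past \<Omega> X Y j)"
proof -
  have obs: "observation X Y i \<in> borel_measurable \<Omega>" if "i \<ge> 1" for i
    unfolding observation_def[abs_def] using X[OF that] Y[OF that] by (rule borel_measurable_Pair)
  have "sets (generated \<Omega> {1..<j} (observation X Y)) \<subseteq> sets \<Omega>"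
    by (rule sets_generated_subset) (use obs in auto)
  moreover have "sets (generated \<Omega> {j} X) \<subseteq> sets \<Omega>"
    by (rule sets_generated_subset) (use X j in auto)
  ultimately show ?thesis
    unfolding subalgebra_def sets_past by (simp add: sets.sigma_sets_subset)
qed

section \<open>Moments of covariates and responses\<close>

text \<open>Reduces all lower moments of the covariates to the one moment that (A1)(iii)
  bounds.\<close>

lemma powr_le_one_plus_powr:
  fixes t :: real
  assumes "0 \<le> t" "0 \<le> r" "r \<le> q"
  shows "t powr r \<le> 1 + t powr q"
proof (cases "t \<le> 1")
  case True
  then have "t powr r \<le> 1" using assms by (intro powr_le1) auto
  then show ?thesis using powr_ge_zero[of t q] by linarith
next
  case False
  then have "t powr r \<le> t powr q" using assms by (intro powr_mono) auto
  then show ?thesis by simp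
qed

text \<open>Used to dominate first and second powers by the cubes that (A1)(ii) controls.\<close>

lemma power_le_one_plus_power:
  fixes t :: real
  assumes "0 \<le> t" "m \<le> n"
  shows "t ^ m \<le> 1 + t ^ n"
proof (cases "t \<le> 1")
  case True
  then have "t ^ m \<le> 1" using assms by (intro power_le_one) auto
  then show ?thesis using zero_le_power[OF assms(1), of n] by linarith
next
  case False
  then have "t ^ m \<le> t ^ n" using assms by (intro power_increasing) auto
  then show ?thesis by simp
qed

text \<open>The setting shared by all candidate models; the moment and martingale bounds are proved
  here once for all of them.\<close>

locale quasi_glm = prob_space \<Omega> for \<Omega> :: "'w measure" +
  fixes X :: "nat \<Rightarrow> 'w \<Rightarrow> real ^ 'p::finite"
    and Y :: "nat \<Rightarrow> 'w \<Rightarrow> real"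
    and b :: "real \<Rightarrow> real"
    and F :: "real ^ 'p \<Rightarrow> real"
  assumes X_meas [measurable]: "\<And>j. j \<ge> 1 \<Longrightarrow> X j \<in> borel_measurable \<Omega>"
    and Y_meas [measurable]: "\<And>j. j \<ge> 1 \<Longrightarrow> Y j \<in> borel_measurable \<Omega>"
    and b_C3: "C3_function b"
    and A1: "condition_A1 \<Omega> b X Y"
    and A2: "condition_A2 \<Omega> X Y F"
begin

lemma F_meas [measurable]: "F \<in> borel_measurable borel"
  using A2 by (simp add: condition_A2_def)

lemma cond_exp_past:
  assumes "j \<ge> 1"
  shows "sigma_finite_subalgebra \<Omega> (past \<Omega> X Y j)"
  using subalgebra_past[OF X_meas Y_meas assms]
  by (intro finite_measure_subalgebra_is_sigma_finite finite_measure_subalgebra.intro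
      finite_measure_subalgebra_axioms.intro) (auto simp: finite_measure_axioms)

text \<open>The weight \<open>w\<close> depends on the norm of the covariate and not on the
  parameter. It dominates the second derivative at every linear predictor of size at most
  \<open>R\<close> times that norm, and so will bound the information matrix for all parameters of a
  bounded set simultaneously.\<close>

lemma covariate_weight_moments:
  assumes R: "0 \<le> R"
  shows "\<exists>w V. (\<forall>t. 0 \<le> w t) \<and>
    (\<forall>s t. \<bar>s\<bar> \<le> R * t \<longrightarrow> \<bar>(deriv ^^ 2) b s\<bar> \<le> w t) \<and>
    (\<forall>j\<ge>1. integrable \<Omega> (\<lambda>\<omega>. w (norm (X j \<omega>)) * (norm (X j \<omega>))\<^sup>2) \<and>
      expectation (\<lambda>\<omega>. w (norm (X j \<omega>)) * (norm (X j \<omega>))\<^sup>2) \<le> V)"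
proof -
  obtain C C' K where C: "C \<ge> 0" "C' \<ge> 0" "K > 0"
    and bK: "\<And>x i. i \<in> {1, 2, 3} \<Longrightarrow> \<bar>(deriv ^^ i) b x\<bar> \<le> K * (1 + \<bar>x\<bar> powr C)"
    and XB: "(SUP j\<in>{1..}. \<integral>\<^sup>+\<omega>. ennreal (norm (X j \<omega>) powr (3 * C + C' + 3)) \<partial>\<Omega>) < \<infinity>"
    using A1 unfolding condition_A1_def by blast
  define q where "q = 3 * C + C' + 3"
  define B where "B = enn2real (SUP j\<in>{1..}. \<integral>\<^sup>+\<omega>. ennreal (norm (X j \<omega>) powr q) \<partial>\<Omega>)"
  define w where "w = (\<lambda>t. K * (1 + \<bar>R * t\<bar> powr C))"
  define L where "L = K * (1 + R powr C)"
  have L: "0 \<le> L" using C by (simp add: L_def)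
  have B: "(\<integral>\<^sup>+\<omega>. ennreal (norm (X j \<omega>) powr q) \<partial>\<Omega>) \<le> ennreal B" if "j \<ge> 1" for j
  proof -
    have "(\<integral>\<^sup>+\<omega>. ennreal (norm (X j \<omega>) powr q) \<partial>\<Omega>)
        \<le> (SUP j\<in>{1..}. \<integral>\<^sup>+\<omega>. ennreal (norm (X j \<omega>) powr q) \<partial>\<Omega>)"
      using that by (intro SUP_upper) auto
    then show ?thesis using XB by (simp add: B_def q_def)
  qed
  have pt: "w t * t\<^sup>2 \<le> L * (1 + t powr q)" if t: "0 \<le> t" for t
  proof -
    have "w t * t\<^sup>2 = K * (t powr 2 + R powr C * t powr (C + 2))"
      using t R by (cases "t = 0") (auto simp: w_def powr_mult powr_add powr_numeral algebra_simps)
    \<comment> \<open>Both exponents, 2 and \<open>C + 2\<close>, are at most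
      \<open>q = 3 * C + C' + 3\<close>.\<close>
    also have "\<dots> \<le> K * ((1 + t powr q) + R powr C * (1 + t powr q))"
      using t C by (intro mult_left_mono add_mono powr_le_one_plus_powr) (auto simp: q_def)
    finally show ?thesis by (simp add: L_def algebra_simps)
  qed
  have "integrable \<Omega> (\<lambda>\<omega>. w (norm (X j \<omega>)) * (norm (X j \<omega>))\<^sup>2) \<and>
      expectation (\<lambda>\<omega>. w (norm (X j \<omega>)) * (norm (X j \<omega>))\<^sup>2) \<le> L * (1 + B)" if j: "j \<ge> 1" for j
  proof -
    note X_meas[OF j, measurable]
    have "integrable \<Omega> (\<lambda>\<omega>. norm (X j \<omega>) powr q)"
      using B[OF j] by (intro integrableI_bounded) (auto intro: order.strict_trans1)
    moreover have "expectation (\<lambda>\<omega>. norm (X j \<omega>) powr q) \<le> B"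
      using B[OF j] by (intro integral_real_bounded) (auto simp: B_def)
    ultimately have int: "integrable \<Omega> (\<lambda>\<omega>. L * (1 + norm (X j \<omega>) powr q))"
      and le: "expectation (\<lambda>\<omega>. L * (1 + norm (X j \<omega>) powr q)) \<le> L * (1 + B)"
      using L by (auto simp: prob_space intro!: mult_left_mono)
    have int': "integrable \<Omega> (\<lambda>\<omega>. w (norm (X j \<omega>)) * (norm (X j \<omega>))\<^sup>2)"
    proof (rule Bochner_Integration.integrable_bound[OF int])
      show "(\<lambda>\<omega>. w (norm (X j \<omega>)) * (norm (X j \<omega>))\<^sup>2) \<in> borel_measurable \<Omega>"
        unfolding w_def by measurable
      show "AE \<omega> in \<Omega>. norm (w (norm (X j \<omega>)) * (norm (X j \<omega>))\<^sup>2) \<le> norm (L * (1 + norm (X j \<omega>) powr q))"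
      proof (rule AE_I2)
        fix \<omega>
        have "0 \<le> w (norm (X j \<omega>)) * (norm (X j \<omega>))\<^sup>2" using C by (simp add: w_def)
        then show "norm (w (norm (X j \<omega>)) * (norm (X j \<omega>))\<^sup>2) \<le> norm (L * (1 + norm (X j \<omega>) powr q))"
          using pt[of "norm (X j \<omega>)"] by (simp del: power2_eq_square)
      qed
    qed
    have "expectation (\<lambda>\<omega>. w (norm (X j \<omega>)) * (norm (X j \<omega>))\<^sup>2) \<le>
        expectation (\<lambda>\<omega>. L * (1 + norm (X j \<omega>) powr q))"
      by (intro integral_mono int int' pt) simp
    then show ?thesis using int' le by simp
  qed
  moreover have "\<bar>(deriv ^^ 2) b s\<bar> \<le> w t" if "\<bar>s\<bar> \<le> R * t" for s t
  proof -
    have "\<bar>s\<bar> powr C \<le> \<bar>R * t\<bar> powr C" using that C by (intro powr_mono2) auto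
    then have "K * (1 + \<bar>s\<bar> powr C) \<le> w t" unfolding w_def using C by (intro mult_left_mono) auto
    then show ?thesis using bK[of 2 s] by simp
  qed
  moreover have "\<forall>t. 0 \<le> w t" using C by (simp add: w_def)
  ultimately show ?thesis by blast
qed

text \<open>The factor \<open>1 + norm (X j \<omega>) ^ 3\<close> is measurable with respect to the
  past, so it may be multiplied into (A1)(ii) before integrating, and a moment of the covariates of
  order at most \<open>q\<close> remains. The computation runs in extended nonnegative numbers, and
  the integrability of \<open>U\<close> is a consequence of it.\<close>

lemma response_moments:
  "\<exists>V\<ge>0. \<forall>j\<ge>1. integrable \<Omega> (Y j) \<and> integrable \<Omega> (\<lambda>\<omega>. (Y j \<omega>)\<^sup>2 * (norm (X j \<omega>))\<^sup>2) \<and>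
     expectation (\<lambda>\<omega>. (Y j \<omega>)\<^sup>2 * (norm (X j \<omega>))\<^sup>2) \<le> V"
proof -
  obtain C C' K where C: "C \<ge> 0" "C' \<ge> 0" "K > 0"
    and YK: "\<And>j. j \<ge> 1 \<Longrightarrow> AE \<omega> in \<Omega>. nn_cond_exp \<Omega> (past \<Omega> X Y j) (\<lambda>\<omega>. ennreal (\<bar>Y j \<omega>\<bar> ^ 3)) \<omega>
                    \<le> ennreal (K * (1 + norm (X j \<omega>) powr C'))"
    and XB: "(SUP j\<in>{1..}. \<integral>\<^sup>+\<omega>. ennreal (norm (X j \<omega>) powr (3 * C + C' + 3)) \<partial>\<Omega>) < \<infinity>"
    using A1 unfolding condition_A1_def by blast
  define q where "q = 3 * C + C' + 3"
  define B where "B = enn2real (SUP j\<in>{1..}. \<integral>\<^sup>+\<omega>. ennreal (norm (X j \<omega>) powr q) \<partial>\<Omega>)"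
  have B0: "0 \<le> B" by (simp add: B_def)
  have B: "(\<integral>\<^sup>+\<omega>. ennreal (norm (X j \<omega>) powr q) \<partial>\<Omega>) \<le> ennreal B" if "j \<ge> 1" for j
  proof -
    have "(\<integral>\<^sup>+\<omega>. ennreal (norm (X j \<omega>) powr q) \<partial>\<Omega>)
        \<le> (SUP j\<in>{1..}. \<integral>\<^sup>+\<omega>. ennreal (norm (X j \<omega>) powr q) \<partial>\<Omega>)"
      using that by (intro SUP_upper) auto
    then show ?thesis using XB by (simp add: B_def q_def)
  qed
  have pt: "(1 + t ^ 3) * (K * (1 + t powr C')) \<le> 4 * K * (1 + t powr q)" if t: "0 \<le> t" for t
  proof -
    have "(1 + t ^ 3) * (1 + t powr C') = 1 + t powr C' + t powr 3 + t powr (3 + C')"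
      using t by (cases "t = 0") (auto simp: powr_add powr_numeral algebra_simps)
    \<comment> \<open>Each of the four summands is at most \<open>1 + t powr q\<close>, since the
      largest exponent \<open>3 + C'\<close> does not exceed \<open>q\<close>; hence the factor
      4.\<close>
    also have "\<dots> \<le> (1 + t powr q) + (1 + t powr q) + (1 + t powr q) + (1 + t powr q)"
      using t C by (intro add_mono powr_le_one_plus_powr) (auto simp: q_def)
    finally have "K * ((1 + t ^ 3) * (1 + t powr C')) \<le> K * (4 * (1 + t powr q))"
      using C by (intro mult_left_mono) auto
    then show ?thesis by (simp add: algebra_simps)
  qed
  define V where "V = 4 * K * (1 + B)"
  have V: "0 \<le> V" using C B0 by (simp add: V_def)
  have "integrable \<Omega> (Y j) \<and> integrable \<Omega> (\<lambda>\<omega>. (Y j \<omega>)\<^sup>2 * (norm (X j \<omega>))\<^sup>2) \<and>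
     expectation (\<lambda>\<omega>. (Y j \<omega>)\<^sup>2 * (norm (X j \<omega>))\<^sup>2) \<le> 1 + V" if j: "j \<ge> 1" for j
  proof -
    note X_meas[OF j, measurable] Y_meas[OF j, measurable]
    interpret G: sigma_finite_subalgebra \<Omega> "past \<Omega> X Y j" by (rule cond_exp_past[OF j])
    have [measurable]: "X j \<in> borel_measurable (past \<Omega> X Y j)" by (rule measurable_past_X)
    \<comment> \<open>The summand 1 makes \<open>U\<close> dominate the cube of
      \<open>\<bar>Y j \<omega>\<bar>\<close>, the summand with the norm makes it dominate the cube
      of \<open>\<bar>Y j \<omega>\<bar> * norm (X j \<omega>)\<close>.\<close>
    define U where "U = (\<lambda>\<omega>. (1 + (norm (X j \<omega>)) ^ 3) * \<bar>Y j \<omega>\<bar> ^ 3)"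
    have U0: "0 \<le> U \<omega>" for \<omega> by (simp add: U_def)
    have [measurable]: "U \<in> borel_measurable \<Omega>" unfolding U_def by measurable
    have "(\<integral>\<^sup>+\<omega>. ennreal (U \<omega>) \<partial>\<Omega>)
        = (\<integral>\<^sup>+\<omega>. ennreal (1 + (norm (X j \<omega>)) ^ 3) * ennreal (\<bar>Y j \<omega>\<bar> ^ 3) \<partial>\<Omega>)"
      by (simp add: U_def ennreal_mult)
    also have "\<dots> = (\<integral>\<^sup>+\<omega>. ennreal (1 + (norm (X j \<omega>)) ^ 3) *
        nn_cond_exp \<Omega> (past \<Omega> X Y j) (\<lambda>\<omega>. ennreal (\<bar>Y j \<omega>\<bar> ^ 3)) \<omega> \<partial>\<Omega>)"
      by (rule G.nn_cond_exp_intg[symmetric]) measurable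
    also have "\<dots> \<le> (\<integral>\<^sup>+\<omega>. ennreal (4 * K * (1 + norm (X j \<omega>) powr q)) \<partial>\<Omega>)"
    proof (rule nn_integral_mono_AE)
      show "AE \<omega> in \<Omega>. ennreal (1 + (norm (X j \<omega>)) ^ 3) *
          nn_cond_exp \<Omega> (past \<Omega> X Y j) (\<lambda>\<omega>. ennreal (\<bar>Y j \<omega>\<bar> ^ 3)) \<omega>
          \<le> ennreal (4 * K * (1 + norm (X j \<omega>) powr q))"
        using YK[OF j]
      proof eventually_elim
        case (elim \<omega>)
        have "ennreal (1 + (norm (X j \<omega>)) ^ 3) *
          nn_cond_exp \<Omega> (past \<Omega> X Y j) (\<lambda>\<omega>. ennreal (\<bar>Y j \<omega>\<bar> ^ 3)) \<omega>
          \<le> ennreal (1 + (norm (X j \<omega>)) ^ 3) * ennreal (K * (1 + norm (X j \<omega>) powr C'))"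
          by (intro mult_left_mono elim) auto
        also have "\<dots> = ennreal ((1 + (norm (X j \<omega>)) ^ 3) * (K * (1 + norm (X j \<omega>) powr C')))"
          using C by (intro ennreal_mult[symmetric]) auto
        also have "\<dots> \<le> ennreal (4 * K * (1 + norm (X j \<omega>) powr q))"
          by (intro ennreal_leI pt) simp
        finally show ?case .
      qed
    qed
    also have "\<dots> = ennreal (4 * K) * (1 + (\<integral>\<^sup>+\<omega>. ennreal (norm (X j \<omega>) powr q) \<partial>\<Omega>))"
    proof -
      have "ennreal (4 * K * (1 + norm (X j \<omega>) powr q))
          = ennreal (4 * K) * (1 + ennreal (norm (X j \<omega>) powr q))" for \<omega>
        using C ennreal_mult[of "4 * K" "1 + norm (X j \<omega>) powr q"] by simp
      then show ?thesis by (simp add: nn_integral_cmult nn_integral_add emeasure_space_1)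
    qed
    also have "\<dots> \<le> ennreal (4 * K) * (1 + ennreal B)"
      by (intro mult_left_mono add_mono B[OF j]) auto
    also have "\<dots> = ennreal V"
      using C B0 by (simp add: V_def ennreal_mult)
    finally have UV: "(\<integral>\<^sup>+\<omega>. ennreal (U \<omega>) \<partial>\<Omega>) \<le> ennreal V" .
    have intU: "integrable \<Omega> U"
      using UV U0 by (intro integrableI_bounded) (auto intro: order.strict_trans1)
    have EU: "expectation U \<le> V"
      using UV V by (intro integral_real_bounded) auto
    have Y3: "\<bar>Y j \<omega>\<bar> ^ 3 \<le> U \<omega>" for \<omega>
      unfolding U_def by (simp add: mult_le_cancel_right1)
    have intY: "integrable \<Omega> (Y j)"
    proof (rule Bochner_Integration.integrable_bound)
      show "integrable \<Omega> (\<lambda>\<omega>. 1 + U \<omega>)" using intU by auto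
      show "AE \<omega> in \<Omega>. norm (Y j \<omega>) \<le> norm (1 + U \<omega>)"
      proof (rule AE_I2)
        fix \<omega> show "norm (Y j \<omega>) \<le> norm (1 + U \<omega>)"
          using power_le_one_plus_power[of "\<bar>Y j \<omega>\<bar>" 1 3] Y3[of \<omega>] U0[of \<omega>] by simp
      qed
    qed simp
    have pt2: "(Y j \<omega>)\<^sup>2 * (norm (X j \<omega>))\<^sup>2 \<le> 1 + U \<omega>" for \<omega>
    proof -
      have "(\<bar>Y j \<omega>\<bar> * norm (X j \<omega>))\<^sup>2 \<le> 1 + (\<bar>Y j \<omega>\<bar> * norm (X j \<omega>)) ^ 3"
        by (intro power_le_one_plus_power) auto
      also have "(\<bar>Y j \<omega>\<bar> * norm (X j \<omega>)) ^ 3 \<le> U \<omega>"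
        unfolding U_def power_mult_distrib by (simp add: algebra_simps)
      finally show ?thesis by (simp add: power_mult_distrib)
    qed
    have int2: "integrable \<Omega> (\<lambda>\<omega>. (Y j \<omega>)\<^sup>2 * (norm (X j \<omega>))\<^sup>2)"
    proof (rule Bochner_Integration.integrable_bound)
      show "integrable \<Omega> (\<lambda>\<omega>. 1 + U \<omega>)" using intU by auto
      show "AE \<omega> in \<Omega>. norm ((Y j \<omega>)\<^sup>2 * (norm (X j \<omega>))\<^sup>2) \<le> norm (1 + U \<omega>)"
        using pt2 U0 by (auto intro!: AE_I2 simp: abs_mult)
    qed measurable
    have "expectation (\<lambda>\<omega>. (Y j \<omega>)\<^sup>2 * (norm (X j \<omega>))\<^sup>2) \<le> expectation (\<lambda>\<omega>. 1 + U \<omega>)"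
      using intU by (intro integral_mono int2 pt2) auto
    also have "\<dots> = 1 + expectation U" using intU by (simp add: prob_space)
    finally show ?thesis using intY int2 EU by simp
  qed
  then show ?thesis using V by (intro exI[of _ "1 + V"]) auto
qed

section \<open>Orthogonal martingale increments\<close>

text \<open>With \<open>c\<close> a selected coordinate this is the increment of the martingale part
  of the score; with \<open>c\<close> a rescaled linear predictor it is the noise in the
  quasi-likelihood at a fixed parameter.\<close>

definition innovation :: "(real ^ 'p \<Rightarrow> real) \<Rightarrow> nat \<Rightarrow> 'w \<Rightarrow> real" where
  "innovation c j \<omega> = (Y j \<omega> - F (X j \<omega>)) * c (X j \<omega>)"

lemma innovation_meas:
  assumes "c \<in> borel_measurable borel" "j \<ge> 1"
  shows "innovation c j \<in> borel_measurable \<Omega>"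
proof -
  note X_meas[OF assms(2), measurable] Y_meas[OF assms(2), measurable] assms(1)[measurable]
  show ?thesis unfolding innovation_def[abs_def] by measurable
qed

lemma integrable_mult_of_squares:
  fixes f g :: "'w \<Rightarrow> real"
  assumes [measurable]: "f \<in> borel_measurable \<Omega>" "g \<in> borel_measurable \<Omega>"
    and "integrable \<Omega> (\<lambda>\<omega>. (f \<omega>)\<^sup>2)" "integrable \<Omega> (\<lambda>\<omega>. (g \<omega>)\<^sup>2)"
  shows "integrable \<Omega> (\<lambda>\<omega>. f \<omega> * g \<omega>)"
proof (rule Bochner_Integration.integrable_bound)
  show "integrable \<Omega> (\<lambda>\<omega>. (f \<omega>)\<^sup>2 + (g \<omega>)\<^sup>2)" using assms(3,4) by simp
  show "AE \<omega> in \<Omega>. norm (f \<omega> * g \<omega>) \<le> norm ((f \<omega>)\<^sup>2 + (g \<omega>)\<^sup>2)"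
  proof (rule AE_I2)
    fix \<omega>
    have "2 * (\<bar>f \<omega>\<bar> * \<bar>g \<omega>\<bar>) \<le> (f \<omega>)\<^sup>2 + (g \<omega>)\<^sup>2"
      using sum_squares_bound[of "\<bar>f \<omega>\<bar>" "\<bar>g \<omega>\<bar>"] by (simp add: mult.assoc)
    moreover have "0 \<le> \<bar>f \<omega>\<bar> * \<bar>g \<omega>\<bar>" by simp
    ultimately have "\<bar>f \<omega>\<bar> * \<bar>g \<omega>\<bar> \<le> (f \<omega>)\<^sup>2 + (g \<omega>)\<^sup>2" by linarith
    then show "norm (f \<omega> * g \<omega>) \<le> norm ((f \<omega>)\<^sup>2 + (g \<omega>)\<^sup>2)" by (simp add: abs_mult)
  qed
qed measurable

text \<open>An innovation is \<open>Z - W\<close>, where \<open>Z = c(X) Y\<close> and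
  \<open>W = c(X) F(X)\<close> is the conditional expectation of \<open>Z\<close> given the past.
  Orthogonality to a past-measurable \<open>f\<close> is the defining property of that expectation;
  the factor 4 comes from
  \<open>(Z - W)\<^sup>2 \<le> 2 * Z\<^sup>2 + 2 * W\<^sup>2\<close>.\<close>

lemma innovation_properties:
  assumes c [measurable]: "c \<in> borel_measurable borel" and cn: "\<And>x. \<bar>c x\<bar> \<le> norm x" and j: "j \<ge> 1"
    and V: "integrable \<Omega> (Y j)" "integrable \<Omega> (\<lambda>\<omega>. (Y j \<omega>)\<^sup>2 * (norm (X j \<omega>))\<^sup>2)"
      "expectation (\<lambda>\<omega>. (Y j \<omega>)\<^sup>2 * (norm (X j \<omega>))\<^sup>2) \<le> V"
  shows "integrable \<Omega> (\<lambda>\<omega>. (innovation c j \<omega>)\<^sup>2)"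
    and "expectation (\<lambda>\<omega>. (innovation c j \<omega>)\<^sup>2) \<le> 4 * V"
    and "\<And>f :: 'w \<Rightarrow> real. f \<in> borel_measurable (past \<Omega> X Y j) \<Longrightarrow> integrable \<Omega> (\<lambda>\<omega>. (f \<omega>)\<^sup>2) \<Longrightarrow>
      expectation (\<lambda>\<omega>. f \<omega> * innovation c j \<omega>) = 0"
proof -
  note X_meas[OF j, measurable] Y_meas[OF j, measurable]
  interpret G: sigma_finite_subalgebra \<Omega> "past \<Omega> X Y j" by (rule cond_exp_past[OF j])
  have Xp [measurable]: "X j \<in> borel_measurable (past \<Omega> X Y j)" by (rule measurable_past_X)
  define Z where "Z = (\<lambda>\<omega>. c (X j \<omega>) * Y j \<omega>)"
  define W where "W = (\<lambda>\<omega>. c (X j \<omega>) * F (X j \<omega>))"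
  have [measurable]: "Z \<in> borel_measurable \<Omega>" "W \<in> borel_measurable \<Omega>"
    unfolding Z_def W_def by measurable
  have Z2: "(Z \<omega>)\<^sup>2 \<le> (Y j \<omega>)\<^sup>2 * (norm (X j \<omega>))\<^sup>2" for \<omega>
  proof -
    have "(c (X j \<omega>))\<^sup>2 \<le> (norm (X j \<omega>))\<^sup>2" using cn[of "X j \<omega>"] by (intro abs_le_square_iff[THEN iffD1]) simp
    then show ?thesis unfolding Z_def power_mult_distrib by (simp add: mult.commute mult_left_mono)
  qed
  have intZ2: "integrable \<Omega> (\<lambda>\<omega>. (Z \<omega>)\<^sup>2)"
    by (rule Bochner_Integration.integrable_bound[OF V(2)]) (use Z2 in \<open>auto intro!: AE_I2\<close>)
  have EZ2: "expectation (\<lambda>\<omega>. (Z \<omega>)\<^sup>2) \<le> V"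
    using integral_mono[OF intZ2 V(2) Z2] V(3) by simp
  have intZ: "integrable \<Omega> Z"
    using integrable_mult_of_squares[of Z "\<lambda>_. 1"] intZ2 by simp
  have rce: "AE \<omega> in \<Omega>. real_cond_exp \<Omega> (past \<Omega> X Y j) Z \<omega> = W \<omega>"
  proof -
    have "AE \<omega> in \<Omega>. real_cond_exp \<Omega> (past \<Omega> X Y j) Z \<omega>
        = c (X j \<omega>) * real_cond_exp \<Omega> (past \<Omega> X Y j) (Y j) \<omega>"
      unfolding Z_def using intZ unfolding Z_def by (intro G.real_cond_exp_mult) measurable
    moreover have "AE \<omega> in \<Omega>. real_cond_exp \<Omega> (past \<Omega> X Y j) (Y j) \<omega> = F (X j \<omega>)"
      using A2 j by (simp add: condition_A2_def)
    ultimately show ?thesis by eventually_elim (simp add: W_def)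
  qed
  \<comment> \<open>Jensen's inequality passes the second moment of \<open>Z\<close> on to its
    conditional expectation \<open>W\<close>; this is how \<open>F\<close>, given only as a
    measurable function, acquires the moments used here.\<close>
  have jensen: "AE \<omega> in \<Omega>. (W \<omega>)\<^sup>2 \<le> real_cond_exp \<Omega> (past \<Omega> X Y j) (\<lambda>\<omega>. (Z \<omega>)\<^sup>2) \<omega>"
  proof -
    have "AE \<omega> in \<Omega>. (real_cond_exp \<Omega> (past \<Omega> X Y j) Z \<omega>)\<^sup>2
        \<le> real_cond_exp \<Omega> (past \<Omega> X Y j) (\<lambda>\<omega>. (Z \<omega>)\<^sup>2) \<omega>"
      by (rule G.real_cond_exp_jensens_inequality(2)[where I = UNIV and q = "\<lambda>x. x\<^sup>2"])
        (use intZ intZ2 in \<open>auto simp: convex_power2\<close>)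
    with rce show ?thesis by eventually_elim simp
  qed
  note rZ2 = G.real_cond_exp_int[OF intZ2]
  have intW2: "integrable \<Omega> (\<lambda>\<omega>. (W \<omega>)\<^sup>2)"
  proof (rule Bochner_Integration.integrable_bound[OF rZ2(1)])
    show "AE \<omega> in \<Omega>. norm ((W \<omega>)\<^sup>2) \<le> norm (real_cond_exp \<Omega> (past \<Omega> X Y j) (\<lambda>\<omega>. (Z \<omega>)\<^sup>2) \<omega>)"
      using jensen by eventually_elim auto
  qed measurable
  have EW2: "expectation (\<lambda>\<omega>. (W \<omega>)\<^sup>2) \<le> V"
    using integral_mono_AE[OF intW2 rZ2(1) jensen] rZ2(2) EZ2 by simp
  have inn: "innovation c j \<omega> = Z \<omega> - W \<omega>" for \<omega>
    by (simp add: innovation_def Z_def W_def algebra_simps)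
  have sq: "(innovation c j \<omega>)\<^sup>2 \<le> 2 * (Z \<omega>)\<^sup>2 + 2 * (W \<omega>)\<^sup>2" for \<omega>
    using zero_le_power2[of "Z \<omega> + W \<omega>"] unfolding inn by (simp add: power2_eq_square algebra_simps)
  have [measurable]: "innovation c j \<in> borel_measurable \<Omega>" by (rule innovation_meas[OF c j])
  show int: "integrable \<Omega> (\<lambda>\<omega>. (innovation c j \<omega>)\<^sup>2)"
  proof (rule Bochner_Integration.integrable_bound)
    show "integrable \<Omega> (\<lambda>\<omega>. 2 * (Z \<omega>)\<^sup>2 + 2 * (W \<omega>)\<^sup>2)" using intZ2 intW2 by simp
    show "AE \<omega> in \<Omega>. norm ((innovation c j \<omega>)\<^sup>2) \<le> norm (2 * (Z \<omega>)\<^sup>2 + 2 * (W \<omega>)\<^sup>2)"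
      using sq by (intro AE_I2) simp
  qed measurable
  have "expectation (\<lambda>\<omega>. (innovation c j \<omega>)\<^sup>2) \<le> expectation (\<lambda>\<omega>. 2 * (Z \<omega>)\<^sup>2 + 2 * (W \<omega>)\<^sup>2)"
    using intZ2 intW2 by (intro integral_mono int sq) auto
  also have "\<dots> = 2 * expectation (\<lambda>\<omega>. (Z \<omega>)\<^sup>2) + 2 * expectation (\<lambda>\<omega>. (W \<omega>)\<^sup>2)"
    using intZ2 intW2 by simp
  also have "\<dots> \<le> 4 * V" using EZ2 EW2 by simp
  finally show "expectation (\<lambda>\<omega>. (innovation c j \<omega>)\<^sup>2) \<le> 4 * V" .
  fix f :: "'w \<Rightarrow> real" assume f: "f \<in> borel_measurable (past \<Omega> X Y j)" "integrable \<Omega> (\<lambda>\<omega>. (f \<omega>)\<^sup>2)"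
  have [measurable]: "f \<in> borel_measurable \<Omega>" by (rule measurable_from_subalg[OF G.subalg f(1)])
  have fZ: "integrable \<Omega> (\<lambda>\<omega>. f \<omega> * Z \<omega>)" and fW: "integrable \<Omega> (\<lambda>\<omega>. f \<omega> * W \<omega>)"
    using f(2) intZ2 intW2 by (auto intro!: integrable_mult_of_squares)
  have "expectation (\<lambda>\<omega>. f \<omega> * Z \<omega>) = expectation (\<lambda>\<omega>. f \<omega> * real_cond_exp \<Omega> (past \<Omega> X Y j) Z \<omega>)"
    by (rule G.real_cond_exp_intg(2)[symmetric, OF fZ f(1)]) measurable
  also have "\<dots> = expectation (\<lambda>\<omega>. f \<omega> * W \<omega>)"
    by (rule integral_cong_AE) (use rce in \<open>auto simp: borel_measurable_cond_exp2\<close>)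
  finally show "expectation (\<lambda>\<omega>. f \<omega> * innovation c j \<omega>) = 0"
    using fZ fW by (simp add: inn right_diff_distrib)
qed

text \<open>Induction on \<open>n\<close>: in the square of the extended sum the cross term has
  expectation 0. The constant is fixed before \<open>c\<close> and \<open>n\<close>, so it serves
  all coordinates and all models.\<close>

lemma innovation_sum_second_moment:
  "\<exists>V. \<forall>c n. c \<in> borel_measurable borel \<longrightarrow> (\<forall>x. \<bar>c x\<bar> \<le> norm x) \<longrightarrow>
     integrable \<Omega> (\<lambda>\<omega>. (\<Sum>j=1..n. innovation c j \<omega>)\<^sup>2) \<and>
     expectation (\<lambda>\<omega>. (\<Sum>j=1..n. innovation c j \<omega>)\<^sup>2) \<le> real n * V"
proof -
  obtain V where V: "\<And>j. j \<ge> 1 \<Longrightarrow> integrable \<Omega> (Y j)"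
    "\<And>j. j \<ge> 1 \<Longrightarrow> integrable \<Omega> (\<lambda>\<omega>. (Y j \<omega>)\<^sup>2 * (norm (X j \<omega>))\<^sup>2)"
    "\<And>j. j \<ge> 1 \<Longrightarrow> expectation (\<lambda>\<omega>. (Y j \<omega>)\<^sup>2 * (norm (X j \<omega>))\<^sup>2) \<le> V"
    using response_moments by blast
  have "integrable \<Omega> (\<lambda>\<omega>. (\<Sum>j=1..n. innovation c j \<omega>)\<^sup>2) \<and>
     expectation (\<lambda>\<omega>. (\<Sum>j=1..n. innovation c j \<omega>)\<^sup>2) \<le> real n * (4 * V)"
    if c: "c \<in> borel_measurable borel" and cn: "\<And>x. \<bar>c x\<bar> \<le> norm x" for c n
  proof (induction n)
    case (Suc n)
    define S where "S = (\<lambda>\<omega>. \<Sum>j=1..n. innovation c j \<omega>)"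
    define D where "D = innovation c (Suc n)"
    have j: "Suc n \<ge> 1" by simp
    note D = innovation_properties[OF c cn j V[OF j], folded D_def]
    \<comment> \<open>The sum involves observations with index at most \<open>n\<close> only, which
      belong to the past of \<open>Suc n\<close>; this makes the new innovation orthogonal to
      it.\<close>
    have Sp: "S \<in> borel_measurable (past \<Omega> X Y (Suc n))"
      unfolding S_def innovation_def
    proof (intro borel_measurable_sum)
      fix i assume "i \<in> {1..n}"
      then have i: "1 \<le> i" "i < Suc n" by auto
      note [measurable] = measurable_past_observation[OF i, where \<Omega> = \<Omega> and X = X and Y = Y] c
      show "(\<lambda>\<omega>. (Y i \<omega> - F (X i \<omega>)) * c (X i \<omega>)) \<in> borel_measurable (past \<Omega> X Y (Suc n))"
        by measurable
    qed
    have S2: "integrable \<Omega> (\<lambda>\<omega>. (S \<omega>)\<^sup>2)" and ES2: "expectation (\<lambda>\<omega>. (S \<omega>)\<^sup>2) \<le> real n * (4 * V)"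
      using Suc by (auto simp: S_def)
    have [measurable]: "S \<in> borel_measurable \<Omega>" "D \<in> borel_measurable \<Omega>"
      unfolding S_def D_def by (auto intro!: borel_measurable_sum innovation_meas[OF c])
    have SD: "integrable \<Omega> (\<lambda>\<omega>. S \<omega> * D \<omega>)"
      using S2 D(1) by (intro integrable_mult_of_squares) auto
    have eq: "(\<Sum>j=1..Suc n. innovation c j \<omega>)\<^sup>2 = (S \<omega>)\<^sup>2 + 2 * (S \<omega> * D \<omega>) + (D \<omega>)\<^sup>2" for \<omega>
      by (simp add: S_def D_def power2_eq_square algebra_simps)
    have "expectation (\<lambda>\<omega>. (S \<omega>)\<^sup>2 + 2 * (S \<omega> * D \<omega>) + (D \<omega>)\<^sup>2)
        = expectation (\<lambda>\<omega>. (S \<omega>)\<^sup>2) + 2 * expectation (\<lambda>\<omega>. S \<omega> * D \<omega>) + expectation (\<lambda>\<omega>. (D \<omega>)\<^sup>2)"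
      using S2 SD D(1) by simp
    also have "\<dots> \<le> real (Suc n) * (4 * V)"
      using ES2 D(2) D(3)[OF Sp S2] by (simp add: algebra_simps)
    finally show ?case
      unfolding eq using S2 SD D(1) by simp
  qed simp
  then show ?thesis by blast
qed

end

subsection \<open>Asymptotics of a single model\<close>

lemma select_index_meas [measurable]:
  assumes "i < length ds"
  shows "(\<lambda>x :: real ^ 'p::finite. select ds x $ i) \<in> borel_measurable borel"
  using assms
  by (auto simp: select_def intro!: borel_measurable_continuous_onI linear_continuous_on
      bounded_linear_vec_nth)

lemma select_scalar_prod:
  assumes "\<theta> \<in> carrier_vec (length ds)"
  shows "select ds x \<bullet> \<theta> = (\<Sum>i<length ds. select ds x $ i * \<theta> $ i)"
  using assms by (simp add: scalar_prod_def lessThan_atLeast0)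

lemma select_scalar_prod_meas:
  assumes "\<theta> \<in> carrier_vec (length ds)"
  shows "(\<lambda>x :: real ^ 'p::finite. select ds x \<bullet> \<theta>) \<in> borel_measurable borel"
  unfolding select_scalar_prod[OF assms]
  by (intro borel_measurable_sum borel_measurable_times select_index_meas) auto

lemma abs_select_scalar_prod_le:
  assumes \<theta>: "\<theta> \<in> carrier_vec (length ds)" "vec_enorm \<theta> \<le> R"
  shows "\<bar>select ds x \<bullet> \<theta>\<bar> \<le> real (length ds) * R * norm x"
proof -
  have "\<bar>select ds x \<bullet> \<theta>\<bar> \<le> (\<Sum>i<length ds. \<bar>select ds x $ i * \<theta> $ i\<bar>)"
    unfolding select_scalar_prod[OF \<theta>(1)] by (rule sum_abs)
  also have "\<dots> \<le> (\<Sum>i<length ds. norm x * R)"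
    unfolding abs_mult
  proof (intro sum_mono mult_mono abs_select_le_norm)
    fix i assume "i \<in> {..<length ds}"
    then show "\<bar>\<theta> $ i\<bar> \<le> R" using abs_index_le_vec_enorm[of i \<theta>] \<theta> by auto
  qed auto
  finally show ?thesis by (simp add: mult_ac)
qed

lemma C3_function_meas:
  assumes "C3_function b"
  shows "b \<in> borel_measurable borel" "deriv b \<in> borel_measurable borel"
    "(deriv ^^ 2) b \<in> borel_measurable borel"
  using C3_function_continuous[OF assms] by (auto intro: borel_measurable_continuous_onI)

lemma tendsto_0_if_limsup_eq_0:
  fixes p :: "nat \<Rightarrow> real"
  assumes "limsup (\<lambda>n. ereal (p n)) = 0" "\<And>n. 0 \<le> p n"
  shows "p \<longlonglongrightarrow> 0"
proof -
  have "0 \<le> liminf (\<lambda>n. ereal (p n))"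
    using assms(2) by (intro Liminf_bounded) auto
  then show ?thesis
    using assms(1) by (intro limsup_le_liminf_real) (auto simp: zero_ereal_def)
qed

text \<open>A single candidate model. The limit \<open>H\<^sub>0\<close> is an abstract function
  here, tied to the data by the convergence in \<open>A4\<close>; the locale is interpreted twice,
  for the two models compared.\<close>

locale quasi_glm_model = quasi_glm \<Omega> X Y b F
  for \<Omega> :: "'w measure" and X :: "nat \<Rightarrow> 'w \<Rightarrow> real ^ 'p::finite" and Y b F +
  fixes ds :: "'p list" and \<Theta> :: "real vec set" and \<theta>hat :: "nat \<Rightarrow> 'w \<Rightarrow> real vec"
    and \<theta>\<^sub>0 :: "real vec" and H\<^sub>0 :: "real vec \<Rightarrow> real"
  assumes ds: "ds \<noteq> []"
    and dom: "bounded_convex_domain (length ds) \<Theta>"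
    and qmle: "\<And>n. n \<ge> 1 \<Longrightarrow> is_QMLE \<Omega> b X Y ds \<Theta> n (\<theta>hat n)"
    and \<theta>\<^sub>0: "\<theta>\<^sub>0 \<in> \<Theta>"
    and A4: "\<And>\<theta>. \<theta> \<in> \<Theta> \<Longrightarrow> conv_to_0_in_prob \<Omega> (\<lambda>n \<omega>.
      1 / real n * (\<Sum>j=1..n. F (X j \<omega>) * (select ds (X j \<omega>) \<bullet> \<theta>) - b (select ds (X j \<omega>) \<bullet> \<theta>))
      - H\<^sub>0 \<theta>)"
    and A5: "\<exists>bl :: real ^ 'p \<Rightarrow> real. (\<forall>x. 0 < bl x) \<and>
      (\<forall>x. \<forall>\<theta>\<in>\<Theta>. bl x \<le> (deriv ^^ 2) b (select ds x \<bullet> \<theta>)) \<and>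
      (\<exists>l>0.
         (\<forall>n\<ge>1. {\<omega>\<in>space \<Omega>. lambda_min ((1 / real n) \<cdot>\<^sub>m
            weighted_gram ds n (\<lambda>j. bl (X j \<omega>)) (\<lambda>j. X j \<omega>)) < l} \<in> sets \<Omega>) \<and>
         limsup (\<lambda>n. ereal (\<P>(\<omega> in \<Omega>. lambda_min ((1 / real n) \<cdot>\<^sub>m
            weighted_gram ds n (\<lambda>j. bl (X j \<omega>)) (\<lambda>j. X j \<omega>)) < l))) = 0)"
    and A6: "bounded_in_prob \<Omega> (\<lambda>n \<omega>. vec_enorm
      ((1 / sqrt (real n)) \<cdot>\<^sub>v Matrix.vec (length ds) (\<lambda>i. \<Sum>j=1..n.
         (F (X j \<omega>) - deriv b (select ds (X j \<omega>) \<bullet> \<theta>\<^sub>0)) * select ds (X j \<omega>) $ i)))"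
begin

abbreviation "k \<equiv> length ds"
abbreviation "H \<equiv> quasi_loglik b X Y ds"

definition gram_hat :: "nat \<Rightarrow> 'w \<Rightarrow> real mat" where
  "gram_hat n \<omega> = weighted_gram ds n
     (\<lambda>j. (deriv ^^ 2) b (select ds (X j \<omega>) \<bullet> \<theta>hat n \<omega>)) (\<lambda>j. X j \<omega>)"

lemma QBIC_gram_hat:
  "QBIC b X Y ds n (\<theta>hat n) \<omega> = - 2 * H n (\<theta>hat n \<omega>) \<omega> + ln (Determinant.det (gram_hat n \<omega>))"
  by (simp add: QBIC_def gram_hat_def)

lemmas b_meas [measurable] = C3_function_meas[OF b_C3]

lemma QMLE_in_domain:
  assumes "n \<ge> 1" "\<omega> \<in> space \<Omega>"
  shows "\<theta>hat n \<omega> \<in> \<Theta>"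
  using qmle[OF assms(1)] assms(2) by (auto simp: is_QMLE_def)

lemma QBIC_meas:
  assumes n: "n \<ge> 1"
  shows "QBIC b X Y ds n (\<theta>hat n) \<in> borel_measurable \<Omega>"
proof -
  have sel: "(\<lambda>\<omega>. select ds (X j \<omega>) $ i) \<in> borel_measurable \<Omega>" if "j \<in> {1..n}" "i < k" for i j
    using measurable_compose[OF X_meas select_index_meas] that by auto
  have hat: "(\<lambda>\<omega>. \<theta>hat n \<omega> $ i) \<in> borel_measurable \<Omega>" if "i < k" for i
    using qmle[OF n] that by (auto simp: is_QMLE_def)
  \<comment> \<open>The sum formula for the scalar product presupposes the dimension of
    \<open>\<theta>hat n \<omega>\<close>, which is known for \<open>\<omega>\<close> in the space;
    hence the detour through \<open>measurable_cong\<close>.\<close>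
  have prod: "(\<lambda>\<omega>. select ds (X j \<omega>) \<bullet> \<theta>hat n \<omega>) \<in> borel_measurable \<Omega>" if "j \<in> {1..n}" for j
  proof (rule measurable_cong[THEN iffD1])
    show "(\<Sum>i<k. select ds (X j \<omega>) $ i * \<theta>hat n \<omega> $ i) = select ds (X j \<omega>) \<bullet> \<theta>hat n \<omega>"
      if "\<omega> \<in> space \<Omega>" for \<omega>
      using select_scalar_prod[OF domain_carrier[OF dom QMLE_in_domain[OF n that]]] by simp
    show "(\<lambda>\<omega>. \<Sum>i<k. select ds (X j \<omega>) $ i * \<theta>hat n \<omega> $ i) \<in> borel_measurable \<Omega>"
      using sel[OF that] hat by (intro borel_measurable_sum borel_measurable_times) auto
  qed
  have "(\<lambda>\<omega>. H n (\<theta>hat n \<omega>) \<omega>) \<in> borel_measurable \<Omega>"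
    unfolding quasi_loglik_def
    by (intro borel_measurable_sum borel_measurable_diff borel_measurable_times prod Y_meas
        measurable_compose[OF prod b_meas(1)]) auto
  \<comment> \<open>By the Leibniz formula the determinant is a polynomial in the entries.\<close>
  moreover have "(\<lambda>\<omega>. Determinant.det (gram_hat n \<omega>)) \<in> borel_measurable \<Omega>"
  proof -
    have "gram_hat n \<omega> \<in> carrier_mat k k" for \<omega> by (simp add: gram_hat_def)
    then have det: "Determinant.det (gram_hat n \<omega>) = (\<Sum>p\<in>{p. p permutes {0..<k}}.
        signof p * (\<Prod>i=0..<k. gram_hat n \<omega> $$ (i, p i)))" for \<omega>
      by (rule det_def')
    have entry: "(\<lambda>\<omega>. gram_hat n \<omega> $$ (r, s)) \<in> borel_measurable \<Omega>" if "r < k" "s < k" for r s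
    proof -
      have "(\<lambda>\<omega>. \<Sum>j=1..n. (deriv ^^ 2) b (select ds (X j \<omega>) \<bullet> \<theta>hat n \<omega>) *
          (select ds (X j \<omega>) $ r * select ds (X j \<omega>) $ s)) \<in> borel_measurable \<Omega>"
        using that
        by (intro borel_measurable_sum borel_measurable_times sel
            measurable_compose[OF prod b_meas(3)]) auto
      then show ?thesis using that by (simp add: gram_hat_def weighted_gram_def)
    qed
    show ?thesis
      unfolding det
      by (intro borel_measurable_sum borel_measurable_times borel_measurable_prod entry
          borel_measurable_const) (auto dest: permutes_in_image)
  qed
  ultimately show ?thesis
    unfolding QBIC_gram_hat[abs_def] by measurable
qed

lemma score_bounded:
  assumes \<epsilon>: "\<epsilon> > 0"
  shows "\<exists>R>0. likely \<Omega> \<epsilon> (\<lambda>n \<omega>. vec_enorm (score b X Y ds n \<theta>\<^sub>0 \<omega>) \<le> R * sqrt (real n))"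
proof -
  let ?c = "\<lambda>i x. select ds x $ i"
  \<comment> \<open>\<open>Z\<close> is the squared norm of the martingale part of the score at
    \<open>\<theta>\<^sub>0\<close>; \<open>v\<close> is the part that (A6) bounds after division by
    \<open>sqrt (real n)\<close>.\<close>
  define Z where "Z = (\<lambda>n \<omega>. \<Sum>i<k. (\<Sum>j=1..n. innovation (?c i) j \<omega>)\<^sup>2)"
  define v where "v = (\<lambda>n \<omega>. Matrix.vec k (\<lambda>i. \<Sum>j=1..n.
         (F (X j \<omega>) - deriv b (select ds (X j \<omega>) \<bullet> \<theta>\<^sub>0)) * select ds (X j \<omega>) $ i))"
  obtain V where V: "\<And>i n. i < k \<Longrightarrow> integrable \<Omega> (\<lambda>\<omega>. (\<Sum>j=1..n. innovation (?c i) j \<omega>)\<^sup>2)"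
    "\<And>i n. i < k \<Longrightarrow> expectation (\<lambda>\<omega>. (\<Sum>j=1..n. innovation (?c i) j \<omega>)\<^sup>2) \<le> real n * V"
    using innovation_sum_second_moment select_index_meas[of _ ds] abs_select_le_norm[of _ ds] by blast
  have intZ: "integrable \<Omega> (Z n)" for n unfolding Z_def using V(1) by auto
  have EZ: "expectation (Z n) \<le> real n * (real k * V)" for n
  proof -
    have "expectation (Z n) = (\<Sum>i<k. expectation (\<lambda>\<omega>. (\<Sum>j=1..n. innovation (?c i) j \<omega>)\<^sup>2))"
      unfolding Z_def using V(1) by (intro Bochner_Integration.integral_sum) auto
    also have "\<dots> \<le> (\<Sum>i<k. real n * V)" using V(2) by (intro sum_mono) auto
    finally show ?thesis by (simp add: mult_ac)
  qed
  obtain R\<^sub>1 where R\<^sub>1: "R\<^sub>1 > 0" "likely \<Omega> (\<epsilon> / 2) (\<lambda>n \<omega>. Z n \<omega> \<le> R\<^sub>1 * real n)"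
    using likely_Markov[of Z "real k * V" "\<epsilon> / 2", OF intZ _ EZ] \<epsilon> by (auto simp: Z_def sum_nonneg)
  have v_meas: "(\<lambda>\<omega>. v n \<omega> $ i) \<in> borel_measurable \<Omega>" if "i < k" for n i
  proof -
    have "(\<lambda>\<omega>. \<Sum>j=1..n. (F (X j \<omega>) - deriv b (select ds (X j \<omega>) \<bullet> \<theta>\<^sub>0)) * select ds (X j \<omega>) $ i)
        \<in> borel_measurable \<Omega>"
    proof (rule borel_measurable_sum)
      fix j assume "j \<in> {1..n}"
      then have [measurable]: "X j \<in> borel_measurable \<Omega>" by (intro X_meas) auto
      note [measurable] = select_index_meas[OF that] select_scalar_prod_meas[OF domain_carrier[OF dom \<theta>\<^sub>0]]
      show "(\<lambda>\<omega>. (F (X j \<omega>) - deriv b (select ds (X j \<omega>) \<bullet> \<theta>\<^sub>0)) * select ds (X j \<omega>) $ i)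
        \<in> borel_measurable \<Omega>"
        by measurable
    qed
    then show ?thesis using that by (simp add: v_def)
  qed
  have v_dim: "dim_vec (v n \<omega>) = k" for n \<omega> by (simp add: v_def)
  have "\<exists>R. likely \<Omega> (\<epsilon> / 2) (\<lambda>n \<omega>. \<bar>vec_enorm ((1 / sqrt (real n)) \<cdot>\<^sub>v v n \<omega>)\<bar> \<le> R)"
  proof (rule likely_if_bounded_in_prob)
    show "bounded_in_prob \<Omega> (\<lambda>n \<omega>. vec_enorm ((1 / sqrt (real n)) \<cdot>\<^sub>v v n \<omega>))"
      using A6 unfolding v_def .
    show "(\<lambda>\<omega>. vec_enorm ((1 / sqrt (real n)) \<cdot>\<^sub>v v n \<omega>)) \<in> borel_measurable \<Omega>" for n
      unfolding vec_enorm_def scalar_prod_def using v_meas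
      by (auto simp: v_dim intro!: borel_measurable_sum borel_measurable_times
          measurable_compose[OF _ borel_measurable_sqrt])
  qed (use \<epsilon> in auto)
  then obtain R\<^sub>2 where R\<^sub>2: "likely \<Omega> (\<epsilon> / 2) (\<lambda>n \<omega>. \<bar>vec_enorm ((1 / sqrt (real n)) \<cdot>\<^sub>v v n \<omega>)\<bar> \<le> R\<^sub>2)"
    by blast
  \<comment> \<open>The factors 2 come from
    \<open>(a + v)\<^sup>2 \<le> 2 * a\<^sup>2 + 2 * v\<^sup>2\<close> in each coordinate.\<close>
  define R where "R = sqrt (2 * R\<^sub>1 + 2 * R\<^sub>2\<^sup>2)"
  have "likely \<Omega> (\<epsilon> / 2 + \<epsilon> / 2) (\<lambda>n \<omega>. vec_enorm (score b X Y ds n \<theta>\<^sub>0 \<omega>) \<le> R * sqrt (real n))"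
  proof (rule likely_mono[OF likely_conj[OF R\<^sub>1(2) R\<^sub>2], of 1])
    fix n :: nat and \<omega> assume n: "n \<ge> 1" and
      ev: "Z n \<omega> \<le> R\<^sub>1 * real n \<and> \<bar>vec_enorm ((1 / sqrt (real n)) \<cdot>\<^sub>v v n \<omega>)\<bar> \<le> R\<^sub>2"
    define a where "a = (\<lambda>i. \<Sum>j=1..n. innovation (?c i) j \<omega>)"
    have "(vec_enorm ((1 / sqrt (real n)) \<cdot>\<^sub>v v n \<omega>))\<^sup>2 = (v n \<omega> \<bullet> v n \<omega>) / real n"
      unfolding vec_enorm_sq by (simp add: v_dim)
    moreover have "(vec_enorm ((1 / sqrt (real n)) \<cdot>\<^sub>v v n \<omega>))\<^sup>2 \<le> R\<^sub>2\<^sup>2"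
      using ev by (intro power_mono) auto
    ultimately have vv: "v n \<omega> \<bullet> v n \<omega> \<le> R\<^sub>2\<^sup>2 * real n"
      using n by (simp add: pos_divide_le_eq)
    have sc: "score b X Y ds n \<theta>\<^sub>0 \<omega> $ i = a i + v n \<omega> $ i" if "i < k" for i
      using that by (simp add: score_def a_def v_def innovation_def sum.distrib[symmetric] algebra_simps)
    have sc_dim: "dim_vec (score b X Y ds n \<theta>\<^sub>0 \<omega>) = k" by (simp add: score_def)
    have "(vec_enorm (score b X Y ds n \<theta>\<^sub>0 \<omega>))\<^sup>2 = (\<Sum>i<k. (a i + v n \<omega> $ i)\<^sup>2)"
      unfolding vec_enorm_sq scalar_prod_def
      by (auto simp: sc sc_dim power2_eq_square lessThan_atLeast0 intro!: sum.cong)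
    also have "\<dots> \<le> (\<Sum>i<k. 2 * (a i)\<^sup>2 + 2 * (v n \<omega> $ i)\<^sup>2)"
    proof (rule sum_mono)
      fix i
      show "(a i + v n \<omega> $ i)\<^sup>2 \<le> 2 * (a i)\<^sup>2 + 2 * (v n \<omega> $ i)\<^sup>2"
        using zero_le_power2[of "a i - v n \<omega> $ i"] by (simp add: power2_eq_square algebra_simps)
    qed
    also have "\<dots> = 2 * Z n \<omega> + 2 * (v n \<omega> \<bullet> v n \<omega>)"
      by (simp add: Z_def a_def scalar_prod_def v_dim sum.distrib sum_distrib_left lessThan_atLeast0 power2_eq_square)
    also have "\<dots> \<le> (2 * R\<^sub>1 + 2 * R\<^sub>2\<^sup>2) * real n"
      using ev vv by (simp add: algebra_simps)
    finally have "vec_enorm (score b X Y ds n \<theta>\<^sub>0 \<omega>) \<le> sqrt ((2 * R\<^sub>1 + 2 * R\<^sub>2\<^sup>2) * real n)"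
      by (rule real_le_rsqrt)
    then show "vec_enorm (score b X Y ds n \<theta>\<^sub>0 \<omega>) \<le> R * sqrt (real n)"
      by (simp add: R_def real_sqrt_mult)
  qed
  moreover have "R > 0" using R\<^sub>1(1) by (simp add: R_def add_pos_nonneg)
  ultimately show ?thesis by auto
qed

text \<open>\<open>l\<close> is the eigenvalue bound of (A5). It is chosen before
  \<open>\<epsilon>\<close>, because the probability that the bound fails tends to 0. Measurability
  is supplied by the eigenvalue event, which implies the curvature event.\<close>

lemma curvature_linear:
  "\<exists>l>0. \<forall>\<epsilon>>0. likely \<Omega> \<epsilon> (\<lambda>n \<omega>. curvature_ge b ds \<Theta> n X \<omega> (real n * l))"
proof -
  obtain bl l where bl: "\<And>x \<theta>. \<theta> \<in> \<Theta> \<Longrightarrow> bl x \<le> (deriv ^^ 2) b (select ds x \<bullet> \<theta>)" and l: "l > 0"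
    and meas: "\<And>n. n \<ge> 1 \<Longrightarrow> {\<omega>\<in>space \<Omega>. lambda_min ((1 / real n) \<cdot>\<^sub>m
            weighted_gram ds n (\<lambda>j. bl (X j \<omega>)) (\<lambda>j. X j \<omega>)) < l} \<in> sets \<Omega>"
    and lim: "limsup (\<lambda>n. ereal (\<P>(\<omega> in \<Omega>. lambda_min ((1 / real n) \<cdot>\<^sub>m
            weighted_gram ds n (\<lambda>j. bl (X j \<omega>)) (\<lambda>j. X j \<omega>)) < l))) = 0"
    using A5 by blast
  define m where "m = (\<lambda>n \<omega>. lambda_min ((1 / real n) \<cdot>\<^sub>m
            weighted_gram ds n (\<lambda>j. bl (X j \<omega>)) (\<lambda>j. X j \<omega>)))"
  have "likely \<Omega> \<epsilon> (\<lambda>n \<omega>. curvature_ge b ds \<Theta> n X \<omega> (real n * l))" if \<epsilon>: "\<epsilon> > 0" for \<epsilon>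
  proof (rule likely_mono[of _ "\<lambda>n \<omega>. l \<le> m n \<omega>" 1])
    show "likely \<Omega> \<epsilon> (\<lambda>n \<omega>. l \<le> m n \<omega>)"
    proof (rule likely_if_prob_tendsto_0[where N = 1])
      show "(\<lambda>n. prob {\<omega>\<in>space \<Omega>. \<not> l \<le> m n \<omega>}) \<longlonglongrightarrow> 0"
        using tendsto_0_if_limsup_eq_0[OF lim] by (simp add: m_def not_le)
      fix n :: nat assume "1 \<le> n"
      then have "space \<Omega> - {\<omega>\<in>space \<Omega>. m n \<omega> < l} \<in> sets \<Omega>"
        using meas unfolding m_def by (intro sets.compl_sets)
      also have "space \<Omega> - {\<omega>\<in>space \<Omega>. m n \<omega> < l} = {\<omega>\<in>space \<Omega>. l \<le> m n \<omega>}" by auto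
      finally show "{\<omega>\<in>space \<Omega>. l \<le> m n \<omega>} \<in> sets \<Omega>" .
    qed (rule \<epsilon>)
    fix n :: nat and \<omega> assume n: "n \<ge> 1" and ml: "l \<le> m n \<omega>"
    show "curvature_ge b ds \<Theta> n X \<omega> (real n * l)"
      unfolding curvature_ge_def
    proof (intro exI[of _ bl] conjI allI ballI)
      fix u :: "real vec" assume "u \<in> carrier_vec k"
      then show "real n * l * (u \<bullet> u) \<le> (\<Sum>j=1..n. bl (X j \<omega>) * (select ds (X j \<omega>) \<bullet> u)\<^sup>2)"
        using lambda_min_gram_le[OF n ds, of u l "\<lambda>j. bl (X j \<omega>)" "\<lambda>j. X j \<omega>"] ml
        by (simp add: m_def)
    qed (rule bl)
  qed
  then show ?thesis using l by blast
qed

text \<open>The quantifier over \<open>\<Theta>\<close> stands inside the event, so that the bound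
  may be used at the estimator, which depends on the same data.\<close>

lemma weights_bounded:
  assumes \<epsilon>: "\<epsilon> > 0"
  shows "\<exists>R>0. likely \<Omega> \<epsilon> (\<lambda>n \<omega>. \<forall>\<theta>\<in>\<Theta>.
    (\<Sum>j=1..n. \<bar>(deriv ^^ 2) b (select ds (X j \<omega>) \<bullet> \<theta>)\<bar> * (norm (X j \<omega>))\<^sup>2) \<le> R * real n)"
proof -
  obtain R where R: "\<And>\<theta>. \<theta> \<in> \<Theta> \<Longrightarrow> vec_enorm \<theta> \<le> R"
    using dom unfolding bounded_convex_domain_def by blast
  then have R0: "0 \<le> R" using \<theta>\<^sub>0 vec_enorm_nonneg order_trans by blast
  obtain w V where w: "\<And>t. 0 \<le> w t"
    "\<And>s t. \<bar>s\<bar> \<le> real k * R * t \<Longrightarrow> \<bar>(deriv ^^ 2) b s\<bar> \<le> w t"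
    and V: "\<And>j. j \<ge> 1 \<Longrightarrow> integrable \<Omega> (\<lambda>\<omega>. w (norm (X j \<omega>)) * (norm (X j \<omega>))\<^sup>2)"
      "\<And>j. j \<ge> 1 \<Longrightarrow> expectation (\<lambda>\<omega>. w (norm (X j \<omega>)) * (norm (X j \<omega>))\<^sup>2) \<le> V"
    using covariate_weight_moments[OF mult_nonneg_nonneg[OF of_nat_0_le_iff R0], of k] by blast
  define Z where "Z = (\<lambda>n \<omega>. \<Sum>j=1..n. w (norm (X j \<omega>)) * (norm (X j \<omega>))\<^sup>2)"
  have intZ: "integrable \<Omega> (Z n)" for n unfolding Z_def using V(1) by auto
  have EZ: "expectation (Z n) \<le> real n * V" for n
  proof -
    have "expectation (Z n) = (\<Sum>j=1..n. expectation (\<lambda>\<omega>. w (norm (X j \<omega>)) * (norm (X j \<omega>))\<^sup>2))"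
      unfolding Z_def using V(1) by (intro Bochner_Integration.integral_sum) auto
    also have "\<dots> \<le> (\<Sum>j=1..n. V)" using V(2) by (intro sum_mono) auto
    finally show ?thesis by simp
  qed
  obtain S where S: "S > 0" "likely \<Omega> \<epsilon> (\<lambda>n \<omega>. Z n \<omega> \<le> S * real n)"
    using likely_Markov[of Z V \<epsilon>, OF intZ _ EZ \<epsilon>] w(1) by (auto simp: Z_def sum_nonneg)
  have "likely \<Omega> \<epsilon> (\<lambda>n \<omega>. \<forall>\<theta>\<in>\<Theta>.
    (\<Sum>j=1..n. \<bar>(deriv ^^ 2) b (select ds (X j \<omega>) \<bullet> \<theta>)\<bar> * (norm (X j \<omega>))\<^sup>2) \<le> S * real n)"
  proof (rule likely_mono[OF S(2), of 0], intro ballI)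
    fix n \<omega> \<theta> assume ev: "Z n \<omega> \<le> S * real n" and \<theta>: "\<theta> \<in> \<Theta>"
    have "(\<Sum>j=1..n. \<bar>(deriv ^^ 2) b (select ds (X j \<omega>) \<bullet> \<theta>)\<bar> * (norm (X j \<omega>))\<^sup>2) \<le> Z n \<omega>"
      unfolding Z_def
      by (intro sum_mono mult_right_mono w(2) abs_select_scalar_prod_le domain_carrier[OF dom \<theta>] R[OF \<theta>]) auto
    then show "(\<Sum>j=1..n. \<bar>(deriv ^^ 2) b (select ds (X j \<omega>) \<bullet> \<theta>)\<bar> * (norm (X j \<omega>))\<^sup>2) \<le> S * real n"
      using ev by simp
  qed
  then show ?thesis using S(1) by blast
qed

text \<open>Three events, each failing with probability at most \<open>\<epsilon> / 3\<close>,
  reduce the claim to the bounds at a fixed \<open>\<omega>\<close> with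
  \<open>\<kappa> = real n * l\<close> and \<open>W = R\<^sub>2 * real n\<close>. Both the score
  bound squared and \<open>\<kappa>\<close> are of order \<open>n\<close>, so their quotient stays
  bounded.\<close>

lemma QMLE_expansion:
  assumes \<epsilon>: "\<epsilon> > 0"
  shows "\<exists>R. likely \<Omega> \<epsilon> (\<lambda>n \<omega>. H n \<theta>\<^sub>0 \<omega> \<le> H n (\<theta>hat n \<omega>) \<omega> \<and> H n (\<theta>hat n \<omega>) \<omega> \<le> H n \<theta>\<^sub>0 \<omega> + R \<and>
     \<bar>ln (Determinant.det (gram_hat n \<omega>)) - real k * ln (real n)\<bar> \<le> R)"
proof -
  obtain l where l: "l > 0"
    and curv: "likely \<Omega> (\<epsilon> / 3) (\<lambda>n \<omega>. curvature_ge b ds \<Theta> n X \<omega> (real n * l))"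
    using curvature_linear \<epsilon> by (metis zero_less_divide_iff zero_less_numeral)
  obtain R\<^sub>1 where R\<^sub>1: "R\<^sub>1 > 0" "likely \<Omega> (\<epsilon> / 3) (\<lambda>n \<omega>. vec_enorm (score b X Y ds n \<theta>\<^sub>0 \<omega>) \<le> R\<^sub>1 * sqrt (real n))"
    using score_bounded[of "\<epsilon> / 3"] \<epsilon> by auto
  obtain R\<^sub>2 where R\<^sub>2: "R\<^sub>2 > 0" "likely \<Omega> (\<epsilon> / 3) (\<lambda>n \<omega>. \<forall>\<theta>\<in>\<Theta>.
    (\<Sum>j=1..n. \<bar>(deriv ^^ 2) b (select ds (X j \<omega>) \<bullet> \<theta>)\<bar> * (norm (X j \<omega>))\<^sup>2) \<le> R\<^sub>2 * real n)"
    using weights_bounded[of "\<epsilon> / 3"] \<epsilon> by auto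
  obtain \<delta> where \<delta>: "\<delta> > 0" "\<And>v. v \<in> carrier_vec k \<Longrightarrow> vec_enorm (v - \<theta>\<^sub>0) < \<delta> \<Longrightarrow> v \<in> \<Theta>"
    using dom \<theta>\<^sub>0 unfolding bounded_convex_domain_def by blast
  \<comment> \<open>The first summand is
    \<open>(R\<^sub>1 * sqrt (real n))\<^sup>2 / (2 * (real n * l))\<close>; the others are what
    remains of the two log-determinant bounds once \<open>real k * ln (real n)\<close> is removed.
    One constant serves both claims.\<close>
  define R where "R = R\<^sub>1\<^sup>2 / (2 * l) + real k * \<bar>ln l\<bar> + ln (fact k) + real k * \<bar>ln R\<^sub>2\<bar>"
  \<comment> \<open>From \<open>N\<close> on, \<open>2 * R\<^sub>1 * sqrt (real n)\<close> is less
    than \<open>real n * l * \<delta>\<close>: the ball on which the maximum is sought fits into the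
    ball of radius \<open>\<delta>\<close> inside \<open>\<Theta>\<close>.\<close>
  obtain N :: nat where N: "(2 * R\<^sub>1 / (l * \<delta>))\<^sup>2 < real N" using reals_Archimedean2 by blast
  have "likely \<Omega> (\<epsilon> / 3 + \<epsilon> / 3 + \<epsilon> / 3) (\<lambda>n \<omega>. H n \<theta>\<^sub>0 \<omega> \<le> H n (\<theta>hat n \<omega>) \<omega> \<and> H n (\<theta>hat n \<omega>) \<omega> \<le> H n \<theta>\<^sub>0 \<omega> + R \<and>
     \<bar>ln (Determinant.det (gram_hat n \<omega>)) - real k * ln (real n)\<bar> \<le> R)"
  proof (rule likely_mono[OF likely_conj[OF likely_conj[OF curv R\<^sub>1(2)] R\<^sub>2(2)], of "max 1 N"])
    fix n :: nat and \<omega>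
    assume n': "max 1 N \<le> n" and \<omega>: "\<omega> \<in> space \<Omega>"
      and ev: "(curvature_ge b ds \<Theta> n X \<omega> (real n * l) \<and>
        vec_enorm (score b X Y ds n \<theta>\<^sub>0 \<omega>) \<le> R\<^sub>1 * sqrt (real n)) \<and> (\<forall>\<theta>\<in>\<Theta>.
        (\<Sum>j=1..n. \<bar>(deriv ^^ 2) b (select ds (X j \<omega>) \<bullet> \<theta>)\<bar> * (norm (X j \<omega>))\<^sup>2) \<le> R\<^sub>2 * real n)"
    have n: "n \<ge> 1" "n \<ge> N" using n' by auto
    then have n0: "0 < real n" by simp
    let ?s = "vec_enorm (score b X Y ds n \<theta>\<^sub>0 \<omega>)"
    have curv': "curvature_ge b ds \<Theta> n X \<omega> (real n * l)" using ev by blast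
    have nl: "0 < real n * l" using n0 l by simp
    have small: "2 * ?s < real n * l * \<delta>"
    proof -
      have "(2 * R\<^sub>1 / (l * \<delta>))\<^sup>2 < real n" using N n by linarith
      then have "2 * R\<^sub>1 / (l * \<delta>) < sqrt (real n)" by (rule real_less_rsqrt)
      then have "2 * R\<^sub>1 < sqrt (real n) * (l * \<delta>)" using l \<delta>(1) by (simp add: field_simps)
      then have "2 * R\<^sub>1 * sqrt (real n) < sqrt (real n) * (l * \<delta>) * sqrt (real n)"
        using n0 by (intro mult_strict_right_mono) auto
      also have "sqrt (real n) * (l * \<delta>) * sqrt (real n) = (sqrt (real n))\<^sup>2 * (l * \<delta>)"
        by (simp only: power2_eq_square mult_ac)
      finally show ?thesis using ev n0 by (simp add: mult_ac)
    qed
    note Q = QMLE_loglik_bounds[OF b_C3 dom \<theta>\<^sub>0 curv' nl \<delta>(2) small qmle[OF n(1)] \<omega>]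
    have "?s\<^sup>2 \<le> (R\<^sub>1 * sqrt (real n))\<^sup>2" using ev by (intro power_mono) auto
    then have "?s\<^sup>2 / (2 * (real n * l)) \<le> (R\<^sub>1\<^sup>2 * real n) / (2 * (real n * l))"
      using nl by (intro divide_right_mono) (auto simp: power_mult_distrib)
    also have "\<dots> = R\<^sub>1\<^sup>2 / (2 * l)" using n0 by simp
    also have "\<dots> \<le> R" unfolding R_def by (simp add: fact_ge_1)
    finally have up: "H n (\<theta>hat n \<omega>) \<omega> \<le> H n \<theta>\<^sub>0 \<omega> + R" using Q(2) by linarith
    have \<theta>: "\<theta>hat n \<omega> \<in> \<Theta>" by (rule QMLE_in_domain[OF n(1) \<omega>])
    have D: "real k * ln (real n * l) \<le> ln (Determinant.det (gram_hat n \<omega>))"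
      "ln (Determinant.det (gram_hat n \<omega>)) \<le> ln (fact k) + real k * ln (R\<^sub>2 * real n)"
      unfolding gram_hat_def
      by (rule ln_det_gram_bounds[OF ds nl curv' \<theta> refl, where W = "R\<^sub>2 * real n"],
          use ev \<theta> R\<^sub>2(1) n0 in auto)+
    have k1: "\<bar>real k * ln l\<bar> = real k * \<bar>ln l\<bar>" and k2: "\<bar>real k * ln R\<^sub>2\<bar> = real k * \<bar>ln R\<^sub>2\<bar>"
      by (simp_all add: abs_mult)
    have "0 \<le> R\<^sub>1\<^sup>2 / (2 * l)" "0 \<le> ln (fact k :: real)" using l by (auto simp: fact_ge_1)
    moreover have "real k * ln (real n * l) = real k * ln (real n) + real k * ln l"
      "real k * ln (R\<^sub>2 * real n) = real k * ln R\<^sub>2 + real k * ln (real n)"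
      using l R\<^sub>2(1) n0 by (simp_all add: ln_mult distrib_left)
    ultimately have "\<bar>ln (Determinant.det (gram_hat n \<omega>)) - real k * ln (real n)\<bar> \<le> R"
      unfolding R_def using D k1 k2 by linarith
    then show "H n \<theta>\<^sub>0 \<omega> \<le> H n (\<theta>hat n \<omega>) \<omega> \<and> H n (\<theta>hat n \<omega>) \<omega> \<le> H n \<theta>\<^sub>0 \<omega> + R \<and>
     \<bar>ln (Determinant.det (gram_hat n \<omega>)) - real k * ln (real n)\<bar> \<le> R"
      using Q(1) up by blast
  qed
  then show ?thesis by auto
qed

text \<open>\<open>H n \<theta> \<omega>\<close> is a sum of innovations, of order
  \<open>sqrt (real n)\<close> by its second moment, plus the sum with
  \<open>F (X j \<omega>)\<close> in place of \<open>Y j \<omega>\<close>, to which (A4)(i)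
  applies.\<close>

lemma loglik_law_of_large_numbers:
  assumes \<theta>: "\<theta> \<in> \<Theta>" and \<epsilon>: "\<epsilon> > 0" and \<delta>: "\<delta> > 0"
  shows "likely \<Omega> \<epsilon> (\<lambda>n \<omega>. \<bar>H n \<theta> \<omega> - real n * H\<^sub>0 \<theta>\<bar> \<le> \<delta> * real n)"
proof -
  have \<theta>c: "\<theta> \<in> carrier_vec k" by (rule domain_carrier[OF dom \<theta>])
  note [measurable] = select_scalar_prod_meas[OF \<theta>c]
  \<comment> \<open>Normalizes the linear predictor so that \<open>c\<close> is bounded by the norm,
    as the second-moment bound requires; the summand 1 avoids division by 0 when
    \<open>\<theta>\<close> is zero.\<close>
  define \<rho> where "\<rho> = real k * vec_enorm \<theta> + 1"
  have \<rho>: "\<rho> > 0" by (simp add: \<rho>_def add_nonneg_pos)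
  define c where "c = (\<lambda>x. (select ds x \<bullet> \<theta>) / \<rho>)"
  have c_meas: "c \<in> borel_measurable borel" unfolding c_def by measurable
  have c_le: "\<bar>c x\<bar> \<le> norm x" for x
  proof -
    have "\<bar>select ds x \<bullet> \<theta>\<bar> \<le> real k * vec_enorm \<theta> * norm x"
      by (rule abs_select_scalar_prod_le[OF \<theta>c order_refl])
    also have "\<dots> \<le> \<rho> * norm x" unfolding \<rho>_def by (intro mult_right_mono) auto
    finally show ?thesis using \<rho> by (simp add: c_def field_simps)
  qed
  define S where "S = (\<lambda>n \<omega>. \<Sum>j=1..n. innovation c j \<omega>)"
  obtain V where "\<And>n. integrable \<Omega> (\<lambda>\<omega>. (S n \<omega>)\<^sup>2)" "\<And>n. expectation (\<lambda>\<omega>. (S n \<omega>)\<^sup>2) \<le> real n * V"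
    using innovation_sum_second_moment c_meas c_le unfolding S_def by blast
  then obtain R where R: "R > 0" "likely \<Omega> (\<epsilon> / 2) (\<lambda>n \<omega>. (S n \<omega>)\<^sup>2 \<le> R * real n)"
    using likely_Markov[of "\<lambda>n \<omega>. (S n \<omega>)\<^sup>2" V "\<epsilon> / 2"] \<epsilon> by auto
  define G where "G = (\<lambda>n \<omega>. \<Sum>j=1..n. F (X j \<omega>) * (select ds (X j \<omega>) \<bullet> \<theta>) - b (select ds (X j \<omega>) \<bullet> \<theta>))"
  have G_meas: "G n \<in> borel_measurable \<Omega>" for n
    unfolding G_def
  proof (rule borel_measurable_sum)
    fix j assume "j \<in> {1..n}"
    then have [measurable]: "X j \<in> borel_measurable \<Omega>" by (intro X_meas) auto
    show "(\<lambda>\<omega>. F (X j \<omega>) * (select ds (X j \<omega>) \<bullet> \<theta>) - b (select ds (X j \<omega>) \<bullet> \<theta>)) \<in> borel_measurable \<Omega>"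
      by measurable
  qed
  have G: "likely \<Omega> (\<epsilon> / 2) (\<lambda>n \<omega>. \<bar>1 / real n * G n \<omega> - H\<^sub>0 \<theta>\<bar> \<le> \<delta> / 2)"
  proof (rule likely_if_conv_to_0_in_prob[where N = 0])
    show "conv_to_0_in_prob \<Omega> (\<lambda>n \<omega>. 1 / real n * G n \<omega> - H\<^sub>0 \<theta>)"
      using A4[OF \<theta>] by (simp add: G_def)
    show "(\<lambda>\<omega>. 1 / real n * G n \<omega> - H\<^sub>0 \<theta>) \<in> borel_measurable \<Omega>" for n
      using G_meas by measurable
  qed (use \<epsilon> \<delta> in auto)
  \<comment> \<open>Chosen so that \<open>\<rho>\<^sup>2 * (R * real n)\<close> is at most
    \<open>(\<delta> / 2 * real n)\<^sup>2\<close> from \<open>N\<close> on.\<close>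
  obtain N :: nat where N: "R * (2 * \<rho> / \<delta>)\<^sup>2 < real N" using reals_Archimedean2 by blast
  have "likely \<Omega> (\<epsilon> / 2 + \<epsilon> / 2) (\<lambda>n \<omega>. \<bar>H n \<theta> \<omega> - real n * H\<^sub>0 \<theta>\<bar> \<le> \<delta> * real n)"
  proof (rule likely_mono[OF likely_conj[OF R(2) G], of "max 1 N"])
    fix n \<omega> assume n': "max 1 N \<le> n"
      and ev: "(S n \<omega>)\<^sup>2 \<le> R * real n \<and> \<bar>1 / real n * G n \<omega> - H\<^sub>0 \<theta>\<bar> \<le> \<delta> / 2"
    have n: "0 < real n" "real N \<le> real n" using n' by auto
    have "H n \<theta> \<omega> = \<rho> * S n \<omega> + G n \<omega>"
      unfolding quasi_loglik_def S_def G_def sum_distrib_left sum.distrib[symmetric]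
      using \<rho> by (intro sum.cong refl) (simp add: innovation_def c_def field_simps)
    moreover have "\<bar>G n \<omega> - real n * H\<^sub>0 \<theta>\<bar> \<le> \<delta> / 2 * real n"
    proof -
      have "G n \<omega> - real n * H\<^sub>0 \<theta> = real n * (1 / real n * G n \<omega> - H\<^sub>0 \<theta>)"
        using n by (simp add: field_simps)
      then show ?thesis using ev n by (simp add: abs_mult)
    qed
    moreover have "\<bar>\<rho> * S n \<omega>\<bar> \<le> \<delta> / 2 * real n"
    proof (rule power2_le_imp_le)
      have "\<bar>\<rho> * S n \<omega>\<bar>\<^sup>2 \<le> \<rho>\<^sup>2 * (R * real n)"
        using ev by (simp add: power_mult_distrib mult_left_mono)
      also have "\<dots> = (\<delta> / 2)\<^sup>2 * real n * (R * (2 * \<rho> / \<delta>)\<^sup>2)"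
        using \<delta> by (simp add: field_simps power2_eq_square)
      also have "\<dots> \<le> (\<delta> / 2)\<^sup>2 * real n * real n"
        using N n by (intro mult_left_mono) auto
      finally show "\<bar>\<rho> * S n \<omega>\<bar>\<^sup>2 \<le> (\<delta> / 2 * real n)\<^sup>2"
        by (simp add: power2_eq_square mult_ac)
    qed (use n \<delta> in auto)
    ultimately show "\<bar>H n \<theta> \<omega> - real n * H\<^sub>0 \<theta>\<bar> \<le> \<delta> * real n"
      by linarith
  qed
  then show ?thesis by simp
qed

end

section \<open>Comparison of two models\<close>

theorem theorem3p4:
  fixes \<Omega> :: "'w measure"
    and X :: "nat \<Rightarrow> 'w \<Rightarrow> real ^ 'p::finite"
    and Y :: "nat \<Rightarrow> 'w \<Rightarrow> real"
    and b :: "real \<Rightarrow> real"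
    and F :: "real ^ 'p \<Rightarrow> real"
    and \<nu> :: "(real ^ 'p) measure"
    and M :: nat
    and d :: "nat \<Rightarrow> 'p list"
    and \<Theta> :: "nat \<Rightarrow> real vec set"
    and \<theta>hat :: "nat \<Rightarrow> nat \<Rightarrow> 'w \<Rightarrow> real vec"
    and \<theta>\<^sub>0 :: "nat \<Rightarrow> real vec"
    and m\<^sub>0 m :: nat
  assumes "prob_space \<Omega>"
    and "\<And>j. j \<ge> 1 \<Longrightarrow> X j \<in> borel_measurable \<Omega>"
    and "\<And>j. j \<ge> 1 \<Longrightarrow> Y j \<in> borel_measurable \<Omega>"
    and "C3_function b" and "convex_on UNIV b"
    and "\<And>i. i \<in> {1..M} \<Longrightarrow> distinct (d i) \<and> d i \<noteq> []"
    and "\<And>i. i \<in> {1..M} \<Longrightarrow> bounded_convex_domain (length (d i)) (\<Theta> i)"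
    and "\<And>i n. i \<in> {1..M} \<Longrightarrow> n \<ge> 1 \<Longrightarrow> is_QMLE \<Omega> b X Y (d i) (\<Theta> i) n (\<theta>hat i n)"
    and "\<And>i. i \<in> {1..M} \<Longrightarrow> unique_maximizer (quasi_loglik0 b F \<nu> (d i)) (\<Theta> i) (\<theta>\<^sub>0 i)"
    and A1: "condition_A1 \<Omega> b X Y"
    and A2: "condition_A2 \<Omega> X Y F"
    and A3: "condition_A3 \<Omega> X Y"
    and A4: "condition_A4 \<Omega> b X F \<nu> M d \<Theta>"
    and A5: "condition_A5 \<Omega> b X M d \<Theta>"
    and A6: "condition_A6 \<Omega> b X F M d \<theta>\<^sub>0"
    and "m\<^sub>0 \<in> {1..M}"
    and "optimal_model M (\<lambda>i. quasi_loglik0 b F \<nu> (d i) (\<theta>\<^sub>0 i)) (\<lambda>i. length (d i)) m\<^sub>0"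
    and "\<exists>!i. i \<in> {1..M} \<and>
           optimal_model M (\<lambda>i. quasi_loglik0 b F \<nu> (d i) (\<theta>\<^sub>0 i)) (\<lambda>i. length (d i)) i"
    and "m \<in> {1..M} - {m\<^sub>0}"
    and "nested_in \<Omega> (length (d m\<^sub>0)) (\<Theta> m\<^sub>0) (quasi_loglik b X Y (d m\<^sub>0))
                      (length (d m)) (\<Theta> m) (quasi_loglik b X Y (d m))
         \<or> (\<forall>\<theta>\<in>\<Theta> m. quasi_loglik0 b F \<nu> (d m) \<theta> \<noteq> quasi_loglik0 b F \<nu> (d m\<^sub>0) (\<theta>\<^sub>0 m\<^sub>0))"
  shows "(\<lambda>n. \<P>(\<omega> in \<Omega>. QBIC b X Y (d m\<^sub>0) n (\<theta>hat m\<^sub>0 n) \<omega>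
                         - QBIC b X Y (d m) n (\<theta>hat m n) \<omega> < 0)) \<longlonglongrightarrow> 1"
proof -
  let ?v = "\<lambda>i. quasi_loglik0 b F \<nu> (d i) (\<theta>\<^sub>0 i)"
  let ?H = "\<lambda>i. quasi_loglik b X Y (d i)"
  let ?H\<^sub>0 = "\<lambda>i. quasi_loglik0 b F \<nu> (d i)"
  let ?k = "\<lambda>i. real (length (d i))"
  have model: "quasi_glm_model \<Omega> X Y b F (d i) (\<Theta> i) (\<theta>hat i) (\<theta>\<^sub>0 i) (?H\<^sub>0 i)"
    if i: "i \<in> {1..M}" for i
  proof -
    have "\<theta>\<^sub>0 i \<in> \<Theta> i"
      using assms(9)[OF i] by (auto simp: unique_maximizer_def is_arg_max_def)
    moreover have "quasi_glm \<Omega> X Y b F"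
      using assms(1-4) A1 A2 by (intro quasi_glm.intro quasi_glm_axioms.intro)
    ultimately show ?thesis
      using assms(6-8)[OF i] A4[unfolded condition_A4_def] A5[unfolded condition_A5_def]
        A6[unfolded condition_A6_def] i
      by (intro quasi_glm_model.intro quasi_glm_model_axioms.intro) blast+
  qed
  have m: "m \<in> {1..M}" and m\<^sub>0: "m\<^sub>0 \<in> {1..M}" using assms by auto
  interpret I: quasi_glm_model \<Omega> X Y b F "d m\<^sub>0" "\<Theta> m\<^sub>0" "\<theta>hat m\<^sub>0" "\<theta>\<^sub>0 m\<^sub>0" "?H\<^sub>0 m\<^sub>0"
    by (rule model[OF m\<^sub>0])
  interpret J: quasi_glm_model \<Omega> X Y b F "d m" "\<Theta> m" "\<theta>hat m" "\<theta>\<^sub>0 m" "?H\<^sub>0 m"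
    by (rule model[OF m])
  have "is_arg_max ?v (\<lambda>i. i \<in> {1..M}) m\<^sub>0"
    using assms(17) by (auto simp: optimal_model_def is_arg_min_def)
  then have vm: "?v m \<le> ?v m\<^sub>0" using m by (auto simp: is_arg_max_def not_less)
  \<comment> \<open>The leading part of the difference of the two criteria: estimators replaced by
    \<open>\<theta>\<^sub>0\<close>, log-determinants by dimension times
    \<open>ln (real n)\<close>.\<close>
  define U where "U = (\<lambda>n \<omega>. - 2 * (?H m\<^sub>0 n (\<theta>\<^sub>0 m\<^sub>0) \<omega> - ?H m n (\<theta>\<^sub>0 m) \<omega>)
    + (?k m\<^sub>0 - ?k m) * ln (real n))"
  have U: "likely \<Omega> \<epsilon> (\<lambda>n \<omega>. U n \<omega> + C < 0)" if \<epsilon>: "\<epsilon> > 0" for \<epsilon> C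
    using assms(20)
  proof
    assume "nested_in \<Omega> (length (d m\<^sub>0)) (\<Theta> m\<^sub>0) (?H m\<^sub>0) (length (d m)) (\<Theta> m) (?H m)"
    then obtain A c where less: "length (d m\<^sub>0) < length (d m)"
      and nest: "\<And>\<theta>. \<theta> \<in> \<Theta> m\<^sub>0 \<Longrightarrow> A *\<^sub>v \<theta> + c \<in> \<Theta> m"
        "\<And>\<theta> n. \<theta> \<in> \<Theta> m\<^sub>0 \<Longrightarrow> AE \<omega> in \<Omega>. ?H m\<^sub>0 n \<theta> \<omega> = ?H m n (A *\<^sub>v \<theta> + c) \<omega>"
      unfolding nested_in_def by blast
    \<comment> \<open>The optimal parameter of the small model, embedded into the large one. It will
      turn out to be the optimal parameter there.\<close>
    define \<theta>' where "\<theta>' = A *\<^sub>v \<theta>\<^sub>0 m\<^sub>0 + c"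
    have \<theta>': "\<theta>' \<in> \<Theta> m" using nest(1)[OF I.\<theta>\<^sub>0] by (simp add: \<theta>'_def)
    have eq: "likely \<Omega> \<epsilon>' (\<lambda>n \<omega>. ?H m\<^sub>0 n (\<theta>\<^sub>0 m\<^sub>0) \<omega> = ?H m n \<theta>' \<omega>)" if "\<epsilon>' > 0" for \<epsilon>'
      unfolding \<theta>'_def by (rule I.likely_AE) (use nest(2)[OF I.\<theta>\<^sub>0] that in auto)
    have "\<bar>?v m\<^sub>0 - ?H\<^sub>0 m \<theta>'\<bar> \<le> \<delta>" if \<delta>: "\<delta> > 0" for \<delta>
    proof -
      have h: "\<delta> / 2 > 0" using \<delta> by simp
      \<comment> \<open>Three events failing with probability at most 1/4 each have a common point
        for all large \<open>n\<close>. At such a point both limits are compared with the same value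
        of the likelihood.\<close>
      have q: "(1 / 4 :: real) > 0" by simp
      obtain N where N: "\<And>n. n \<ge> N \<Longrightarrow> \<exists>\<omega>\<in>space \<Omega>.
          (\<bar>?H m\<^sub>0 n (\<theta>\<^sub>0 m\<^sub>0) \<omega> - real n * ?v m\<^sub>0\<bar> \<le> \<delta> / 2 * real n \<and>
           \<bar>?H m n \<theta>' \<omega> - real n * ?H\<^sub>0 m \<theta>'\<bar> \<le> \<delta> / 2 * real n) \<and>
          ?H m\<^sub>0 n (\<theta>\<^sub>0 m\<^sub>0) \<omega> = ?H m n \<theta>' \<omega>"
        using I.likely_not_False[OF I.likely_conj[OF I.likely_conj[OF
              I.loglik_law_of_large_numbers[OF I.\<theta>\<^sub>0 q h] J.loglik_law_of_large_numbers[OF \<theta>' q h]] eq[OF q]]]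
        by auto
      define n where "n = max 1 N"
      have n: "real n > 0" "n \<ge> N" by (auto simp: n_def)
      obtain \<omega> where "\<bar>?H m n \<theta>' \<omega> - real n * ?v m\<^sub>0\<bar> \<le> \<delta> / 2 * real n"
        "\<bar>?H m n \<theta>' \<omega> - real n * ?H\<^sub>0 m \<theta>'\<bar> \<le> \<delta> / 2 * real n"
        using N[OF n(2)] by metis
      then have "\<bar>real n * ?v m\<^sub>0 - real n * ?H\<^sub>0 m \<theta>'\<bar> \<le> \<delta> * real n"
        by (simp only: abs_le_iff) (simp add: field_simps)
      then have "real n * \<bar>?v m\<^sub>0 - ?H\<^sub>0 m \<theta>'\<bar> \<le> real n * \<delta>"
        using n by (simp add: abs_mult right_diff_distrib[symmetric] mult.commute)
      then show ?thesis using n by simp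
    qed
    then have "\<bar>?v m\<^sub>0 - ?H\<^sub>0 m \<theta>'\<bar> \<le> 0"
      by (rule field_le_epsilon) simp
    then have "?H\<^sub>0 m \<theta>' = ?v m\<^sub>0" by simp
    \<comment> \<open>The value at \<open>\<theta>'\<close> equals \<open>?v m\<^sub>0\<close>,
      which is at least \<open>?v m\<close>, the maximum over \<open>\<Theta> m\<close>. So
      \<open>\<theta>'\<close> is a maximizer as well, and uniqueness identifies it with
      \<open>\<theta>\<^sub>0 m\<close>.\<close>
    then have "is_arg_max (?H\<^sub>0 m) (\<lambda>z. z \<in> \<Theta> m) \<theta>'"
      using assms(9)[OF m] vm \<theta>' by (force simp: unique_maximizer_def is_arg_max_def)
    then have \<theta>'_eq: "\<theta>' = \<theta>\<^sub>0 m" using assms(9)[OF m] by (simp add: unique_maximizer_def)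
    \<comment> \<open>The likelihoods in \<open>U\<close> cancel and the dimensions differ by at
      least 1, so \<open>C < ln (real n)\<close> is enough.\<close>
    obtain N :: nat where N: "exp C < real N" using reals_Archimedean2 by blast
    show "likely \<Omega> \<epsilon> (\<lambda>n \<omega>. U n \<omega> + C < 0)"
    proof (rule I.likely_mono[OF eq[OF \<epsilon>], of "max 1 N"])
      fix n \<omega> assume n: "max 1 N \<le> n" and "?H m\<^sub>0 n (\<theta>\<^sub>0 m\<^sub>0) \<omega> = ?H m n \<theta>' \<omega>"
      then have "U n \<omega> = (?k m\<^sub>0 - ?k m) * ln (real n)" by (simp add: U_def \<theta>'_eq)
      also have "\<dots> \<le> - 1 * ln (real n)"
        using n less by (intro mult_right_mono) auto
      finally have "U n \<omega> \<le> - ln (real n)" by simp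
      moreover have "C < ln (real n)"
      proof -
        have "exp C < real n" using N n by (auto intro: less_le_trans)
        then show ?thesis using n by (metis exp_less_cancel_iff exp_gt_zero exp_ln order.strict_trans)
      qed
      ultimately show "U n \<omega> + C < 0" by simp
    qed
  next
    assume "\<forall>\<theta>\<in>\<Theta> m. ?H\<^sub>0 m \<theta> \<noteq> ?v m\<^sub>0"
    \<comment> \<open>\<open>?v m\<close> is itself a value of the limit on
      \<open>\<Theta> m\<close>, so it differs from \<open>?v m\<^sub>0\<close>, and it is not
      larger.\<close>
    then have "?v m < ?v m\<^sub>0" using vm J.\<theta>\<^sub>0 by force
    define \<Delta> where "\<Delta> = ?v m\<^sub>0 - ?v m"
    have \<Delta>: "\<Delta> > 0" using \<open>?v m < ?v m\<^sub>0\<close> by (simp add: \<Delta>_def)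
    \<comment> \<open>Two errors of \<open>\<Delta> / 4 * real n\<close>, doubled by the factor
      \<open>- 2\<close>, use up half of the gain \<open>2 * \<Delta> * real n\<close>; the
      remaining \<open>\<Delta> * real n\<close> outweighs the logarithm and
      \<open>C\<close>.\<close>
    have \<Delta>4: "\<Delta> / 4 > 0" and \<epsilon>2: "\<epsilon> / 2 > 0" using \<Delta> \<epsilon> by auto
    have "(\<lambda>n. ?k m\<^sub>0 * (ln (real n) / real n) + C * (1 / real n)) \<longlonglongrightarrow> ?k m\<^sub>0 * 0 + C * 0"
      by (intro tendsto_intros lim_ln_over_n lim_1_over_n)
    then have "\<forall>\<^sub>F n in sequentially. ?k m\<^sub>0 * (ln (real n) / real n) + C * (1 / real n) < \<Delta>"
      using \<Delta> by (intro order_tendstoD(2)[of _ 0]) auto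
    then obtain N where N: "\<And>n. n \<ge> N \<Longrightarrow> ?k m\<^sub>0 * (ln (real n) / real n) + C * (1 / real n) < \<Delta>"
      unfolding eventually_sequentially by blast
    have "likely \<Omega> (\<epsilon> / 2 + \<epsilon> / 2) (\<lambda>n \<omega>. U n \<omega> + C < 0)"
    proof (rule I.likely_mono[OF I.likely_conj[OF
            I.loglik_law_of_large_numbers[OF I.\<theta>\<^sub>0 \<epsilon>2 \<Delta>4] J.loglik_law_of_large_numbers[OF J.\<theta>\<^sub>0 \<epsilon>2 \<Delta>4]],
            of "max 1 N"])
      fix n \<omega> assume n': "max 1 N \<le> n" and
        ev: "\<bar>?H m\<^sub>0 n (\<theta>\<^sub>0 m\<^sub>0) \<omega> - real n * ?v m\<^sub>0\<bar> \<le> \<Delta> / 4 * real n \<and>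
           \<bar>?H m n (\<theta>\<^sub>0 m) \<omega> - real n * ?v m\<bar> \<le> \<Delta> / 4 * real n"
      have n: "real n \<ge> 1" "n \<ge> N" using n' by auto
      have "real n * ?v m\<^sub>0 - real n * ?v m = real n * \<Delta>" by (simp add: \<Delta>_def right_diff_distrib)
      then have "- 2 * (?H m\<^sub>0 n (\<theta>\<^sub>0 m\<^sub>0) \<omega> - ?H m n (\<theta>\<^sub>0 m) \<omega>) \<le> - (real n * \<Delta>)"
        using ev by (simp only: abs_le_iff) (simp add: field_simps)
      moreover have "(?k m\<^sub>0 - ?k m) * ln (real n) \<le> ?k m\<^sub>0 * ln (real n)"
        using n by (intro mult_right_mono) auto
      moreover have "?k m\<^sub>0 * ln (real n) + C < real n * \<Delta>"
        using N[OF n(2)] n(1) by (simp add: field_simps)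
      ultimately show "U n \<omega> + C < 0" by (simp add: U_def)
    qed
    then show "likely \<Omega> \<epsilon> (\<lambda>n \<omega>. U n \<omega> + C < 0)" by simp
  qed
  show ?thesis
  proof (rule I.tendsto_one_if_likely[where N\<^sub>0 = 1])
    fix n :: nat assume n: "n \<ge> 1"
    note [measurable] = I.QBIC_meas[OF n] J.QBIC_meas[OF n]
    show "{\<omega>\<in>space \<Omega>. QBIC b X Y (d m\<^sub>0) n (\<theta>hat m\<^sub>0 n) \<omega> - QBIC b X Y (d m) n (\<theta>hat m n) \<omega> < 0} \<in> sets \<Omega>"
      by measurable
  next
    fix \<epsilon> :: real assume "\<epsilon> > 0"
    then have \<epsilon>3: "\<epsilon> / 3 > 0" by simp
    obtain R\<^sub>0 where R\<^sub>0: "likely \<Omega> (\<epsilon> / 3) (\<lambda>n \<omega>. ?H m\<^sub>0 n (\<theta>\<^sub>0 m\<^sub>0) \<omega> \<le> ?H m\<^sub>0 n (\<theta>hat m\<^sub>0 n \<omega>) \<omega> \<and>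
        ?H m\<^sub>0 n (\<theta>hat m\<^sub>0 n \<omega>) \<omega> \<le> ?H m\<^sub>0 n (\<theta>\<^sub>0 m\<^sub>0) \<omega> + R\<^sub>0 \<and>
        \<bar>ln (Determinant.det (I.gram_hat n \<omega>)) - ?k m\<^sub>0 * ln (real n)\<bar> \<le> R\<^sub>0)"
      using I.QMLE_expansion[OF \<epsilon>3] by blast
    obtain R where R: "likely \<Omega> (\<epsilon> / 3) (\<lambda>n \<omega>. ?H m n (\<theta>\<^sub>0 m) \<omega> \<le> ?H m n (\<theta>hat m n \<omega>) \<omega> \<and>
        ?H m n (\<theta>hat m n \<omega>) \<omega> \<le> ?H m n (\<theta>\<^sub>0 m) \<omega> + R \<and>
        \<bar>ln (Determinant.det (J.gram_hat n \<omega>)) - ?k m * ln (real n)\<bar> \<le> R)"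
      using J.QMLE_expansion[OF \<epsilon>3] by blast
    have "likely \<Omega> (\<epsilon> / 3 + \<epsilon> / 3 + \<epsilon> / 3) (\<lambda>n \<omega>.
      QBIC b X Y (d m\<^sub>0) n (\<theta>hat m\<^sub>0 n) \<omega> - QBIC b X Y (d m) n (\<theta>hat m n) \<omega> < 0)"
    \<comment> \<open>In \<open>R\<^sub>0 + 3 * R\<close>, the likelihood of model \<open>m\<close>
      at its estimator accounts for \<open>2 * R\<close> and the two log-determinants for
      \<open>R\<^sub>0\<close> and \<open>R\<close>. For \<open>m\<^sub>0\<close> the likelihood
      error has the favourable sign.\<close>
    proof (rule I.likely_mono[OF I.likely_conj[OF I.likely_conj[OF R\<^sub>0 R] U[OF \<epsilon>3, of "R\<^sub>0 + 3 * R"]], of 0])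
      fix n \<omega>
      let ?D\<^sub>0 = "ln (Determinant.det (I.gram_hat n \<omega>))" and ?D = "ln (Determinant.det (J.gram_hat n \<omega>))"
      assume ev: "((?H m\<^sub>0 n (\<theta>\<^sub>0 m\<^sub>0) \<omega> \<le> ?H m\<^sub>0 n (\<theta>hat m\<^sub>0 n \<omega>) \<omega> \<and>
          ?H m\<^sub>0 n (\<theta>hat m\<^sub>0 n \<omega>) \<omega> \<le> ?H m\<^sub>0 n (\<theta>\<^sub>0 m\<^sub>0) \<omega> + R\<^sub>0 \<and>
          \<bar>?D\<^sub>0 - ?k m\<^sub>0 * ln (real n)\<bar> \<le> R\<^sub>0) \<and>
        (?H m n (\<theta>\<^sub>0 m) \<omega> \<le> ?H m n (\<theta>hat m n \<omega>) \<omega> \<and>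
          ?H m n (\<theta>hat m n \<omega>) \<omega> \<le> ?H m n (\<theta>\<^sub>0 m) \<omega> + R \<and>
          \<bar>?D - ?k m * ln (real n)\<bar> \<le> R)) \<and> U n \<omega> + (R\<^sub>0 + 3 * R) < 0"
      then have "?H m\<^sub>0 n (\<theta>\<^sub>0 m\<^sub>0) \<omega> \<le> ?H m\<^sub>0 n (\<theta>hat m\<^sub>0 n \<omega>) \<omega>"
        "?H m n (\<theta>hat m n \<omega>) \<omega> \<le> ?H m n (\<theta>\<^sub>0 m) \<omega> + R"
        "?D\<^sub>0 - ?k m\<^sub>0 * ln (real n) \<le> R\<^sub>0" "?k m * ln (real n) - ?D \<le> R"
        "- 2 * (?H m\<^sub>0 n (\<theta>\<^sub>0 m\<^sub>0) \<omega> - ?H m n (\<theta>\<^sub>0 m) \<omega>)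
          + (?k m\<^sub>0 * ln (real n) - ?k m * ln (real n)) + (R\<^sub>0 + 3 * R) < 0"
        by (auto simp: U_def left_diff_distrib)
      then show "QBIC b X Y (d m\<^sub>0) n (\<theta>hat m\<^sub>0 n) \<omega> - QBIC b X Y (d m) n (\<theta>hat m n) \<omega> < 0"
        unfolding I.QBIC_gram_hat J.QBIC_gram_hat by argo
    qed
    then show "likely \<Omega> \<epsilon> (\<lambda>n \<omega>.
      QBIC b X Y (d m\<^sub>0) n (\<theta>hat m\<^sub>0 n) \<omega> - QBIC b X Y (d m) n (\<theta>hat m n) \<omega> < 0)"
      by simp
  qed
qed

end
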